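(* Let $\Omega\subset\mathbb{R}^3$ be a bounded open set with Lipschitz boundary and let $f:S^2\times S^2\to\mathbb{R}$ be a bounded function with $f(u,v)=f(v,u)$ and $f(u,v)=f(u,-v)=f(-u,v)$ for all $u,v\in S^2$. Let $F_\varepsilon:L^\infty(\Omega;\mathbb{M}^{3\times3}_{sym})\to\mathbb{R}\cup\{\infty\}$ be defined by $$F_\varepsilon(Q)=\sum_{|i-j|=1}\varepsilon^3f(u_i,u_j)+\frac14\sum_{|i-j|=\sqrt2}\varepsilon^3f(u_i,u_j)$$ if $Q\in C_\varepsilon(\Omega;S^2_\otimes)$, $Q(\varepsilon i)=u_i\otimes u_i$ ($u_i\in S^2$, $i\in\mathbb{Z}_\varepsilon(\Omega)$), and $F_\varepsilon(Q)=+\infty$ otherwise. For $Q\in K$ set $$\widehat f(Q)=\inf\Bigl\{\sum_{1\le i<j\le4}f(u_i,u_j):\ u_1,\dots,u_4\in S^2,\ \frac14\sum_{i=1}^4u_i\otimes u_i=Q\Bigr\}.$$ Then, as $\varepsilon\to0$, $F_\varepsilon$ $\Gamma$-converges with respect to the weak$^*$ topology of $L^\infty(\Omega;\mathbb{M}^{3\times3}_{sym})$ to the functional $F$ defined by $$F(Q)=\frac32\int_\Omega\widehat f^{**}(Q(x))\,dx\ \text{ if }Q\in L^\infty(\Omega;K),\qquad F(Q)=+\infty\ \text{ otherwise.}$$ In particular $f_{\rm hom}=\frac32\widehat f^{**}$ on $K$, where $f_{\rm hom}$ is the homogenized energy density recalled in the context.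
   Context: $\mathbb{M}^{3\times3}_{sym}$ is the space of symmetric $3\times3$ real matrices with the Frobenius norm, $K=\{Q\in\mathbb{M}^{3\times3}_{sym}:Q\ge0,\ \mathrm{tr}\,Q=1\}$, $S^2_\otimes=\{v\otimes v:v\in S^2\}$. $\mathbb{Z}_\varepsilon(\Omega)=\{i\in\mathbb{Z}^3:\varepsilon i\in\Omega\}$, $W_3=[-\frac12,\frac12)^3$, and $C_\varepsilon(\Omega;S^2_\otimes)=\{Q:\Omega\to S^2_\otimes:\ Q(x)=Q(\varepsilon i)\text{ if }x\in\varepsilon\{i+W_3\},\ i\in\mathbb{Z}_\varepsilon(\Omega)\}$. Sums over $|i-j|=1$ and $|i-j|=\sqrt2$ run over all ordered pairs $(i,j)\in\mathbb{Z}_\varepsilon(\Omega)^2$ with the indicated distance (each unordered pair is counted twice). Every $Q\in K$ can be written as $\frac14\sum_{i=1}^4u_i\otimes u_i$ with $u_i\in S^2$, so $\widehat f$ is finite on $K$; it is extended by $+\infty$ outside $K$, and $\widehat f^{**}$ denotes its lower semicontinuous convex envelope. The density $f_{\rm hom}$ is, for $\bar Q\in K$, $$f_{\rm hom}(\bar Q)=\lim_{\rho\to0}\lim_{h\to+\infty}\frac1{h^3}\inf\Bigl\{\sum_{\xi\in\mathbb{Z}^3}\ \sum_{\beta\in\mathbb{Z}^3\cap hW_3,\ \beta+\xi\in hW_3}c_\xi\,f(u_\beta,u_{\beta+\xi})\Bigr\},$$ with $c_\xi=1$ if $|\xi|=1$, $c_\xi=\frac14$ if $|\xi|=\sqrt2$,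 $c_\xi=0$ otherwise, and the infimum over all $u:\mathbb{Z}^3\cap hW_3\to S^2$ such that the average of $u_\beta\otimes u_\beta$ over $\beta\in\mathbb{Z}^3\cap hW_3$ lies in the closed ball $\overline B(\bar Q,\rho)$. *)

theory Defs
  imports "HOL-Analysis.Analysis"
begin

section \<open>Matrices and Q-tensors\<close>

text \<open>The norm and the inner product of the type \<^typ>\<open>real^3^3\<close> are those of Frobenius.\<close>

definition Msym :: "(real^3^3) set" where
  "Msym = {A. transpose A = A}"

definition S2 :: "(real^3) set" where
  "S2 = sphere 0 1"

definition tensor :: "real^3 \<Rightarrow> real^3^3" where
  "tensor v = (\<chi> i j. v$i * v$j)"

definition K :: "(real^3^3) set" where
  "K = {Q \<in> Msym. (\<forall>v. 0 \<le> v \<bullet> (Q *v v)) \<and> trace Q = 1}"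


section \<open>Open sets with Lipschitz boundary\<close>

text \<open>Near each boundary point the set is, in a suitable orthonormal system of coordinates
  \<open>T\<close>, the strict supergraph of a Lipschitz function of the first two coordinates.\<close>

definition lipschitz_boundary :: "(real^3) set \<Rightarrow> bool" where
  "lipschitz_boundary \<Omega> \<longleftrightarrow>
     (\<forall>x0\<in>frontier \<Omega>. \<exists>r>0. \<exists>T L. \<exists>\<gamma> :: real \<times> real \<Rightarrow> real.
        orthogonal_transformation (T :: real^3 \<Rightarrow> real^3) \<and> L-lipschitz_on UNIV \<gamma> \<and>
        (\<forall>y\<in>ball x0 r. y \<in> \<Omega> \<longleftrightarrow> \<gamma> (T y $ 1, T y $ 2) < T y $ 3))"


section \<open>\<open>L\<^sup>\<infinity>\<close> and its weak* topology\<close>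

text \<open>Elements of \<open>L\<^sup>1\<close> and \<open>L\<^sup>\<infinity>\<close> are represented by functions, whose values
  outside \<open>\<Omega>\<close> and on null sets are irrelevant. The weak* topology below is the preimage
  of the one of the quotient modulo equality almost everywhere, and all functionals on
  \<open>L\<^sup>\<infinity>\<close> considered here are invariant under changes on null sets.\<close>

definition L1 :: "(real^3) set \<Rightarrow> (real^3 \<Rightarrow> real^3^3) set" where
  "L1 \<Omega> = {\<Phi>. integrable (lebesgue_on \<Omega>) \<Phi> \<and> (AE x in lebesgue_on \<Omega>. \<Phi> x \<in> Msym)}"

definition Linf :: "(real^3) set \<Rightarrow> (real^3 \<Rightarrow> real^3^3) set" where
  "Linf \<Omega> = {Q. Q \<in> borel_measurable (lebesgue_on \<Omega>) \<and>
     (AE x in lebesgue_on \<Omega>. Q x \<in> Msym) \<and> (\<exists>C. AE x in lebesgue_on \<Omega>. norm (Q x) \<le> C)}"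

definition weak_star :: "(real^3) set \<Rightarrow> (real^3 \<Rightarrow> real^3^3) topology" where
  "weak_star \<Omega> = topology_generated_by
     {{Q \<in> Linf \<Omega>. (LINT x|lebesgue_on \<Omega>. Q x \<bullet> \<Phi> x) \<in> U} | \<Phi> U. \<Phi> \<in> L1 \<Omega> \<and> open U}"


section \<open>\<open>\<Gamma>\<close>-convergence in a topological space\<close>

definition Gamma_liminf :: "'a topology \<Rightarrow> 'i filter \<Rightarrow> ('i \<Rightarrow> 'a \<Rightarrow> ereal) \<Rightarrow> 'a \<Rightarrow> ereal" where
  "Gamma_liminf X G \<F> x =
     (SUP U\<in>{U. openin X U \<and> x \<in> U}. Liminf G (\<lambda>\<epsilon>. INF y\<in>U. \<F> \<epsilon> y))"

definition Gamma_limsup :: "'a topology \<Rightarrow> 'i filter \<Rightarrow> ('i \<Rightarrow> 'a \<Rightarrow> ereal) \<Rightarrow> 'a \<Rightarrow> ereal" where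
  "Gamma_limsup X G \<F> x =
     (SUP U\<in>{U. openin X U \<and> x \<in> U}. Limsup G (\<lambda>\<epsilon>. INF y\<in>U. \<F> \<epsilon> y))"

definition Gamma_converges ::
  "'a topology \<Rightarrow> 'i filter \<Rightarrow> ('i \<Rightarrow> 'a \<Rightarrow> ereal) \<Rightarrow> ('a \<Rightarrow> ereal) \<Rightarrow> bool" where
  "Gamma_converges X G \<F> F \<longleftrightarrow>
     (\<forall>x\<in>topspace X. Gamma_liminf X G \<F> x = F x \<and> Gamma_limsup X G \<F> x = F x)"


section \<open>The lattice and the discrete energies\<close>

definition Z3 :: "(real^3) set" where
  "Z3 = {i. \<forall>k. i$k \<in> \<int>}"

definition W3 :: "(real^3) set" where
  "W3 = {x. \<forall>k. - 1/2 \<le> x$k \<and> x$k < 1/2}"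

definition Z_eps :: "(real^3) set \<Rightarrow> real \<Rightarrow> (real^3) set" where
  "Z_eps \<Omega> \<epsilon> = {i \<in> Z3. \<epsilon> *\<^sub>R i \<in> \<Omega>}"

definition C_eps :: "(real^3) set \<Rightarrow> real \<Rightarrow> (real^3 \<Rightarrow> real^3^3) set" where
  "C_eps \<Omega> \<epsilon> = {Q. (\<forall>x\<in>\<Omega>. Q x \<in> tensor ` S2) \<and>
     (\<forall>i\<in>Z_eps \<Omega> \<epsilon>. \<forall>x\<in>\<Omega>. x \<in> (\<lambda>w. \<epsilon> *\<^sub>R (i + w)) ` W3 \<longrightarrow> Q x = Q (\<epsilon> *\<^sub>R i))}"

definition lattice_energy ::
  "(real^3 \<Rightarrow> real^3 \<Rightarrow> real) \<Rightarrow> (real^3) set \<Rightarrow> real \<Rightarrow> (real^3 \<Rightarrow> real^3) \<Rightarrow> real" where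
  "lattice_energy f \<Omega> \<epsilon> u =
     (\<Sum>(i,j)\<in>{(i,j). i \<in> Z_eps \<Omega> \<epsilon> \<and> j \<in> Z_eps \<Omega> \<epsilon> \<and> norm (i - j) = 1}. \<epsilon>^3 * f (u i) (u j)) +
     1/4 * (\<Sum>(i,j)\<in>{(i,j). i \<in> Z_eps \<Omega> \<epsilon> \<and> j \<in> Z_eps \<Omega> \<epsilon> \<and> norm (i - j) = sqrt 2}.
              \<epsilon>^3 * f (u i) (u j))"

text \<open>The pairs of a representative of \<open>Q\<close> in \<^const>\<open>C_eps\<close> and a lift of its lattice
  values to \<^const>\<open>S2\<close>.\<close>

definition spin_lifts ::
  "(real^3) set \<Rightarrow> real \<Rightarrow> (real^3 \<Rightarrow> real^3^3) \<Rightarrow> ((real^3 \<Rightarrow> real^3^3) \<times> (real^3 \<Rightarrow> real^3)) set" where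
  "spin_lifts \<Omega> \<epsilon> Q = {(P, u). P \<in> C_eps \<Omega> \<epsilon> \<and> (AE x in lebesgue_on \<Omega>. P x = Q x) \<and>
     (\<forall>i\<in>Z_eps \<Omega> \<epsilon>. u i \<in> S2 \<and> P (\<epsilon> *\<^sub>R i) = tensor (u i))}"

text \<open>The infimum merely selects the common value of the energy on all lifts
  (lemma \<open>F_eps_eq\<close> below); it is \<open>\<infinity>\<close> when there is none, that is, when \<open>Q\<close> has no
  representative in \<^const>\<open>C_eps\<close>.\<close>

definition F_eps ::
  "(real^3 \<Rightarrow> real^3 \<Rightarrow> real) \<Rightarrow> (real^3) set \<Rightarrow> real \<Rightarrow> (real^3 \<Rightarrow> real^3^3) \<Rightarrow> ereal" where
  "F_eps f \<Omega> \<epsilon> Q = (INF (P, u)\<in>spin_lifts \<Omega> \<epsilon> Q. ereal (lattice_energy f \<Omega> \<epsilon> u))"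


section \<open>The limit energy\<close>

definition fhat :: "(real^3 \<Rightarrow> real^3 \<Rightarrow> real) \<Rightarrow> real^3^3 \<Rightarrow> ereal" where
  "fhat f Q = (if Q \<in> K then
     (INF u\<in>{u :: nat \<Rightarrow> real^3. (\<forall>i\<in>{1..4}. u i \<in> S2) \<and> (1/4) *\<^sub>R (\<Sum>i=1..4. tensor (u i)) = Q}.
        ereal (\<Sum>(i,j)\<in>{(i,j). 1 \<le> i \<and> i < j \<and> j \<le> 4}. f (u i) (u j)))
     else \<infinity>)"

definition econvex_on :: "'a::real_vector set \<Rightarrow> ('a \<Rightarrow> ereal) \<Rightarrow> bool" where
  "econvex_on S g \<longleftrightarrow> convex {(x, t::real). x \<in> S \<and> g x \<le> ereal t}"

definition lsc_on :: "'a::topological_space set \<Rightarrow> ('a \<Rightarrow> ereal) \<Rightarrow> bool" where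
  "lsc_on S g \<longleftrightarrow> (\<forall>x\<in>S. g x \<le> Liminf (at x within S) g)"

definition lsc_convex_envelope :: "'a::real_normed_vector set \<Rightarrow> ('a \<Rightarrow> ereal) \<Rightarrow> 'a \<Rightarrow> ereal" where
  "lsc_convex_envelope S g x =
     (SUP h\<in>{h. econvex_on S h \<and> lsc_on S h \<and> (\<forall>y\<in>S. h y \<le> g y)}. h x)"

text \<open>For bounded \<open>f\<close> the envelope is finite and bounded on \<^const>\<open>K\<close>, and lower
  semicontinuous, so that the integral below is one of a bounded measurable function.\<close>

definition F_lim ::
  "(real^3 \<Rightarrow> real^3 \<Rightarrow> real) \<Rightarrow> (real^3) set \<Rightarrow> (real^3 \<Rightarrow> real^3^3) \<Rightarrow> ereal" where
  "F_lim f \<Omega> Q = (if Q \<in> Linf \<Omega> \<and> (AE x in lebesgue_on \<Omega>. Q x \<in> K) then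
     ereal (3/2 * (LINT x|lebesgue_on \<Omega>. real_of_ereal (lsc_convex_envelope Msym (fhat f) (Q x))))
     else \<infinity>)"


section \<open>The homogenized energy density\<close>

definition c_weight :: "real^3 \<Rightarrow> real" where
  "c_weight \<xi> = (if norm \<xi> = 1 then 1 else if norm \<xi> = sqrt 2 then 1/4 else 0)"

definition cube_sites :: "real \<Rightarrow> (real^3) set" where
  "cube_sites h = Z3 \<inter> (\<lambda>w. h *\<^sub>R w) ` W3"

text \<open>The double sum over \<open>\<xi>\<close> and \<open>\<beta>\<close> is written over the set of pairs, which is finite.\<close>

definition cube_energy ::
  "(real^3 \<Rightarrow> real^3 \<Rightarrow> real) \<Rightarrow> real \<Rightarrow> (real^3 \<Rightarrow> real^3) \<Rightarrow> real" where
  "cube_energy f h u =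
     (\<Sum>(\<xi>,\<beta>)\<in>{(\<xi>,\<beta>). \<xi> \<in> Z3 \<and> \<beta> \<in> cube_sites h \<and> \<beta> + \<xi> \<in> (\<lambda>w. h *\<^sub>R w) ` W3}.
        c_weight \<xi> * f (u \<beta>) (u (\<beta> + \<xi>)))"

definition cube_min ::
  "(real^3 \<Rightarrow> real^3 \<Rightarrow> real) \<Rightarrow> real^3^3 \<Rightarrow> real \<Rightarrow> real \<Rightarrow> ereal" where
  "cube_min f Q \<rho> h =
     (INF u\<in>{u. (\<forall>\<beta>\<in>cube_sites h. u \<beta> \<in> S2) \<and>
               (1 / real (card (cube_sites h))) *\<^sub>R (\<Sum>\<beta>\<in>cube_sites h. tensor (u \<beta>)) \<in> cball Q \<rho>}.
        ereal (cube_energy f h u))"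

text \<open>\<open>has_f_hom f Q l\<close>: the iterated limit defining the density at \<open>Q\<close> exists and equals \<open>l\<close>.\<close>

definition has_f_hom :: "(real^3 \<Rightarrow> real^3 \<Rightarrow> real) \<Rightarrow> real^3^3 \<Rightarrow> ereal \<Rightarrow> bool" where
  "has_f_hom f Q l \<longleftrightarrow>
     (\<exists>g. (\<forall>\<rho>>0. ((\<lambda>h. cube_min f Q \<rho> h / ereal (h^3)) \<longlongrightarrow> g \<rho>) at_top) \<and>
          (g \<longlongrightarrow> l) (at_right 0))"


section \<open>Well-definedness of the discrete energies\<close>

lemma tensor_eq_imp:
  assumes "u \<in> S2" "v \<in> S2" "tensor u = tensor v"
  shows "u = v \<or> u = - v"
proof -
  have e: "u$i * u$j = v$i * v$j" for i j
    using arg_cong[OF assms(3), of "\<lambda>A. A$i$j"] by (simp add: tensor_def)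
  have "(u \<bullet> v)^2 = (\<Sum>i\<in>UNIV. \<Sum>j\<in>UNIV. (u$i * u$j) * (v$i * v$j))"
    by (simp add: inner_vec_def power2_eq_square sum_product algebra_simps)
  also have "\<dots> = (\<Sum>i\<in>UNIV. \<Sum>j\<in>UNIV. (v$i * v$j) * (v$i * v$j))"
    by (simp only: e)
  also have "\<dots> = (v \<bullet> v)^2"
    by (simp add: inner_vec_def power2_eq_square sum_product algebra_simps)
  finally have "(u \<bullet> v)^2 = 1"
    using assms(2) by (simp add: S2_def dot_square_norm)
  then have "u \<bullet> v = 1 \<or> u \<bullet> v = -1"
    by (simp add: power2_eq_1_iff)
  moreover have "u \<bullet> u = 1" "v \<bullet> v = 1"
    using assms by (simp_all add: S2_def dot_square_norm)
  ultimately have "(u - v) \<bullet> (u - v) = 0 \<or> (u + v) \<bullet> (u + v) = 0"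
    by (auto simp: inner_diff_left inner_diff_right inner_add_left inner_add_right inner_commute)
  then show ?thesis
    by (auto simp: eq_neg_iff_add_eq_0)
qed

lemma C_eps_AE_eq:
  assumes "open \<Omega>" "\<epsilon> > 0" "P \<in> C_eps \<Omega> \<epsilon>" "P' \<in> C_eps \<Omega> \<epsilon>"
    and ae: "AE x in lebesgue_on \<Omega>. P x = P' x" and i: "i \<in> Z_eps \<Omega> \<epsilon>"
  shows "P (\<epsilon> *\<^sub>R i) = P' (\<epsilon> *\<^sub>R i)"
proof -
  define A where "A = \<Omega> \<inter> ball (\<epsilon> *\<^sub>R i) (\<epsilon>/2)"
  have A: "open A" "A \<noteq> {}"
    using assms by (auto simp: A_def Z_eps_def intro!: exI[of _ "\<epsilon> *\<^sub>R i"])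
  have om: "\<Omega> \<in> sets lebesgue"
    using assms(1) by (simp add: borel_open)
  have "AE x in lebesgue. x \<in> \<Omega> \<longrightarrow> P x = P' x"
    using ae om by (simp add: AE_restrict_space_iff)
  then obtain N where N: "N \<in> null_sets lebesgue" "{x. \<not> (x \<in> \<Omega> \<longrightarrow> P x = P' x)} \<subseteq> N"
    by (rule AE_E3) auto
  obtain y r where "r > 0" "ball y r \<subseteq> A"
    using A by (metis all_not_in_conv open_contains_ball)
  moreover have "\<not> negligible (ball y r)"
    using \<open>r > 0\<close> negligible_convex_interior[OF convex_ball, of y r]
    by (simp add: interior_open)
  ultimately have "\<not> A \<subseteq> N"
    using N(1) negligible_subset negligible_iff_null_sets by (metis subset_trans)
  then obtain x where x: "x \<in> A" "x \<notin> N"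
    by blast
  then have x: "x \<in> A" "P x = P' x"
    using N(2) unfolding A_def by blast+
  have "x \<in> (\<lambda>w. \<epsilon> *\<^sub>R (i + w)) ` W3"
  proof
    show "x = \<epsilon> *\<^sub>R (i + (x /\<^sub>R \<epsilon> - i))"
      using assms(2) by simp
    show "x /\<^sub>R \<epsilon> - i \<in> W3"
      unfolding W3_def
    proof (intro CollectI allI)
      fix k
      have "\<bar>(x - \<epsilon> *\<^sub>R i)$k\<bar> < \<epsilon>/2"
        using x(1) component_le_norm_cart[of "x - \<epsilon> *\<^sub>R i" k]
        by (simp add: A_def dist_norm norm_minus_commute)
      then have "x$k - \<epsilon> * i$k < \<epsilon>/2" "- (\<epsilon>/2) < x$k - \<epsilon> * i$k"
        by (auto simp: abs_if split: if_splits)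
      moreover have "(x /\<^sub>R \<epsilon> - i)$k = (x$k - \<epsilon> * i$k) / \<epsilon>"
        using assms(2) by (simp add: field_simps)
      ultimately show "- 1/2 \<le> (x /\<^sub>R \<epsilon> - i)$k \<and> (x /\<^sub>R \<epsilon> - i)$k < 1/2"
        using assms(2) by (simp add: field_simps)
    qed
  qed
  with x i assms(3,4) show ?thesis
    by (auto simp: C_eps_def A_def)
qed

lemma F_eps_eq:
  assumes "open \<Omega>" "\<epsilon> > 0"
    and even: "\<And>u v. u \<in> S2 \<Longrightarrow> v \<in> S2 \<Longrightarrow> f u v = f u (- v) \<and> f u v = f (- u) v"
    and lift: "(P, u) \<in> spin_lifts \<Omega> \<epsilon> Q"
  shows "F_eps f \<Omega> \<epsilon> Q = ereal (lattice_energy f \<Omega> \<epsilon> u)"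
proof -
  have "lattice_energy f \<Omega> \<epsilon> u' = lattice_energy f \<Omega> \<epsilon> u"
    if "(P', u') \<in> spin_lifts \<Omega> \<epsilon> Q" for P' u'
  proof -
    have "AE x in lebesgue_on \<Omega>. P' x = Q x" "AE x in lebesgue_on \<Omega>. P x = Q x"
      using that lift by (auto simp: spin_lifts_def)
    then have "AE x in lebesgue_on \<Omega>. P' x = P x"
      by eventually_elim simp
    then have "tensor (u' i) = tensor (u i)" if "i \<in> Z_eps \<Omega> \<epsilon>" for i
      using C_eps_AE_eq[OF assms(1,2), of P' P i] that lift \<open>(P', u') \<in> _\<close>
      by (auto simp: spin_lifts_def)
    moreover have S: "u i \<in> S2" "u' i \<in> S2" if "i \<in> Z_eps \<Omega> \<epsilon>" for i
      using that lift \<open>(P', u') \<in> _\<close> by (auto simp: spin_lifts_def)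
    ultimately have pm: "u' i = u i \<or> u' i = - u i" if "i \<in> Z_eps \<Omega> \<epsilon>" for i
      using that tensor_eq_imp by blast
    have neg: "- v \<in> S2" if "v \<in> S2" for v
      using that by (simp add: S2_def)
    have "f (u' i) (u' j) = f (u i) (u j)" if "i \<in> Z_eps \<Omega> \<epsilon>" "j \<in> Z_eps \<Omega> \<epsilon>" for i j
      using pm[OF that(1)] pm[OF that(2)] S[OF that(1)] S[OF that(2)] even neg by metis
    then show ?thesis
      unfolding lattice_energy_def
      by (intro arg_cong2[where f="(+)"] arg_cong2[where f="(*)"] sum.cong refl) auto
  qed
  then have "F_eps f \<Omega> \<epsilon> Q = (INF _\<in>spin_lifts \<Omega> \<epsilon> Q. ereal (lattice_energy f \<Omega> \<epsilon> u))"
    unfolding F_eps_def by (intro INF_cong) auto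
  also have "\<dots> = ereal (lattice_energy f \<Omega> \<epsilon> u)"
    using lift by (intro cINF_const) auto
  finally show ?thesis .
qed

end

theory Submission
  imports Defs
begin

text \<open>The pairs of sites at distance \<open>1\<close> and \<open>\<surd>2\<close> are regrouped over the unit squares of the lattice:
  an edge lies in four squares and a diagonal in one, so that the weights \<open>1\<close> and \<open>1/4\<close> turn the
  energy into one half of the sum, over all squares, of the six pair energies of the four vertices.
  Three squares per site account for the factor \<open>3/2\<close>. Each square costs at least \<open>fhat\<close> of the mean of its
  four tensors, hence at least any affine minorant of \<open>fhat\<close> there. As the envelope is a countable supremum
  of affine minorants, optimal up to a small error on finitely many compact sets filling \<open>\<Omega>\<close>, the lower
  bound follows by testing with a simple function. Conversely, a colouring of the lattice showing all
  four colours on every square realizes \<open>fhat\<close>; layering of periodic configurations convexifies the set of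
  achievable pairs (mean tensor, cost), whose closure is therefore the epigraph of a lower semicontinuous
  convex function below \<open>fhat\<close>, hence below the envelope. Recovery sequences use one periodic
  configuration near each of finitely many compact sets.\<close>

section \<open>Lattice energies\<close>

text \<open>The \<Gamma>-limits are suprema over weak* neighbourhoods, and these have no countable
  bases, so neither bound runs along sequences of fields. Below, one needs a single weak*-open
  half-space around the limit field on which the energies are eventually large. An estimate that is
  affine in the integrals of the field over finitely many sets and holds for all fields at once
  provides it. Above, a given neighbourhood already contains a field whose finitely many values are
  mean tensors of periodic configurations; with this field fixed, \<epsilon> tends to 0 and no
  diagonal sequence occurs. The error terms are of one kind: regrouping into squares, shifting,
  cutting and periodic averaging cost a bounded amount per site of a collar, and the collars that
  occur contain few sites compared with \<open>\<epsilon>^-3\<close>. An interface between two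
  layers has a cost per site that vanishes only as the period grows, which is why a closure has to
  be taken. The density on cubes of side h is treated by the same estimates, with \<epsilon> = 1/h
  and the unit cube as domain.\<close>

type_synonym site = "int \<times> int \<times> int"

definition site_box :: "int \<Rightarrow> site set" where
  "site_box r = {-r..r} \<times> {-r..r} \<times> {-r..r}"

definition nb :: "int \<Rightarrow> site set \<Rightarrow> site set" where
  "nb r S = (\<Union>i\<in>S. (+) i ` site_box r)"

text \<open>The outer collar of width \<open>r\<close>. Errors of regrouping, shifting and periodic
  averaging are all multiples of its cardinality.\<close>

definition bd :: "int \<Rightarrow> site set \<Rightarrow> site set" where
  "bd r S = nb r S - S"

lemma finite_site_box [simp]: "finite (site_box r)"
  by (simp add: site_box_def)

lemma finite_nb [simp]: "finite S \<Longrightarrow> finite (nb r S)"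
  by (simp add: nb_def)

lemma finite_bd [simp]: "finite S \<Longrightarrow> finite (bd r S)"
  by (simp add: bd_def)

lemma add_mem_nb: "i \<in> S \<Longrightarrow> \<xi> \<in> site_box r \<Longrightarrow> i + \<xi> \<in> nb r S"
  by (auto simp: nb_def)

lemma subset_nb: assumes "0 \<le> r" shows "S \<subseteq> nb r S"
proof
  fix i assume "i \<in> S"
  from add_mem_nb[OF this, of "(0,0,0)" r] show "i \<in> nb r S"
    using assms by (cases i) (simp add: site_box_def)
qed

lemma site_box_1: "site_box 1 = {-1,0,1} \<times> {-1,0,1} \<times> {-1,0,1}"
proof -
  have "{-1..1} = {-1,0,1::int}" by auto
  then show ?thesis by (simp add: site_box_def)
qed

lemma norm_sum_le_card:
  assumes "\<And>j. norm (F j) \<le> c"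
  shows "norm (\<Sum>j\<in>A. F j) \<le> c * real (card A)"
  using sum_norm_le[of A F "\<lambda>_. c"] assms by (simp add: mult.commute)

lemma norm_sum_diff_subset:
  assumes "finite B" "A \<subseteq> B" "\<And>j. norm (F j) \<le> c"
  shows "norm ((\<Sum>j\<in>B. F j) - (\<Sum>j\<in>A. F j)) \<le> c * real (card (B - A))"
  by (metis assms norm_sum_le_card sum_diff)

text \<open>A shifted set has the cardinality of the original one, so the sites gained and the sites
  lost are equally many, and the gained ones lie in the collar. Hence twice the collar.\<close>

lemma sum_shift_le:
  fixes F :: "site \<Rightarrow> 'a::real_normed_vector"
  assumes S: "finite S" and \<eta>: "\<eta> \<in> site_box r" and F: "\<And>j. norm (F j) \<le> c"
  shows "norm ((\<Sum>i\<in>S. F (i + \<eta>)) - (\<Sum>i\<in>S. F i)) \<le> 2 * c * real (card (bd r S))"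
proof -
  define T where "T = (\<lambda>i. i + \<eta>) ` S"
  have c: "0 \<le> c" using F norm_ge_zero order_trans by blast
  have fT: "finite T" "card T = card S"
    using S by (auto simp: T_def card_image inj_on_def)
  have sub: "T - S \<subseteq> bd r S"
    using add_mem_nb[OF _ \<eta>] by (auto simp: T_def bd_def)
  have "card (S - T) = card (T - S)"
    using fT S by (metis card_le_sym_Diff le_antisym order_refl)
  have le: "card (T - S) \<le> card (bd r S)"
    using sub S by (intro card_mono) auto
  have "(\<Sum>i\<in>S. F (i + \<eta>)) = (\<Sum>j\<in>T. F j)"
    unfolding T_def by (subst sum.reindex) (auto simp: inj_on_def)
  also have "\<dots> - (\<Sum>i\<in>S. F i) = (\<Sum>j\<in>T-S. F j) - (\<Sum>j\<in>S-T. F j)"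
    using sum.Int_Diff[OF fT(1), of F S] sum.Int_Diff[OF S, of F T] by (simp add: Int_commute)
  also have "norm \<dots> \<le> c * real (card (T - S)) + c * real (card (S - T))"
    by (intro order_trans[OF norm_triangle_ineq4] add_mono norm_sum_le_card F)
  also have "\<dots> = 2 * c * real (card (T - S))"
    using \<open>card (S - T) = card (T - S)\<close> by simp
  also have "\<dots> \<le> 2 * c * real (card (bd r S))"
    using le c by (intro mult_left_mono) auto
  finally show ?thesis by simp
qed

section \<open>Interaction weights and the regrouping over unit squares\<close>

definition wt :: "site \<Rightarrow> real" where
  "wt = (\<lambda>(a,b,c). if a\<^sup>2 + b\<^sup>2 + c\<^sup>2 = 1 then 1 else if a\<^sup>2 + b\<^sup>2 + c\<^sup>2 = 2 then 1/4 else 0)"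

lemma wt_nonneg: "0 \<le> wt \<xi>"
  by (simp add: wt_def split: prod.split)

text \<open>A coordinate outside {-1, 0, 1} already contributes 4 to the squared length. Sums over
  all differences thus reduce to the 27 vectors of \<open>site_box 1\<close>.\<close>

lemma wt_outside: assumes "\<xi> \<notin> site_box 1" shows "wt \<xi> = 0"
proof -
  obtain a b c where \<xi>: "\<xi> = (a,b,c)" by (cases \<xi>)
  have big: "x\<^sup>2 \<ge> 4" if "x \<notin> {-1..1}" for x :: int
  proof -
    have "\<bar>x\<bar> \<ge> 2" using that by auto
    then have "\<bar>x\<bar>^2 \<ge> 2^2" by (intro power_mono) auto
    then show ?thesis by simp
  qed
  have "a \<notin> {-1..1} \<or> b \<notin> {-1..1} \<or> c \<notin> {-1..1}"
    using assms by (auto simp: \<xi> site_box_def)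
  then have "a\<^sup>2 + b\<^sup>2 + c\<^sup>2 \<ge> 4"
    using big[of a] big[of b] big[of c] zero_le_power2[of a] zero_le_power2[of b] zero_le_power2[of c]
    by linarith
  then show ?thesis by (simp add: \<xi> wt_def)
qed

lemma sum_site_box_1:
  "(\<Sum>\<xi>\<in>site_box 1. g \<xi>) = (\<Sum>a\<in>{-1,0,1}. \<Sum>b\<in>{-1,0,1}. \<Sum>c\<in>{-1,0,1}. g (a,b,c))"
  unfolding site_box_1 by (simp add: sum.cartesian_product add.assoc)

lemma sum_wt: "(\<Sum>\<xi>\<in>site_box 1. wt \<xi> * g \<xi>) =
   g (1,0,0) + g (-1,0,0) + g (0,1,0) + g (0,-1,0) + g (0,0,1) + g (0,0,-1)
   + 1/4 * (g (1,1,0) + g (-1,-1,0) + g (1,0,1) + g (-1,0,-1) + g (0,1,1) + g (0,-1,-1)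
   + g (-1,1,0) + g (1,-1,0) + g (-1,0,1) + g (1,0,-1) + g (0,-1,1) + g (0,1,-1))"
  unfolding sum_site_box_1 by (simp add: wt_def)

definition pairs_sum :: "(real^3 \<Rightarrow> real^3 \<Rightarrow> real) \<Rightarrow> site set \<Rightarrow> (site \<Rightarrow> real^3) \<Rightarrow> site \<Rightarrow> real" where
  "pairs_sum f S u \<xi> = (\<Sum>i\<in>{i\<in>S. i + \<xi> \<in> S}. f (u i) (u (i + \<xi>)))"

definition energy :: "(real^3 \<Rightarrow> real^3 \<Rightarrow> real) \<Rightarrow> site set \<Rightarrow> (site \<Rightarrow> real^3) \<Rightarrow> real" where
  "energy f S u = (\<Sum>\<xi>\<in>site_box 1. wt \<xi> * pairs_sum f S u \<xi>)"

definition quad :: "(real^3 \<Rightarrow> real^3 \<Rightarrow> real) \<Rightarrow> real^3 \<Rightarrow> real^3 \<Rightarrow> real^3 \<Rightarrow> real^3 \<Rightarrow> real" where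
  "quad f a b c d = f a b + f a c + f a d + f b c + f b d + f c d"

text \<open>The three unit squares, one per coordinate plane, whose lowest corner is
  \<open>i\<close>; every unit square of the lattice has exactly one such corner. The other vertices
  may leave the set under consideration, which is why spins are taken as total functions with unit
  values everywhere.\<close>

definition square_energy :: "(real^3 \<Rightarrow> real^3 \<Rightarrow> real) \<Rightarrow> (site \<Rightarrow> real^3) \<Rightarrow> site \<Rightarrow> real" where
  "square_energy f u i =
     quad f (u i) (u (i + (1,0,0))) (u (i + (0,1,0))) (u (i + (1,1,0))) +
     quad f (u i) (u (i + (1,0,0))) (u (i + (0,0,1))) (u (i + (1,0,1))) +
     quad f (u i) (u (i + (0,1,0))) (u (i + (0,0,1))) (u (i + (0,1,1)))"

locale spin =
  fixes f :: "real^3 \<Rightarrow> real^3 \<Rightarrow> real" and M :: real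
  assumes f_le: "u \<in> S2 \<Longrightarrow> v \<in> S2 \<Longrightarrow> \<bar>f u v\<bar> \<le> M"
    and f_sym: "u \<in> S2 \<Longrightarrow> v \<in> S2 \<Longrightarrow> f u v = f v u"
begin

lemma M_nonneg: "0 \<le> M"
proof -
  have "axis 1 1 \<in> S2" by (simp add: S2_def)
  then show ?thesis using f_le abs_ge_zero order_trans by blast
qed

lemma pairs_sum_uminus:
  assumes "\<And>i. u i \<in> S2"
  shows "pairs_sum f S u (- \<xi>) = pairs_sum f S u \<xi>"
  unfolding pairs_sum_def
  by (rule sum.reindex_bij_witness[of _ "\<lambda>i. i + \<xi>" "\<lambda>i. i - \<xi>"]) (auto simp: f_sym assms)

text \<open>A pair is lost only if its first or its second site lies in \<open>Z - S\<close>, which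
  gives the factor 2.\<close>

lemma abs_pairs_sum_diff:
  assumes "finite Z" "S \<subseteq> Z" "\<And>i. u i \<in> S2"
  shows "\<bar>pairs_sum f Z u \<xi> - pairs_sum f S u \<xi>\<bar> \<le> 2 * M * real (card (Z - S))"
proof -
  let ?A = "{i\<in>Z. i + \<xi> \<in> Z}" and ?B = "{i\<in>S. i + \<xi> \<in> S}"
  have "\<bar>pairs_sum f Z u \<xi> - pairs_sum f S u \<xi>\<bar> \<le> M * real (card (?A - ?B))"
    using norm_sum_diff_subset[of ?A ?B "\<lambda>i. f (u i) (u (i + \<xi>))" M] assms f_le
    by (auto simp: pairs_sum_def)
  also have "card (?A - ?B) \<le> card ((Z - S) \<union> (\<lambda>i. i - \<xi>) ` (Z - S))"
    using assms(1) by (intro card_mono) (auto simp: image_iff algebra_simps)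
  also have "\<dots> \<le> card (Z - S) + card (Z - S)"
    using card_Un_le card_image_le[of "Z - S" "\<lambda>i. i - \<xi>"] assms(1)
    by (meson add_left_mono finite_Diff le_trans)
  finally show ?thesis
    using M_nonneg by (simp add: mult_left_mono algebra_simps)
qed

text \<open>The weights add up to 6 + 12/4 = 9, and each difference vector loses at most
  \<open>2 * M\<close> per removed site: this is the constant 18.\<close>

lemma abs_energy_diff:
  assumes "finite Z" "S \<subseteq> Z" "\<And>i. u i \<in> S2"
  shows "\<bar>energy f Z u - energy f S u\<bar> \<le> 18 * M * real (card (Z - S))"
proof -
  have "\<bar>energy f Z u - energy f S u\<bar>
      = \<bar>\<Sum>\<xi>\<in>site_box 1. wt \<xi> * (pairs_sum f Z u \<xi> - pairs_sum f S u \<xi>)\<bar>"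
    by (simp add: energy_def sum_subtractf right_diff_distrib)
  also have "\<dots> \<le> (\<Sum>\<xi>\<in>site_box 1. wt \<xi> * (2 * M * real (card (Z - S))))"
    by (intro order_trans[OF sum_abs] sum_mono)
       (auto simp: abs_mult wt_nonneg intro!: mult_left_mono abs_pairs_sum_diff assms)
  also have "\<dots> = 18 * M * real (card (Z - S))"
    by (subst sum_wt) simp
  finally show ?thesis .
qed

text \<open>Up to translation, the square energies contain every axis edge four times and every
  diagonal once. Half of this is 2 and 1/2 per difference up to sign, which is what the weights 1
  and 1/4 give when both orientations of a pair are counted. The two sides differ by truncated pairs
  and translated base points only, and both effects live in the collar.\<close>

lemma energy_square_energy:
  assumes S: "finite S" and u: "\<And>i. u i \<in> S2"
  shows "\<bar>energy f S u - 1/2 * (\<Sum>i\<in>S. square_energy f u i)\<bar> \<le> 18 * M * real (card (bd 1 S))"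
proof -
  define T where "T \<xi> = (\<Sum>i\<in>S. f (u i) (u (i + \<xi>)))" for \<xi>
  define G where "G = pairs_sum f S u"
  define B where "B = M * real (card (bd 1 S))"
  have b: "\<xi> \<in> site_box 1 \<Longrightarrow> \<bar>G \<xi> - T \<xi>\<bar> \<le> B" for \<xi>
  proof -
    assume \<xi>: "\<xi> \<in> site_box 1"
    let ?A = "{i\<in>S. i + \<xi> \<in> S}"
    have "\<bar>G \<xi> - T \<xi>\<bar> \<le> M * real (card (S - ?A))"
      using norm_sum_diff_subset[of S ?A "\<lambda>i. f (u i) (u (i + \<xi>))" M] S f_le u
      by (auto simp: pairs_sum_def T_def G_def)
    also have "card (S - ?A) = card ((\<lambda>i. i + \<xi>) ` (S - ?A))"
      by (simp add: card_image inj_on_def)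
    also have "\<dots> \<le> card (bd 1 S)"
      using S add_mem_nb[OF _ \<xi>] by (intro card_mono) (auto simp: bd_def)
    finally show ?thesis
      using M_nonneg by (simp add: mult_left_mono B_def)
  qed
  have sh: "\<bar>(\<Sum>i\<in>S. f (u (i + \<eta>)) (u (i + \<eta> + \<xi>))) - T \<xi>\<bar> \<le> 2 * B" if "\<eta> \<in> site_box 1" for \<eta> \<xi>
    using sum_shift_le[OF S that, of "\<lambda>i. f (u i) (u (i + \<xi>))" M] f_le u
    by (simp add: T_def B_def mult.assoc)
  define s where "s \<eta> \<xi> = (\<Sum>i\<in>S. f (u (i + \<eta>)) (u (i + \<xi>)))" for \<eta> \<xi>
  have E1: "energy f S u = 2 * (G (1,0,0) + G (0,1,0) + G (0,0,1)) + 1/2 * (G (1,1,0) + G (1,0,1)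
      + G (0,1,1) + G (-1,1,0) + G (-1,0,1) + G (0,-1,1))"
    unfolding energy_def sum_wt G_def
    by (simp add: pairs_sum_uminus[OF u, where S=S and \<xi>="(1,0,0)", simplified]
        pairs_sum_uminus[OF u, where S=S and \<xi>="(0,1,0)", simplified]
        pairs_sum_uminus[OF u, where S=S and \<xi>="(0,0,1)", simplified]
        pairs_sum_uminus[OF u, where S=S and \<xi>="(1,1,0)", simplified]
        pairs_sum_uminus[OF u, where S=S and \<xi>="(1,0,1)", simplified]
        pairs_sum_uminus[OF u, where S=S and \<xi>="(0,1,1)", simplified]
        pairs_sum_uminus[OF u, where S=S and \<xi>="(-1,1,0)", simplified]
        pairs_sum_uminus[OF u, where S=S and \<xi>="(-1,0,1)", simplified]
        pairs_sum_uminus[OF u, where S=S and \<xi>="(0,-1,1)", simplified])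
  have E2: "(\<Sum>i\<in>S. square_energy f u i) =
      2 * T (1,0,0) + 2 * T (0,1,0) + 2 * T (0,0,1) + T (1,1,0) + T (1,0,1) + T (0,1,1)
      + s (1,0,0) (0,1,0) + s (1,0,0) (1,1,0) + s (0,1,0) (1,1,0)
      + s (1,0,0) (0,0,1) + s (1,0,0) (1,0,1) + s (0,0,1) (1,0,1)
      + s (0,1,0) (0,0,1) + s (0,1,0) (0,1,1) + s (0,0,1) (0,1,1)"
    by (simp add: square_energy_def quad_def sum.distrib T_def s_def flip: sum_distrib_left)
  \<comment> \<open>\<open>d\<close> measures the truncation to pairs with both ends in
    \<open>S\<close>, at most \<open>B\<close> per difference, and \<open>e\<close> the translation
    of the base point, at most \<open>2 * B\<close>. With the coefficients of \<open>eq\<close> each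
    of the two kinds adds up to \<open>9 * B\<close>.\<close>
  define d where "d = (\<lambda>\<xi>. G \<xi> - T \<xi>)"
  define e where "e = (\<lambda>\<eta> \<zeta>. s \<eta> \<zeta> - T (\<zeta> - \<eta>))"
  have eq: "energy f S u - 1/2 * (\<Sum>i\<in>S. square_energy f u i) =
      2 * (d (1,0,0) + d (0,1,0) + d (0,0,1)) + 1/2 * (d (1,1,0) + d (1,0,1) + d (0,1,1))
      + 1/2 * (d (-1,1,0) + d (-1,0,1) + d (0,-1,1))
      - 1/2 * (e (1,0,0) (0,1,0) + e (1,0,0) (1,1,0) + e (0,1,0) (1,1,0))
      - 1/2 * (e (1,0,0) (0,0,1) + e (1,0,0) (1,0,1) + e (0,0,1) (1,0,1))
      - 1/2 * (e (0,1,0) (0,0,1) + e (0,1,0) (0,1,1) + e (0,0,1) (0,1,1))"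
    unfolding E1 E2 d_def e_def by (simp add: zero_prod_def field_simps)
  have d: "\<bar>d \<xi>\<bar> \<le> B" if "\<xi> \<in> site_box 1" for \<xi>
    using b[OF that] by (simp add: d_def)
  have e: "\<bar>e \<eta> \<zeta>\<bar> \<le> 2 * B" if "\<eta> \<in> site_box 1" for \<eta> \<zeta>
    using sh[OF that, of "\<zeta> - \<eta>"] by (simp add: e_def s_def add.assoc)
  have tri: "\<bar>x + y + z\<bar> \<le> 3 * C" if "\<bar>x\<bar> \<le> C" "\<bar>y\<bar> \<le> C" "\<bar>z\<bar> \<le> C" for x y z C :: real
    using that by linarith
  have fin: "\<bar>2 * x1 + 1/2 * x2 + 1/2 * x3 - 1/2 * y1 - 1/2 * y2 - 1/2 * y3\<bar> \<le> 18 * B"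
    if "\<bar>x1\<bar> \<le> 3 * B" "\<bar>x2\<bar> \<le> 3 * B" "\<bar>x3\<bar> \<le> 3 * B"
      "\<bar>y1\<bar> \<le> 3 * (2 * B)" "\<bar>y2\<bar> \<le> 3 * (2 * B)" "\<bar>y3\<bar> \<le> 3 * (2 * B)" for x1 x2 x3 y1 y2 y3
    using that unfolding abs_le_iff by linarith
  have "\<bar>energy f S u - 1/2 * (\<Sum>i\<in>S. square_energy f u i)\<bar> \<le> 18 * B"
    unfolding eq by (intro fin tri d e) (simp_all add: site_box_def)
  then show ?thesis by (simp add: B_def mult.assoc)
qed

end

subsection \<open>Periodic functions\<close>

definition blk :: "int \<Rightarrow> site \<Rightarrow> site" where
  "blk N = (\<lambda>(a,b,c). (a div N, b div N, c div N))"

definition cell0 :: "int \<Rightarrow> site set" where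
  "cell0 N = {0..<N} \<times> {0..<N} \<times> {0..<N}"

definition periodic :: "int \<Rightarrow> (site \<Rightarrow> 'a) \<Rightarrow> bool" where
  "periodic N \<phi> \<longleftrightarrow> (\<forall>a b c k l m. \<phi> (a + N * k, b + N * l, c + N * m) = \<phi> (a, b, c))"

definition mean :: "int \<Rightarrow> (site \<Rightarrow> 'a::real_vector) \<Rightarrow> 'a" where
  "mean N \<phi> = (1 / real_of_int (N^3)) *\<^sub>R (\<Sum>i\<in>cell0 N. \<phi> i)"

text \<open>Unions of full period cells. On them sums of periodic functions are exact, without
  boundary error.\<close>

definition saturated :: "int \<Rightarrow> site set \<Rightarrow> bool" where
  "saturated N S \<longleftrightarrow> (\<forall>i\<in>S. \<forall>j. blk N i = blk N j \<longrightarrow> j \<in> S)"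

lemma finite_cell0 [simp]: "finite (cell0 N)"
  by (simp add: cell0_def)

lemma card_cell0: "0 < N \<Longrightarrow> real (card (cell0 N)) = real_of_int (N^3)"
  by (simp add: cell0_def power3_eq_cube card_cartesian_product)

lemma periodic_dvd: "periodic N \<phi> \<Longrightarrow> periodic (N * m) \<phi>"
  unfolding periodic_def by (simp add: mult.assoc)

lemma periodic_comp: "periodic N v \<Longrightarrow> periodic N (\<lambda>i. g (v i))"
  unfolding periodic_def by simp

lemma periodic_square_energy:
  assumes "periodic N v" shows "periodic N (square_energy f v)"
proof -
  have *: "v (a + N * k, b + N * l, c + N * m) = v (a, b, c)" for a b c k l m
    using assms by (simp add: periodic_def)
  have "v (a + N * k + x, b + N * l + y, c + N * m + z) = v (a + x, b + y, c + z)" for a b c k l m x y z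
    using *[of "a + x" k "b + y" l "c + z" m] by (simp add: add_ac)
  from this this[of _ _ 0] this[of _ _ _ _ _ 0] this[of _ _ _ _ _ _ _ _ 0]
    this[of _ _ 0 _ _ 0] this[of _ _ 0 _ _ _ _ _ 0] this[of _ _ _ _ _ 0 _ _ 0] *
  show ?thesis by (simp add: periodic_def square_energy_def)
qed

text \<open>By periodicity every block contributes the sum over the fundamental cell, so only the
  number of blocks matters; it is found by summing the constant 1.\<close>

lemma sum_saturated:
  fixes \<phi> :: "site \<Rightarrow> 'a::real_vector"
  assumes N: "0 < N" and p: "periodic N \<phi>" and S: "finite S" "saturated N S"
  shows "(\<Sum>i\<in>S. \<phi> i) = real (card S) *\<^sub>R mean N \<phi>"
proof -
  define \<tau> where "\<tau> = (\<lambda>k j :: site. (fst k * N + fst j, fst (snd k) * N + fst (snd j), snd (snd k) * N + snd (snd j)))"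
  have blk: "blk N i = k \<longleftrightarrow> i \<in> \<tau> k ` cell0 N" for i k
  proof -
    obtain a b c where i: "i = (a,b,c)" by (cases i)
    obtain k1 k2 k3 where k: "k = (k1,k2,k3)" by (cases k)
    show ?thesis
    proof
      assume "blk N i = k"
      then have "i = \<tau> k (a mod N, b mod N, c mod N)"
        by (auto simp: blk_def i k \<tau>_def)
      moreover have "(a mod N, b mod N, c mod N) \<in> cell0 N"
        using N by (simp add: cell0_def)
      ultimately show "i \<in> \<tau> k ` cell0 N" by (rule image_eqI)
    next
      assume "i \<in> \<tau> k ` cell0 N"
      then show "blk N i = k"
        using N by (auto simp: i k cell0_def blk_def \<tau>_def)
    qed
  qed
  have fib: "{i\<in>S. blk N i = k} = \<tau> k ` cell0 N" if k: "k \<in> blk N ` S" for k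
  proof -
    obtain i where "i \<in> S" "k = blk N i" using k by blast
    then have "j \<in> S" if "blk N j = k" for j
      using S(2) that unfolding saturated_def by metis
    then have "{i\<in>S. blk N i = k} = {i. blk N i = k}" by blast
    also have "\<dots> = \<tau> k ` cell0 N" using blk by (simp add: set_eq_iff)
    finally show ?thesis .
  qed
  have inj: "inj_on (\<tau> k) (cell0 N)" for k
    by (auto simp: \<tau>_def inj_on_def)
  have \<phi>: "\<phi> (\<tau> k j) = \<phi> j" for k j
    using p[unfolded periodic_def, rule_format, of "fst j" "fst k" "fst (snd j)" "fst (snd k)" "snd (snd j)" "snd (snd k)"]
    by (simp add: \<tau>_def algebra_simps)
  have s: "(\<Sum>i\<in>S. g i) = (\<Sum>k\<in>blk N ` S. \<Sum>i\<in>cell0 N. g (\<tau> k i))" for g :: "site \<Rightarrow> 'b::comm_monoid_add"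
    by (subst sum.image_gen[OF S(1), of _ "blk N"])
       (auto simp: fib sum.reindex[OF inj] intro!: sum.cong)
  have "(\<Sum>i\<in>S. \<phi> i) = real (card (blk N ` S)) *\<^sub>R (\<Sum>i\<in>cell0 N. \<phi> i)"
    by (simp add: s[of \<phi>] \<phi> sum_constant_scaleR)
  moreover have "real (card S) = real (card (blk N ` S)) * real (card (cell0 N))"
    using s[of "\<lambda>_. 1 :: real"] by simp
  ultimately show ?thesis
    using N by (simp add: mean_def card_cell0)
qed

lemma norm_mean_le:
  assumes "0 < N" "\<And>j. norm (\<phi> j) \<le> c" shows "norm (mean N \<phi>) \<le> c"
proof -
  have "norm (\<Sum>i\<in>cell0 N. \<phi> i) \<le> c * real_of_int (N^3)"
    using norm_sum_le_card[of \<phi> c "cell0 N"] assms by (simp add: card_cell0)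
  then show ?thesis
    using assms(1) by (simp add: mean_def divide_simps mult.commute)
qed

text \<open>Completing \<open>S\<close> to the union \<open>B\<close> of all blocks that it meets
  makes the sum exact. The added sites lie in the collar of width \<open>N\<close> and are charged
  twice: once in the sum and once in the cardinality that multiplies the mean.\<close>

lemma sum_periodic:
  fixes \<phi> :: "site \<Rightarrow> 'a::real_normed_vector"
  assumes N: "0 < N" and p: "periodic N \<phi>" and S: "finite S" and c: "\<And>j. norm (\<phi> j) \<le> c"
  shows "norm ((\<Sum>i\<in>S. \<phi> i) - real (card S) *\<^sub>R mean N \<phi>) \<le> 2 * c * real (card (bd N S))"
proof -
  define B where "B = {j. \<exists>i\<in>S. blk N i = blk N j}"
  have c0: "0 \<le> c" using c norm_ge_zero order_trans by blast
  have close: "b - a \<in> {-N..N}" if "a div N = b div N" for a b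
  proof -
    have "b - a = b mod N - a mod N"
      using that by (metis add_diff_cancel_left mult_div_mod_eq)
    then show ?thesis
      using pos_mod_bound[OF N, of a] pos_mod_bound[OF N, of b]
        pos_mod_sign[OF N, of a] pos_mod_sign[OF N, of b]
      unfolding atLeastAtMost_iff by linarith
  qed
  have sub: "B \<subseteq> nb N S"
  proof
    fix j assume "j \<in> B"
    then obtain i where i: "i \<in> S" "blk N i = blk N j" by (auto simp: B_def)
    then have "j - i \<in> site_box N"
      using close by (cases i; cases j) (auto simp: blk_def site_box_def)
    then show "j \<in> nb N S"
      using add_mem_nb[OF i(1)] by fastforce
  qed
  have fB: "finite B" using sub S by (meson finite_nb finite_subset)
  have sB: "S \<subseteq> B" by (auto simp: B_def)
  have "saturated N B" by (auto simp: saturated_def B_def)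
  then have eq: "(\<Sum>i\<in>B. \<phi> i) = real (card B) *\<^sub>R mean N \<phi>"
    using N p fB by (intro sum_saturated) auto
  have le: "real (card (B - S)) \<le> real (card (bd N S))"
    using sub S by (auto simp: bd_def intro!: card_mono)
  have "real (card B) - real (card S) = real (card (B - S))"
    using fB sB S by (metis card_Diff_subset card_mono of_nat_diff)
  then have "(\<Sum>i\<in>S. \<phi> i) - real (card S) *\<^sub>R mean N \<phi>
      = real (card (B - S)) *\<^sub>R mean N \<phi> - ((\<Sum>i\<in>B. \<phi> i) - (\<Sum>i\<in>S. \<phi> i))"
    unfolding eq by (metis (no_types) add_diff_cancel_left' add_diff_eq diff_diff_eq2 scaleR_left_diff_distrib)
  also have "norm \<dots> \<le> c * real (card (B - S)) + c * real (card (B - S))"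
    using norm_mean_le[of N \<phi>, OF N c] norm_sum_diff_subset[of B S \<phi>, OF fB sB c]
    by (intro order_trans[OF norm_triangle_ineq4[of "real (card (B - S)) *\<^sub>R mean N \<phi>"]] add_mono)
       (auto simp: mult.commute mult_right_mono)
  also have "\<dots> \<le> c * real (card (bd N S)) + c * real (card (bd N S))"
    using le c0 by (intro add_mono mult_left_mono) auto
  finally show ?thesis by simp
qed

lemma le_div_iff_int:
  fixes N k x :: int
  assumes "0 < N" shows "k \<le> x div N \<longleftrightarrow> N * k \<le> x"
proof
  assume "k \<le> x div N"
  then have "N * k \<le> N * (x div N)" using assms by simp
  also have "\<dots> \<le> x"
    using pos_mod_sign[OF assms, of x] mult_div_mod_eq[of N x] by linarith
  finally show "N * k \<le> x" .
next
  assume "N * k \<le> x"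
  from zdiv_mono1[OF this assms] show "k \<le> x div N" using assms by simp
qed

lemma saturated_Times:
  assumes "0 < N"
  shows "saturated N ({N*k..<N*k'} \<times> {N*l..<N*l'} \<times> {N*m..<N*m'})"
proof -
  have *: "b \<in> {N*k..<N*k'}" if "a \<in> {N*k..<N*k'}" "a div N = b div N" for a b k k'
    using that le_div_iff_int[OF assms, of k a] le_div_iff_int[OF assms, of k b]
      le_div_iff_int[OF assms, of k' a] le_div_iff_int[OF assms, of k' b] by simp
  show ?thesis
    unfolding saturated_def
  proof (intro ballI allI impI)
    fix i j :: site
    assume i: "i \<in> {N*k..<N*k'} \<times> {N*l..<N*l'} \<times> {N*m..<N*m'}" and e: "blk N i = blk N j"
    obtain a b c a' b' c' where "i = (a,b,c)" "j = (a',b',c')" by (cases i, cases j)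
    with i e show "j \<in> {N*k..<N*k'} \<times> {N*l..<N*l'} \<times> {N*m..<N*m'}"
      using *[of a k k' a'] *[of b l l' b'] *[of c m m' c'] by (auto simp: blk_def)
  qed
qed

lemma saturated_cell0: "0 < N \<Longrightarrow> saturated N (cell0 (N * m))"
  using saturated_Times[of N 0 m 0 m 0 m] by (simp add: cell0_def)

lemma mean_dvd:
  assumes "0 < N" "0 < m" "periodic N \<phi>"
  shows "mean (N * m) \<phi> = mean N \<phi>"
proof -
  have "(\<Sum>i\<in>cell0 (N * m). \<phi> i) = real (card (cell0 (N * m))) *\<^sub>R mean N \<phi>"
    using assms by (intro sum_saturated saturated_cell0) auto
  then show ?thesis
    using assms card_cell0[of "N * m"] unfolding mean_def[of "N * m"] by simp
qed

text \<open>A horizontal cut at a multiple of \<open>N\<close> splits the large cell into two slabs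
  of complete period cells, with volume fractions \<open>k / R\<close> and
  \<open>1 - k / R\<close>.\<close>

lemma mean_layers:
  fixes \<phi> \<psi> :: "site \<Rightarrow> 'a::real_vector"
  assumes N: "0 < N" and R: "0 < R" and k: "0 \<le> k" "k \<le> R"
    and "periodic N \<phi>" "periodic N \<psi>"
  shows "mean (N * R) (\<lambda>i. if snd (snd i) < N * k then \<phi> i else \<psi> i)
    = (of_int k / of_int R) *\<^sub>R mean N \<phi> + (1 - of_int k / of_int R) *\<^sub>R mean N \<psi>"
proof -
  define A where "A = {0..<N*R} \<times> {0..<N*R} \<times> {0..<N*k}"
  define B where "B = {0..<N*R} \<times> {0..<N*R} \<times> {N*k..<N*R}"
  have le: "N * k \<le> N * R" "0 \<le> N * k" using N k by auto
  have AB: "cell0 (N * R) = A \<union> B" "A \<inter> B = {}" "finite A" "finite B"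
    using le by (auto simp: cell0_def A_def B_def)
  have "saturated N A" "saturated N B"
    using saturated_Times[OF N, of 0 R 0 R 0 k] saturated_Times[OF N, of 0 R 0 R k R]
    by (simp_all add: A_def B_def)
  then have "(\<Sum>i\<in>A. \<phi> i) = real (card A) *\<^sub>R mean N \<phi>" "(\<Sum>i\<in>B. \<psi> i) = real (card B) *\<^sub>R mean N \<psi>"
    using assms AB by (auto intro!: sum_saturated)
  moreover have "(\<Sum>i\<in>cell0 (N * R). if snd (snd i) < N * k then \<phi> i else \<psi> i) = (\<Sum>i\<in>A. \<phi> i) + (\<Sum>i\<in>B. \<psi> i)"
    unfolding AB(1) using AB by (subst sum.union_disjoint) (auto simp: A_def B_def intro!: arg_cong2[where f="(+)"] sum.cong)
  moreover have "real (card A) = of_int (N * R) * of_int (N * R) * of_int (N * k)"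
    "real (card B) = of_int (N * R) * of_int (N * R) * of_int (N * (R - k))"
    using N R k le by (simp_all add: A_def B_def card_cartesian_product algebra_simps)
  moreover have "1 / of_int ((N * R)^3) * (of_int (N * R) * of_int (N * R) * of_int (N * k)) = (of_int k / of_int R :: real)"
    "1 / of_int ((N * R)^3) * (of_int (N * R) * of_int (N * R) * of_int (N * (R - k))) = (1 - of_int k / of_int R :: real)"
    using N R by (simp_all add: field_simps power3_eq_cube)
  ultimately show ?thesis
    unfolding mean_def[of "N * R"] by (simp only: scaleR_add_right scaleR_scaleR)
qed

section \<open>Rank-one tensors\<close>

lemma inner_tensor: "A \<bullet> tensor v = v \<bullet> (A *v v)"
  by (simp add: inner_vec_def tensor_def matrix_vector_mult_def sum_distrib_left algebra_simps)

lemma tensor_mult_vec: "tensor v *v w = (v \<bullet> w) *\<^sub>R v"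
  by (simp add: vec_eq_iff tensor_def matrix_vector_mult_def inner_vec_def sum_distrib_left algebra_simps)

lemma norm_tensor: "v \<in> S2 \<Longrightarrow> norm (tensor v) = 1"
  by (simp add: norm_eq_sqrt_inner inner_tensor tensor_mult_vec S2_def norm_eq_1)

lemma tensor_in_K: "v \<in> S2 \<Longrightarrow> tensor v \<in> K"
proof -
  assume "v \<in> S2"
  then have "v \<bullet> v = 1" by (simp add: S2_def norm_eq_1)
  then have "trace (tensor v) = 1"
    by (simp add: trace_def tensor_def inner_vec_def)
  moreover have "transpose (tensor v) = tensor v"
    by (simp add: transpose_def tensor_def mult.commute)
  ultimately show ?thesis
    by (simp add: K_def Msym_def tensor_mult_vec inner_commute)
qed

section \<open>Layering of periodic configurations\<close>

context spin
begin

lemma abs_quad_le: "a \<in> S2 \<Longrightarrow> b \<in> S2 \<Longrightarrow> c \<in> S2 \<Longrightarrow> d \<in> S2 \<Longrightarrow> \<bar>quad f a b c d\<bar> \<le> 6 * M"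
  unfolding quad_def using f_le[of a b] f_le[of a c] f_le[of a d] f_le[of b c] f_le[of b d] f_le[of c d]
  by linarith

lemma abs_square_energy_le:
  assumes u: "\<And>i. u i \<in> S2" shows "\<bar>square_energy f u i\<bar> \<le> 18 * M"
  unfolding square_energy_def
  using abs_quad_le[OF u u u u, of i "i + (1,0,0)" "i + (0,1,0)" "i + (1,1,0)"]
    abs_quad_le[OF u u u u, of i "i + (1,0,0)" "i + (0,0,1)" "i + (1,0,1)"]
    abs_quad_le[OF u u u u, of i "i + (0,1,0)" "i + (0,0,1)" "i + (0,1,1)"]
  by linarith

text \<open>The cost is normalized by the number \<open>3\<close> of unit squares per site.\<close>

definition achieved :: "((real^3^3) \<times> real) set" where
  "achieved = {(P, s). \<exists>N>0. \<exists>v. (\<forall>i. v i \<in> S2) \<and> periodic N v \<and>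
     mean N (\<lambda>i. tensor (v i)) = P \<and> mean N (square_energy f v) \<le> 3 * s}"

text \<open>A period of \<open>N * R\<close> carries \<open>u\<close> on its lowest
  \<open>N * k\<close> layers and \<open>v\<close> above. Only squares based on the top layer of a
  slab can see both: at most \<open>2 * (N * R)^2\<close> sites with an error of
  \<open>36 * M\<close> each. Division by \<open>(N * R)^3\<close> and by the 3 of the normalization
  leaves at most \<open>24 * M / R\<close>.\<close>

lemma achieved_layers:
  assumes N: "0 < N" and R: "0 < R" and k: "0 \<le> k" "k \<le> R"
    and u: "\<And>i. u i \<in> S2" "periodic N u" and v: "\<And>i. v i \<in> S2" "periodic N v"
    and s: "mean N (square_energy f u) \<le> 3 * s" "mean N (square_energy f v) \<le> 3 * s'"
  shows "((of_int k / of_int R) *\<^sub>R mean N (\<lambda>i. tensor (u i)) + (1 - of_int k / of_int R) *\<^sub>R mean N (\<lambda>i. tensor (v i)),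
      (of_int k / of_int R) * s + (1 - of_int k / of_int R) * s' + 24 * M / of_int R) \<in> achieved"
proof -
  \<comment> \<open>Only the choice of the slab is reduced modulo the new period; \<open>u\<close>
    and \<open>v\<close> are already periodic, so all interfaces are horizontal.\<close>
  define w where "w = (\<lambda>i. if snd (snd i) mod (N * R) < N * k then u i else v i)"
  have w: "w i \<in> S2" for i using u v by (simp add: w_def)
  have NR: "0 < N * R" using N R by simp
  have up: "u (a + N * (R * l), b + N * (R * m), c + N * (R * n)) = u (a, b, c)"
     "v (a + N * (R * l), b + N * (R * m), c + N * (R * n)) = v (a, b, c)" for a b c l m n
    using u(2) v(2) by (simp_all add: periodic_def)
  have pw: "periodic (N * R) w"
    using up by (simp add: periodic_def w_def mult.assoc) (simp add: mod_mult_self2 flip: mult.assoc)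
  have m: "snd (snd i) mod (N * R) = snd (snd i)" if "i \<in> cell0 (N * R)" for i
    using that by (auto simp: cell0_def)
  have "mean (N * R) (\<lambda>i. tensor (w i)) =
     mean (N * R) (\<lambda>i. if snd (snd i) < N * k then tensor (u i) else tensor (v i))"
    unfolding mean_def by (intro arg_cong2[where f=scaleR] sum.cong refl) (simp add: w_def m)
  also have "\<dots> = (of_int k / of_int R) *\<^sub>R mean N (\<lambda>i. tensor (u i)) + (1 - of_int k / of_int R) *\<^sub>R mean N (\<lambda>i. tensor (v i))"
    using N R k u v by (intro mean_layers) (auto intro: periodic_comp)
  finally have mt: "mean (N * R) (\<lambda>i. tensor (w i)) = \<dots>" .
  define g where "g = (\<lambda>i. if snd (snd i) < N * k then square_energy f u i else square_energy f v i)"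
  \<comment> \<open>The top layers of the two slabs; the second one touches the next period.\<close>
  define Z where "Z = {0..<N*R} \<times> {0..<N*R} \<times> {N * k - 1, N * R - 1}"
  have se: "square_energy f w i = g i" if i: "i \<in> cell0 (N * R) - Z" for i
  proof -
    obtain a b c where abc: "i = (a,b,c)" by (cases i)
    have c: "0 \<le> c" "c < N * R" "c \<noteq> N * k - 1" "c \<noteq> N * R - 1" "c + 1 < N * R"
      using i by (auto simp: abc cell0_def Z_def)
    then have "c mod (N * R) = c" "(c + 1) mod (N * R) = c + 1" by auto
    moreover have "c + 1 < N * k \<longleftrightarrow> c < N * k" using c by auto
    ultimately show ?thesis
      by (simp add: g_def w_def abc square_energy_def)
  qed
  have bnd: "square_energy f w i - g i \<le> 36 * M" for i
    using abs_square_energy_le[of w i] abs_square_energy_le[of u i] abs_square_energy_le[of v i] w u v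
    by (auto simp: g_def abs_le_iff split: if_splits)
  have fZ: "finite Z" by (simp add: Z_def)
  have "(\<Sum>i\<in>cell0 (N * R). square_energy f w i) - (\<Sum>i\<in>cell0 (N * R). g i)
      = (\<Sum>i\<in>cell0 (N * R) \<inter> Z. square_energy f w i - g i)"
    unfolding sum_subtractf[symmetric] using se
    by (intro sum.mono_neutral_right) auto
  also have "\<dots> \<le> (\<Sum>i\<in>cell0 (N * R) \<inter> Z. 36 * M)"
    by (intro sum_mono bnd)
  also have "\<dots> = 36 * M * real (card (cell0 (N * R) \<inter> Z))" by simp
  also have "\<dots> \<le> 36 * M * real (card Z)"
    using M_nonneg fZ by (intro mult_left_mono) (auto intro!: card_mono)
  also have "\<dots> \<le> 36 * M * (2 * of_int (N * R) * of_int (N * R))"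
  proof -
    have "card Z \<le> nat (N * R) * nat (N * R) * 2"
      by (simp add: Z_def card_cartesian_product card_insert_le_m1)
    then have "real (card Z) \<le> real (nat (N * R) * nat (N * R) * 2)" by linarith
    then show ?thesis using NR M_nonneg by (intro mult_left_mono) (auto simp: mult.commute)
  qed
  finally have le: "(\<Sum>i\<in>cell0 (N * R). square_energy f w i) - (\<Sum>i\<in>cell0 (N * R). g i)
    \<le> 36 * M * (2 * of_int (N * R) * of_int (N * R))" .
  have "mean (N * R) (square_energy f w) \<le> mean (N * R) g + 72 * M / of_int (N * R)"
  proof -
    define L where "L = real_of_int (N * R)"
    have L: "0 < L" using NR by (simp only: L_def of_int_0_less_iff)
    have "(\<Sum>i\<in>cell0 (N * R). square_energy f w i) / L^3 - (\<Sum>i\<in>cell0 (N * R). g i) / L^3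
        \<le> 36 * M * (2 * L * L) / L^3"
      unfolding diff_divide_distrib[symmetric] using le L by (intro divide_right_mono) (simp_all add: L_def)
    also have "\<dots> = 72 * M / L"
      using L by (simp add: power3_eq_cube field_simps)
    finally show ?thesis
      by (simp add: mean_def L_def)
  qed
  also have "72 * M / of_int (N * R) \<le> 72 * M / of_int R"
    using N R M_nonneg by (intro divide_left_mono) auto
  also have "mean (N * R) g = (of_int k / of_int R) * mean N (square_energy f u) + (1 - of_int k / of_int R) * mean N (square_energy f v)"
    using N R k u v mean_layers[OF N R k periodic_square_energy periodic_square_energy, of u v f f]
    by (simp add: g_def)
  also have "\<dots> \<le> (of_int k / of_int R) * (3 * s) + (1 - of_int k / of_int R) * (3 * s')"
    using R k s by (intro add_mono mult_left_mono) auto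
  finally have "mean (N * R) (square_energy f w) \<le> 3 * ((of_int k / of_int R) * s + (1 - of_int k / of_int R) * s' + 24 * M / of_int R)"
    by (simp add: algebra_simps)
  then show ?thesis
    unfolding achieved_def using NR w pw mt by blast
qed

text \<open>Layering realizes only rational weights \<open>k / R\<close> and pays for its
  interfaces. Both defects vanish as \<open>R\<close> tends to infinity, so the closure is
  convex.\<close>

lemma convex_closure_achieved: "convex (closure achieved)"
proof -
  have *: "t *\<^sub>R x + (1 - t) *\<^sub>R y \<in> closure achieved"
    if xy: "x \<in> achieved" "y \<in> achieved" and t: "0 \<le> t" "t \<le> 1" for x y t
  proof -
    obtain P s P' s' where x: "x = (P, s)" and y: "y = (P', s')" by (cases x, cases y)
    obtain N1 u where u: "0 < N1" "\<And>i. u i \<in> S2" "periodic N1 u" "mean N1 (\<lambda>i. tensor (u i)) = P"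
      "mean N1 (square_energy f u) \<le> 3 * s"
      using xy(1) by (auto simp: achieved_def x)
    obtain N2 v where v: "0 < N2" "\<And>i. v i \<in> S2" "periodic N2 v" "mean N2 (\<lambda>i. tensor (v i)) = P'"
      "mean N2 (square_energy f v) \<le> 3 * s'"
      using xy(2) by (auto simp: achieved_def y)
    \<comment> \<open>A common period, so that both configurations fit into one stack.\<close>
    define N where "N = N1 * N2"
    have N: "0 < N" "N = N2 * N1" using u v by (auto simp: N_def)
    have u': "periodic N u" "mean N (\<lambda>i. tensor (u i)) = P" "mean N (square_energy f u) \<le> 3 * s"
      using u v by (auto simp: N_def mean_dvd periodic_dvd periodic_comp periodic_square_energy)
    have v': "periodic N v" "mean N (\<lambda>i. tensor (v i)) = P'" "mean N (square_energy f v) \<le> 3 * s'"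
      using u v by (auto simp: N(2) mean_dvd periodic_dvd periodic_comp periodic_square_energy)
    \<comment> \<open>Layering is applied with \<open>R = n + 1\<close> and with the integer part of
      \<open>t * R\<close> for \<open>k\<close>.\<close>
    define r where "r n = of_int \<lfloor>t * real (Suc n)\<rfloor> / real (Suc n)" for n
    have "\<bar>r n - t\<bar> \<le> 1 / real (Suc n)" for n
    proof -
      have "\<bar>of_int \<lfloor>t * real (Suc n)\<rfloor> - t * real (Suc n)\<bar> \<le> 1" by linarith
      then show ?thesis by (simp add: r_def divide_simps abs_le_iff)
    qed
    then have "(\<lambda>n. r n - t) \<longlonglongrightarrow> 0"
      by (intro tendsto_rabs_zero_cancel[OF tendsto_sandwich[OF _ _ tendsto_const LIMSEQ_inverse_real_of_nat]])
         (auto simp: inverse_eq_divide)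
    then have r: "r \<longlonglongrightarrow> t" by (simp add: LIM_zero_iff)
    have i: "(\<lambda>n. 24 * M * inverse (real (Suc n))) \<longlonglongrightarrow> 24 * M * 0"
      by (intro tendsto_intros LIMSEQ_inverse_real_of_nat)
    define z where "z n = (r n *\<^sub>R P + (1 - r n) *\<^sub>R P', r n * s + (1 - r n) * s' + 24 * M * inverse (real (Suc n)))" for n
    have "z n \<in> achieved" for n
    proof -
      have "0 \<le> \<lfloor>t * real (Suc n)\<rfloor>" "\<lfloor>t * real (Suc n)\<rfloor> \<le> int (Suc n)"
        using t mult_right_mono[of t 1 "real (Suc n)"] by (simp_all add: floor_le_iff algebra_simps)
      from achieved_layers[OF N(1) _ this u(2) u'(1) v(2) v'(1) u'(3) v'(3)]
      show ?thesis by (simp add: u' v' z_def r_def divide_inverse)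
    qed
    moreover have "z \<longlonglongrightarrow> (t *\<^sub>R P + (1 - t) *\<^sub>R P', t * s + (1 - t) * s' + 24 * M * 0)"
      unfolding z_def by (intro tendsto_intros r i)
    ultimately have "(t *\<^sub>R P + (1 - t) *\<^sub>R P', t * s + (1 - t) * s' + 24 * M * 0) \<in> closure achieved"
      unfolding closure_sequential by blast
    then show ?thesis by (simp add: x y)
  qed
  have cl: "t *\<^sub>R x + (1 - t) *\<^sub>R y \<in> closure achieved"
    if xy: "x \<in> closure achieved" "y \<in> closure achieved" and t: "0 \<le> t" "t \<le> 1" for x y t
  proof -
    obtain a b where ab: "\<And>n. a n \<in> achieved" "\<And>n. b n \<in> achieved" "a \<longlonglongrightarrow> x" "b \<longlonglongrightarrow> y"
      using xy unfolding closure_sequential by blast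
    then have "(\<lambda>n. t *\<^sub>R a n + (1 - t) *\<^sub>R b n) \<longlonglongrightarrow> t *\<^sub>R x + (1 - t) *\<^sub>R y"
      by (intro tendsto_intros)
    then show ?thesis
      by (rule closed_sequentially[OF closed_closure *[OF ab(1) ab(2) t]])
  qed
  show ?thesis
    unfolding convex_alt using cl[of _ _ "1 - _"] by (simp add: add.commute)
qed

end

section \<open>Q-tensors and the convex envelope\<close>

lemma convex_K: "convex K"
proof (rule convexI)
  fix P Q :: "real^3^3" and s t :: real
  assume a: "P \<in> K" "Q \<in> K" "0 \<le> s" "0 \<le> t" "s + t = 1"
  have "transpose (s *\<^sub>R P + t *\<^sub>R Q) = s *\<^sub>R transpose P + t *\<^sub>R transpose Q"
    by (simp add: transpose_def vec_eq_iff)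
  moreover have "trace (s *\<^sub>R P + t *\<^sub>R Q) = s * trace P + t * trace Q"
    by (simp add: trace_def sum.distrib sum_distrib_left)
  moreover have "v \<bullet> ((s *\<^sub>R P + t *\<^sub>R Q) *v v) = s * (v \<bullet> (P *v v)) + t * (v \<bullet> (Q *v v))" for v
    by (simp add: matrix_vector_mult_add_rdistrib scaleR_matrix_vector_assoc[symmetric] inner_add_right)
  ultimately show "s *\<^sub>R P + t *\<^sub>R Q \<in> K"
    using a by (simp add: K_def Msym_def)
qed

lemma convex_Msym: "convex Msym"
proof (rule convexI)
  fix P Q :: "real^3^3" and s t :: real
  assume a: "P \<in> Msym" "Q \<in> Msym"
  have "transpose (s *\<^sub>R P + t *\<^sub>R Q) = s *\<^sub>R transpose P + t *\<^sub>R transpose Q"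
    by (simp add: transpose_def vec_eq_iff)
  then show "s *\<^sub>R P + t *\<^sub>R Q \<in> Msym"
    using a by (simp add: Msym_def)
qed

lemma K_subset_Msym: "K \<subseteq> Msym"
  by (auto simp: K_def)

lemma Msym_inner_commute:
  assumes "A \<in> Msym" shows "v \<bullet> (A *v w) = w \<bullet> (A *v v)"
proof -
  have "v v* A = A *v v"
    using transpose_matrix_vector[of A v] assms unfolding Msym_def mem_Collect_eq by metis
  then show ?thesis
    using dot_lmul_matrix[of v A w] by (simp add: inner_commute)
qed

lemma tensor_0 [simp]: "tensor 0 = 0"
  by (simp add: tensor_def vec_eq_iff)

text \<open>One step of symmetric Gaussian elimination.\<close>

lemma psd_split:
  fixes A :: "real^3^3"
  assumes A: "A \<in> Msym" "\<And>v. 0 \<le> v \<bullet> (A *v v)"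
  shows "\<exists>w. A - tensor w \<in> Msym \<and> (\<forall>v. 0 \<le> v \<bullet> ((A - tensor w) *v v)) \<and>
    (A - tensor w) *v e = 0 \<and> (\<forall>x. A *v x = 0 \<longrightarrow> (A - tensor w) *v x = 0)"
proof -
  define p where "p = e \<bullet> (A *v e)"
  \<comment> \<open>If \<open>p = 0\<close>, division by zero gives \<open>w = 0\<close>. This is
    the right choice, because \<open>A *v e = 0\<close> in that case.\<close>
  define w where "w = (1 / sqrt p) *\<^sub>R (A *v e)"
  have p: "0 \<le> p" using A(2) by (simp add: p_def)
  have quad: "(v + s *\<^sub>R e) \<bullet> (A *v (v + s *\<^sub>R e)) = v \<bullet> (A *v v) + 2 * s * (v \<bullet> (A *v e)) + s^2 * p" for v s
    using Msym_inner_commute[OF A(1), of v e]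
    by (simp add: matrix_vector_right_distrib matrix_vector_mult_scaleR inner_add_left inner_add_right
        p_def power2_eq_square algebra_simps)
  have zero: "v \<bullet> (A *v e) = 0" if "p = 0" for v
  proof (rule ccontr)
    assume n: "v \<bullet> (A *v e) \<noteq> 0"
    \<comment> \<open>Chosen so that the form at \<open>v + s *\<^sub>R e\<close>, which is affine
      in \<open>s\<close> when \<open>p = 0\<close>, takes the value -1.\<close>
    define s where "s = - (v \<bullet> (A *v v) + 1) / (2 * (v \<bullet> (A *v e)))"
    have "0 \<le> v \<bullet> (A *v v) + 2 * s * (v \<bullet> (A *v e))"
      using A(2)[of "v + s *\<^sub>R e"] quad[of v s] that by simp
    moreover have "2 * s * (v \<bullet> (A *v e)) = - (v \<bullet> (A *v v) + 1)"
      using n by (simp add: s_def)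
    ultimately show False by simp
  qed
  have mul: "(A - tensor w) *v x = A *v x - (w \<bullet> x) *\<^sub>R w" for x
    by (simp add: matrix_vector_mult_diff_rdistrib tensor_mult_vec)
  have wx: "w \<bullet> x = (1 / sqrt p) * (x \<bullet> (A *v e))" for x
    by (simp add: w_def inner_commute)
  have "transpose (A - tensor w) = transpose A - tensor w"
    by (simp add: transpose_def tensor_def vec_eq_iff mult.commute)
  then have "A - tensor w \<in> Msym" using A(1) by (simp add: Msym_def)
  moreover have "0 \<le> v \<bullet> ((A - tensor w) *v v)" for v
  proof (cases "p = 0")
    case True
    then show ?thesis using A(2)[of v] by (simp add: mul) (simp add: w_def)
  next
    case False
    \<comment> \<open>The minimizer of the form on the line through \<open>v\<close> in direction
      \<open>e\<close>; the minimum is the form of \<open>A - tensor w\<close> at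
      \<open>v\<close>.\<close>
    define s where "s = - (v \<bullet> (A *v e)) / p"
    have "v \<bullet> ((A - tensor w) *v v) = v \<bullet> (A *v v) - (w \<bullet> v)^2"
      by (simp add: mul inner_diff_right power2_eq_square inner_commute)
    also have "\<dots> = v \<bullet> (A *v v) + 2 * s * (v \<bullet> (A *v e)) + s^2 * p"
      using False p by (simp add: wx power_mult_distrib power_divide s_def field_simps power2_eq_square)
    also have "\<dots> \<ge> 0"
      using A(2)[of "v + s *\<^sub>R e"] quad[of v s] by simp
    finally show ?thesis by simp
  qed
  moreover have "(A - tensor w) *v e = 0"
  proof (cases "p = 0")
    case True
    then have "A *v e = 0" using zero[of "A *v e"] by simp
    then show ?thesis by (simp add: mul w_def)
  next
    case False
    then show ?thesis using p by (simp add: mul wx p_def[symmetric]) (simp add: w_def)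
  qed
  moreover have "(A - tensor w) *v x = 0" if "A *v x = 0" for x
    using Msym_inner_commute[OF A(1), of x e] that by (simp add: mul wx)
  ultimately show ?thesis by blast
qed

text \<open>Each split puts one more basis vector into the kernel and keeps those already there, so
  after three splits the remainder is zero.\<close>

lemma psd_decomp:
  assumes A: "A \<in> Msym" "\<And>v. 0 \<le> v \<bullet> (A *v v)"
  shows "\<exists>w1 w2 w3. A = tensor w1 + tensor w2 + tensor w3"
proof -
  obtain w1 where w1: "A - tensor w1 \<in> Msym" "\<And>v. 0 \<le> v \<bullet> ((A - tensor w1) *v v)"
    "(A - tensor w1) *v axis 1 1 = 0"
    using psd_split[OF A, of "axis 1 1"] by blast
  obtain w2 where w2: "A - tensor w1 - tensor w2 \<in> Msym" "\<And>v. 0 \<le> v \<bullet> ((A - tensor w1 - tensor w2) *v v)"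
    "(A - tensor w1 - tensor w2) *v axis 2 1 = 0" "(A - tensor w1 - tensor w2) *v axis 1 1 = 0"
    using psd_split[OF w1(1,2), of "axis 2 1"] w1(3) by blast
  obtain w3 where w3: "(A - tensor w1 - tensor w2 - tensor w3) *v axis 3 1 = 0"
    "(A - tensor w1 - tensor w2 - tensor w3) *v axis 2 1 = 0" "(A - tensor w1 - tensor w2 - tensor w3) *v axis 1 1 = 0"
    using psd_split[OF w2(1,2), of "axis 3 1"] w2(3,4) by blast
  have "(A - tensor w1 - tensor w2 - tensor w3) $ i $ j = 0" for i j
    using w3 exhaust_3[of j] by (auto simp: matrix_vector_mult_basis column_def vec_eq_iff)
  then have "A - tensor w1 - tensor w2 - tensor w3 = 0" by (simp add: vec_eq_iff)
  then show ?thesis by (metis add.commute diff_eq_eq eq_iff_diff_eq_0)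
qed

lemma tensor_scaleR: "tensor (c *\<^sub>R v) = c^2 *\<^sub>R tensor v"
  by (simp add: tensor_def vec_eq_iff power2_eq_square)

lemma trace_tensor: "trace (tensor v) = v \<bullet> v"
  by (simp add: trace_def tensor_def inner_vec_def)

text \<open>A matrix of \<open>K\<close> is a sum of three rank-one tensors. The squared lengths of
  the vectors add up to the trace 1 and serve as convex weights of the normalized tensors.
  Compactness of \<open>K\<close>, its norm bound and upper bounds for convex functions on it come
  from this description.\<close>

lemma K_eq_hull: "K = convex hull (tensor ` S2)"
proof
  show "convex hull (tensor ` S2) \<subseteq> K"
    by (intro hull_minimal convex_K) (auto simp: tensor_in_K)
  show "K \<subseteq> convex hull (tensor ` S2)"
  proof
    fix A assume A: "A \<in> K"
    then obtain w1 w2 w3 where w: "A = tensor w1 + tensor w2 + tensor w3"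
      using psd_decomp[of A] by (auto simp: K_def)
    have e: "axis 1 1 \<in> S2" by (simp add: S2_def)
    \<comment> \<open>The zero vector may be sent to any unit vector, since its weight is 0.\<close>
    define n where "n w = (if w = 0 then axis 1 1 else w /\<^sub>R norm w)" for w :: "real^3"
    have n: "tensor (n w) \<in> tensor ` S2" for w
      using e by (auto simp: n_def S2_def)
    have t: "tensor w = (w \<bullet> w) *\<^sub>R tensor (n w)" for w
    proof (cases "w = 0")
      case True
      then show ?thesis by (simp add: tensor_def vec_eq_iff)
    next
      case False
      then have "w = norm w *\<^sub>R n w" by (simp add: n_def)
      then have "tensor w = (norm w)^2 *\<^sub>R tensor (n w)" by (metis tensor_scaleR)
      then show ?thesis by (simp add: power2_norm_eq_inner)
    qed
    have "w1 \<bullet> w1 + w2 \<bullet> w2 + w3 \<bullet> w3 = 1"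
      using A by (simp add: K_def w trace_add trace_tensor)
    then have "(w1 \<bullet> w1) *\<^sub>R tensor (n w1) + (w2 \<bullet> w2) *\<^sub>R tensor (n w2) + (w3 \<bullet> w3) *\<^sub>R tensor (n w3)
       \<in> convex hull {tensor (n w1), tensor (n w2), tensor (n w3)}"
      unfolding convex_hull_3 using inner_ge_zero by blast
    also have "\<dots> \<subseteq> convex hull (tensor ` S2)"
      using n by (intro hull_mono) auto
    finally show "A \<in> convex hull (tensor ` S2)"
      using w t by metis
  qed
qed

lemma continuous_on_tensor: "continuous_on S tensor"
  unfolding tensor_def by (intro continuous_intros)

lemma compact_K: "compact K"
  unfolding K_eq_hull S2_def
  by (intro compact_convex_hull compact_continuous_image continuous_on_tensor compact_sphere)

lemma closed_K: "closed K"
  by (simp add: compact_K compact_imp_closed)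

lemma norm_K_le: assumes "Q \<in> K" shows "norm Q \<le> 1"
proof -
  have "convex hull (tensor ` S2) \<subseteq> cball 0 1"
    by (intro hull_minimal) (auto simp: norm_tensor)
  then show ?thesis using assms K_eq_hull by auto
qed

lemma K_nonempty: "K \<noteq> {}"
proof -
  have "axis 1 1 \<in> S2" by (simp add: S2_def)
  then show ?thesis using tensor_in_K by auto
qed

section \<open>The envelope: bounds, semicontinuity, convexity and affine minorants\<close>

abbreviation envelope :: "(real^3 \<Rightarrow> real^3 \<Rightarrow> real) \<Rightarrow> real^3^3 \<Rightarrow> ereal" where
  "envelope f \<equiv> lsc_convex_envelope Msym (fhat f)"

lemma envelope_greatest:
  assumes "econvex_on Msym h" "lsc_on Msym h" "\<And>Y. Y \<in> Msym \<Longrightarrow> h Y \<le> fhat f Y"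
  shows "h Q \<le> envelope f Q"
  unfolding lsc_convex_envelope_def using assms by (intro SUP_upper) auto

lemma pairs_4: "(\<Sum>(i,j)\<in>{(i,j). 1 \<le> i \<and> i < j \<and> j \<le> 4}. f (u i) (u j)) = quad f (u 1) (u 2) (u 3) (u (4::nat))"
proof -
  have "{(i,j). 1 \<le> i \<and> i < j \<and> j \<le> (4::nat)} = {(1,2),(1,3),(1,4),(2,3),(2,4),(3,4)}"
    by auto
  then show ?thesis by (simp add: quad_def)
qed

lemma sum_4: "(\<Sum>i=1..4. g i) = g 1 + g 2 + g 3 + g (4::nat)" for g :: "nat \<Rightarrow> 'a::comm_monoid_add"
  by (simp add: eval_nat_numeral add.assoc)

text \<open>This includes that the mean of four tensors lies in \<open>K\<close>; outside
  \<open>K\<close> the left side would be infinite.\<close>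

lemma fhat_le_quad:
  assumes "a \<in> S2" "b \<in> S2" "c \<in> S2" "d \<in> S2"
  shows "fhat f ((1/4) *\<^sub>R (tensor a + tensor b + tensor c + tensor d)) \<le> ereal (quad f a b c d)"
proof -
  let ?Q = "(1/4) *\<^sub>R (tensor a + tensor b + tensor c + tensor d)"
  define u where "u = (\<lambda>i::nat. if i = 1 then a else if i = 2 then b else if i = 3 then c else d)"
  have "?Q = (1/2) *\<^sub>R ((1/2) *\<^sub>R tensor a + (1/2) *\<^sub>R tensor b) + (1/2) *\<^sub>R ((1/2) *\<^sub>R tensor c + (1/2) *\<^sub>R tensor d)"
    by (simp add: scaleR_add_right)
  also have "\<dots> \<in> K"
    using assms by (intro convexD[OF convex_K] tensor_in_K) auto
  finally have Q: "?Q \<in> K" .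
  have u: "(\<forall>i\<in>{1..4}. u i \<in> S2) \<and> (1/4) *\<^sub>R (\<Sum>i=1..4. tensor (u i)) = ?Q"
    using assms unfolding sum_4 by (simp add: u_def)
  have "(\<Sum>(i,j)\<in>{(i,j). 1 \<le> i \<and> i < j \<and> j \<le> 4}. f (u i) (u j)) = quad f a b c d"
    unfolding pairs_4 by (simp add: u_def)
  then have v: "ereal (\<Sum>(i,j)\<in>{(i,j). 1 \<le> i \<and> i < j \<and> j \<le> 4}. f (u i) (u j)) \<le> ereal (quad f a b c d)"
    by (simp only: order_refl)
  show ?thesis
    unfolding fhat_def if_P[OF Q] by (rule INF_lower2[of u], rule CollectI, rule u, rule v)
qed

lemma fhat_lessE:
  assumes "fhat f Q < ereal s"
  obtains a b c d where "a \<in> S2" "b \<in> S2" "c \<in> S2" "d \<in> S2"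
    "Q = (1/4) *\<^sub>R (tensor a + tensor b + tensor c + tensor d)" "quad f a b c d < s"
proof -
  have Q: "Q \<in> K" using assms by (auto simp: fhat_def split: if_splits)
  then obtain u :: "nat \<Rightarrow> real^3" where u: "\<forall>i\<in>{1..4}. u i \<in> S2" "(1/4) *\<^sub>R (\<Sum>i=1..4. tensor (u i)) = Q"
    "ereal (\<Sum>(i,j)\<in>{(i,j). 1 \<le> i \<and> i < j \<and> j \<le> 4}. f (u i) (u j)) < ereal s"
    using assms by (auto simp: fhat_def INF_less_iff)
  have u': "u 1 \<in> S2" "u 2 \<in> S2" "u 3 \<in> S2" "u 4 \<in> S2"
    by (rule u(1)[rule_format]; simp)+
  show ?thesis
    by (rule that[OF u' u(2)[unfolded sum_4, symmetric] u(3)[unfolded pairs_4 less_ereal.simps]])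
qed

lemma lsc_onI:
  assumes "\<And>x s. x \<in> S \<Longrightarrow> s < h x \<Longrightarrow> eventually (\<lambda>y. s < h y) (at x within S)"
  shows "lsc_on S h"
  using assms by (auto simp: lsc_on_def le_Liminf_iff)

text \<open>The \<open>Liminf\<close> ignores the point \<open>x\<close> itself; there the strict
  inequality is the third assumption.\<close>

lemma lsc_onD:
  assumes "lsc_on S h" "x \<in> S" "s < h x"
  shows "\<exists>e>0. \<forall>y\<in>S. dist y x < e \<longrightarrow> s < h y"
proof -
  have "s < Liminf (at x within S) h"
    using assms unfolding lsc_on_def by (metis less_le_trans)
  then have "eventually (\<lambda>y. s < h y) (at x within S)"
    by (rule less_LiminfD)
  then obtain e where "e > 0" "\<And>y. y \<in> S \<Longrightarrow> y \<noteq> x \<Longrightarrow> dist y x < e \<Longrightarrow> s < h y"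
    unfolding eventually_at by blast
  then show ?thesis using assms(3) by metis
qed

lemma less_envelopeD:
  assumes "s < envelope f Q"
  shows "\<exists>h. econvex_on Msym h \<and> lsc_on Msym h \<and> (\<forall>Y\<in>Msym. h Y \<le> fhat f Y) \<and> s < h Q"
proof -
  obtain h where h: "h \<in> {h. econvex_on Msym h \<and> lsc_on Msym h \<and> (\<forall>Y\<in>Msym. h Y \<le> fhat f Y)}" "s < h Q"
    using assms unfolding lsc_convex_envelope_def less_SUP_iff by (elim bexE)
  from h(1) show ?thesis unfolding mem_Collect_eq using h(2) by (intro exI[of _ h] conjI) (elim conjE, assumption)+
qed

lemma lsc_envelope: "lsc_on Msym (envelope f)"
proof (rule lsc_onI)
  fix Q s assume Q: "Q \<in> Msym" and s: "s < envelope f Q"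
  obtain h where "econvex_on Msym h \<and> lsc_on Msym h \<and> (\<forall>Y\<in>Msym. h Y \<le> fhat f Y) \<and> s < h Q"
    by (rule exE[OF less_envelopeD[OF s]])
  then have h: "econvex_on Msym h" "lsc_on Msym h" "\<forall>Y\<in>Msym. h Y \<le> fhat f Y" "s < h Q"
    by simp_all
  have "h Q \<le> Liminf (at Q within Msym) h"
    using h(2) Q by (simp add: lsc_on_def)
  with h(4) have "s < Liminf (at Q within Msym) h"
    by (rule less_le_trans)
  then have "eventually (\<lambda>Y. s < h Y) (at Q within Msym)"
    by (rule less_LiminfD)
  then show "eventually (\<lambda>Y. s < envelope f Y) (at Q within Msym)"
  proof eventually_elim
    case (elim Y)
    have "h Y \<le> envelope f Y" by (rule envelope_greatest[OF h(1,2)]) (use h(3) in blast)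
    with elim show ?case by (rule less_le_trans)
  qed
qed

text \<open>A supremum of convex functions is convex. Real bounds \<open>p\<close> and
  \<open>q\<close> stand for the values, so that no arithmetic with infinities arises.\<close>

lemma convex_envelope:
  assumes "P \<in> Msym" "Q \<in> Msym" "envelope f P \<le> ereal p" "envelope f Q \<le> ereal q" "0 \<le> t" "t \<le> 1"
  shows "envelope f (t *\<^sub>R P + (1 - t) *\<^sub>R Q) \<le> ereal (t * p + (1 - t) * q)"
  unfolding lsc_convex_envelope_def
proof (rule SUP_least)
  fix h assume h: "h \<in> {h. econvex_on Msym h \<and> lsc_on Msym h \<and> (\<forall>y\<in>Msym. h y \<le> fhat f y)}"
  then have hh: "econvex_on Msym h" "lsc_on Msym h" "\<forall>y\<in>Msym. h y \<le> fhat f y" by simp_all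
  have "h Y \<le> envelope f Y" for Y
    by (rule envelope_greatest[OF hh(1,2)]) (use hh(3) in blast)
  then have "h P \<le> ereal p" "h Q \<le> ereal q"
    using assms(3,4) by (blast intro: order_trans)+
  then have "(P, p) \<in> {(x, t::real). x \<in> Msym \<and> h x \<le> ereal t}" "(Q, q) \<in> {(x, t::real). x \<in> Msym \<and> h x \<le> ereal t}"
    using assms by auto
  moreover have "convex {(x, t::real). x \<in> Msym \<and> h x \<le> ereal t}"
    using hh(1) by (simp add: econvex_on_def)
  ultimately have "t *\<^sub>R (P, p) + (1 - t) *\<^sub>R (Q, q) \<in> {(x, t::real). x \<in> Msym \<and> h x \<le> ereal t}"
    using assms by (intro convexD) auto
  then show "h (t *\<^sub>R P + (1 - t) *\<^sub>R Q) \<le> ereal (t * p + (1 - t) * q)" by simp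
qed

definition aff_minorant :: "(real^3 \<Rightarrow> real^3 \<Rightarrow> real) \<Rightarrow> real^3^3 \<Rightarrow> real \<Rightarrow> bool" where
  "aff_minorant f A b \<longleftrightarrow> (\<forall>Y\<in>K. ereal (A \<bullet> Y + b) \<le> fhat f Y)"

context spin
begin

lemma fhat_ge: "ereal (- 6 * M) \<le> fhat f Y"
proof (rule ccontr)
  assume "\<not> ereal (- 6 * M) \<le> fhat f Y"
  then have "fhat f Y < ereal (- 6 * M)" by simp
  then obtain a b c d where "a \<in> S2" "b \<in> S2" "c \<in> S2" "d \<in> S2" "quad f a b c d < - 6 * M"
    by (rule fhat_lessE)
  then show False using abs_quad_le[of a b c d] by linarith
qed

lemma fhat_tensor_le: assumes "v \<in> S2" shows "fhat f (tensor v) \<le> ereal (6 * M)"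
proof -
  have "(1/4) *\<^sub>R (tensor v + tensor v + tensor v + tensor v) = tensor v"
    by (simp add: vec_eq_iff)
  then have "fhat f (tensor v) \<le> ereal (quad f v v v v)"
    using fhat_le_quad[of v v v v f] assms by simp
  also have "\<dots> \<le> ereal (6 * M)" using abs_quad_le[of v v v v] assms by simp
  finally show ?thesis .
qed

lemma envelope_ge: "ereal (- 6 * M) \<le> envelope f Q"
proof (rule envelope_greatest)
  have "{(x, t::real). x \<in> Msym \<and> ereal (- 6 * M) \<le> ereal t} = Msym \<times> {- 6 * M..}"
    by auto
  then show "econvex_on Msym (\<lambda>_. ereal (- 6 * M))"
    unfolding econvex_on_def by (simp only:) (intro convex_Times convex_Msym convex_real_interval)
  show "lsc_on Msym (\<lambda>_. ereal (- 6 * M))"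
    by (intro lsc_onI) auto
qed (simp only: fhat_ge)

text \<open>Four equal spins bound \<open>fhat\<close> at \<open>tensor v\<close> by
  \<open>6 * M\<close>. Sublevel sets of convex functions are convex, and \<open>K\<close> is the
  hull of these tensors.\<close>

lemma le_on_K:
  assumes h: "econvex_on Msym h" "\<And>Y. Y \<in> Msym \<Longrightarrow> h Y \<le> fhat f Y" and Q: "Q \<in> K"
  shows "h Q \<le> ereal (6 * M)"
proof -
  let ?E = "{(x, t::real). x \<in> Msym \<and> h x \<le> ereal t}"
  have c: "convex ?E" using h by (simp add: econvex_on_def)
  have "convex hull (tensor ` S2) \<subseteq> {Y. (Y, 6 * M) \<in> ?E}"
  proof (rule hull_minimal)
    show "tensor ` S2 \<subseteq> {Y. (Y, 6 * M) \<in> ?E}"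
    proof (rule image_subsetI)
      fix v assume "v \<in> S2"
      then have "tensor v \<in> Msym" "h (tensor v) \<le> ereal (6 * M)"
        using order_trans[OF h(2) fhat_tensor_le, of v] tensor_in_K K_subset_Msym by blast+
      then show "tensor v \<in> {Y. (Y, 6 * M) \<in> ?E}" by simp
    qed
    show "convex {Y. (Y, 6 * M) \<in> ?E}"
    proof (rule convexI)
      fix x y and s t :: real
      assume "x \<in> {Y. (Y, 6 * M) \<in> ?E}" "y \<in> {Y. (Y, 6 * M) \<in> ?E}" and st: "0 \<le> s" "0 \<le> t" "s + t = 1"
      then have "s *\<^sub>R (x, 6 * M) + t *\<^sub>R (y, 6 * M) \<in> ?E"
        by (intro convexD[OF c]) auto
      moreover have "s * (6 * M) + t * (6 * M) = 6 * M" using st by (metis distrib_right mult_1)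
      ultimately show "s *\<^sub>R x + t *\<^sub>R y \<in> {Y. (Y, 6 * M) \<in> ?E}" by simp
    qed
  qed
  then show ?thesis using Q K_eq_hull by auto
qed

lemma envelope_le: "Q \<in> K \<Longrightarrow> envelope f Q \<le> ereal (6 * M)"
  unfolding lsc_convex_envelope_def by (intro SUP_least le_on_K) auto

lemma envelope_real: "Q \<in> K \<Longrightarrow> envelope f Q = ereal (real_of_ereal (envelope f Q))"
  using envelope_le[of Q] envelope_ge[of Q] by (cases "envelope f Q") auto

lemma abs_envelope_le: "Q \<in> K \<Longrightarrow> \<bar>real_of_ereal (envelope f Q)\<bar> \<le> 6 * M"
  using envelope_le[of Q] envelope_ge[of Q] by (cases "envelope f Q") auto

text \<open>Some competitor \<open>h\<close> exceeds \<open>s\<close> at \<open>Q\<close>.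
  Separating \<open>(Q, s)\<close> from a closed convex part of its epigraph over \<open>K\<close>,
  and solving the equation of the hyperplane for the last coordinate, gives an affine minorant of
  \<open>fhat\<close>.\<close>

lemma envelope_aff_minorant:
  assumes Q: "Q \<in> K" and s: "ereal s < envelope f Q"
  shows "\<exists>A b. aff_minorant f A b \<and> s < A \<bullet> Q + b"
proof -
  obtain h where "econvex_on Msym h \<and> lsc_on Msym h \<and> (\<forall>Y\<in>Msym. h Y \<le> fhat f Y) \<and> ereal s < h Q"
    by (rule exE[OF less_envelopeD[OF s]])
  then have h: "econvex_on Msym h" "lsc_on Msym h" "\<And>Y. Y \<in> Msym \<Longrightarrow> h Y \<le> fhat f Y" "ereal s < h Q"
    by simp_all
  define E where "E = {(Y, t). Y \<in> K \<and> h Y \<le> ereal t \<and> - 6 * M \<le> t}"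
  have "E = {(Y, t). Y \<in> Msym \<and> h Y \<le> ereal t} \<inter> (K \<times> {- 6 * M..})"
    using K_subset_Msym by (auto simp: E_def)
  then have cE: "convex E"
    using h(1) unfolding econvex_on_def
    by (simp only:) (intro convex_Int convex_Times convex_K convex_real_interval)
  have clE: "closed E"
    unfolding closed_sequential_limits
  proof (intro allI impI, elim conjE)
    fix x l assume x: "\<forall>n. x n \<in> E" "x \<longlonglongrightarrow> l"
    define Y where "Y = fst l" define t where "t = snd l"
    have lim: "(\<lambda>n. fst (x n)) \<longlonglongrightarrow> Y" "(\<lambda>n. snd (x n)) \<longlonglongrightarrow> t"
      using x(2) by (auto simp: Y_def t_def intro: tendsto_fst tendsto_snd)
    have xn: "fst (x n) \<in> K" "h (fst (x n)) \<le> ereal (snd (x n))" "- 6 * M \<le> snd (x n)" for n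
      using x(1)[rule_format, of n] by (auto simp: E_def)
    have Y: "Y \<in> K" using closed_sequentially[OF closed_K xn(1) lim(1)] .
    have t: "- 6 * M \<le> t" by (rule LIMSEQ_le_const[OF lim(2)]) (use xn(3) in auto)
    have "h Y \<le> ereal t"
    proof (rule ccontr)
      assume "\<not> h Y \<le> ereal t"
      then have "ereal t < h Y" by simp
      from ereal_dense2[OF this] obtain r where r: "t < r" "ereal r < h Y"
        by auto
      obtain e where e: "e > 0" "\<And>y. y \<in> Msym \<Longrightarrow> dist y Y < e \<Longrightarrow> ereal r < h y"
        using lsc_onD[OF h(2) _ r(2)] Y K_subset_Msym by blast
      have "eventually (\<lambda>n. dist (fst (x n)) Y < e) sequentially"
        using lim(1) e(1) by (rule tendstoD)
      then have "eventually (\<lambda>n. r \<le> snd (x n)) sequentially"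
      proof eventually_elim
        case (elim n)
        then have "ereal r < h (fst (x n))" using e(2) xn(1) K_subset_Msym by blast
        also have "\<dots> \<le> ereal (snd (x n))" by (rule xn(2))
        finally show ?case by simp
      qed
      then have "r \<le> t" using tendsto_lowerbound[OF lim(2)] by simp
      then show False using r by simp
    qed
    then show "l \<in> E" using Y t by (simp add: E_def Y_def t_def case_prod_beta)
  qed
  show ?thesis
  proof (cases "s < - 6 * M")
    case True
    then show ?thesis
      using fhat_ge by (intro exI[of _ 0] exI[of _ "- 6 * M"]) (simp add: aff_minorant_def)
  next
    case False
    have "(Q, s) \<notin> E" using h(4) by (auto simp: E_def)
    then obtain z c where z: "z \<bullet> (Q, s) < c" "\<And>x. x \<in> E \<Longrightarrow> c < z \<bullet> x"
      using separating_hyperplane_closed_point[OF cE clE] by blast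
    obtain A \<tau> where A: "z = (A, \<tau>)" by (cases z)
    have sep: "c < A \<bullet> Y + \<tau> * t" if "(Y, t) \<in> E" for Y t
      using z(2)[OF that] by (simp add: A)
    have hQ: "h Q \<le> ereal (6 * M)" using le_on_K[OF h(1,3) Q] by simp
    \<comment> \<open>\<open>E\<close> contains a point above \<open>(Q, s)\<close>, so the
      hyperplane is not vertical and its last coefficient is positive.\<close>
    then have "(Q, 6 * M) \<in> E" using Q M_nonneg by (simp add: E_def)
    then have "A \<bullet> Q + \<tau> * s < A \<bullet> Q + \<tau> * (6 * M)"
      using sep[of Q "6 * M"] z(1) by (simp add: A)
    moreover have "s < 6 * M" using less_le_trans[OF h(4) hQ] by simp
    ultimately have \<tau>: "0 < \<tau>"
      by (metis add_less_cancel_left mult_le_cancel_left not_less order_less_imp_le)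
    have "ereal ((- (1/\<tau>) *\<^sub>R A) \<bullet> Y + c / \<tau>) \<le> fhat f Y" if Y: "Y \<in> K" for Y
    proof (rule ccontr)
      assume "\<not> ?thesis"
      then have "fhat f Y < ereal ((- (1/\<tau>) *\<^sub>R A) \<bullet> Y + c / \<tau>)" by simp
      from ereal_dense2[OF this] obtain r where
        r: "fhat f Y < ereal r" "r < (- (1/\<tau>) *\<^sub>R A) \<bullet> Y + c / \<tau>"
        unfolding less_ereal.simps by blast
      have "ereal (- 6 * M) \<le> ereal r" using fhat_ge[of Y] r(1) by (metis order_less_imp_le order_trans)
      moreover have "h Y \<le> ereal r" using h(3)[of Y] r(1) Y K_subset_Msym by (meson order_less_imp_le order_trans subsetD)
      ultimately have "(Y, r) \<in> E" using Y by (simp add: E_def)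
      from sep[OF this] show False using r(2) \<tau> by (simp add: field_simps)
    qed
    then have "aff_minorant f (- (1/\<tau>) *\<^sub>R A) (c / \<tau>)" by (simp add: aff_minorant_def)
    moreover have "s < (- (1/\<tau>) *\<^sub>R A) \<bullet> Q + c / \<tau>"
      using z(1) \<tau> by (simp add: A field_simps)
    ultimately show ?thesis by blast
  qed
qed

text \<open>The colouring \<open>(x\<^sub>1 + x\<^sub>3, x\<^sub>2 + x\<^sub>3) mod 2\<close> of the lattice puts all four colours on the
  vertices of every unit square.\<close>

lemma quad_achieved:
  assumes S: "a \<in> S2" "b \<in> S2" "c \<in> S2" "d \<in> S2"
  shows "((1/4) *\<^sub>R (tensor a + tensor b + tensor c + tensor d), quad f a b c d) \<in> achieved"
proof -
  define v :: "site \<Rightarrow> real^3" where "v = (\<lambda>(x,y,z). if even (x + z) then if even (y + z) then a else b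
      else if even (y + z) then c else d)"
  have vS: "v i \<in> S2" for i using S by (simp add: v_def split: prod.split)
  have per: "periodic 2 v" by (simp add: periodic_def v_def)
  have e2: "{0..<2} = {0, 1::int}" by auto
  have cell: "cell0 2 = {0,1} \<times> {0,1} \<times> {0,1}" by (simp add: cell0_def e2)
  have sum: "(\<Sum>i\<in>cell0 2. g i) = (\<Sum>x\<in>{0,1}. \<Sum>y\<in>{0,1}. \<Sum>z\<in>{0,1}. g (x,y,z))" for g :: "site \<Rightarrow> real^3^3"
    unfolding cell by (simp add: sum.cartesian_product add.assoc)
  have mt: "mean 2 (\<lambda>i. tensor (v i)) = (1/4) *\<^sub>R (tensor a + tensor b + tensor c + tensor d)"
    unfolding mean_def sum by (simp add: v_def vec_eq_iff)
  note sy = f_sym[OF S(2) S(1)] f_sym[OF S(3) S(1)] f_sym[OF S(4) S(1)] f_sym[OF S(3) S(2)]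
    f_sym[OF S(4) S(2)] f_sym[OF S(4) S(3)]
  \<comment> \<open>Each of the three squares at \<open>i\<close> shows \<open>a\<close>,
    \<open>b\<close>, \<open>c\<close>, \<open>d\<close> once, in an order that depends on two
    parities; symmetry of \<open>f\<close> makes the order irrelevant.\<close>
  have "square_energy f v i = 3 * quad f a b c d" for i
  proof -
    obtain x y z where i: "i = (x,y,z)" by (cases i)
    show ?thesis
      by (cases "even (x + z)"; cases "even (y + z)")
         (auto simp: square_energy_def i v_def quad_def sy)
  qed
  then have "mean 2 (square_energy f v) = 3 * quad f a b c d"
    using card_cell0[of 2] by (simp add: mean_def)
  then show ?thesis
    unfolding achieved_def using vS per mt
    by (intro CollectI case_prodI exI[of _ "2::int"] conjI exI[of _ v] allI) simp_all
qed

section \<open>Realization of the envelope by periodic configurations\<close>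

lemma closure_achieved_mono:
  assumes "(P, s) \<in> closure achieved" "s \<le> s'"
  shows "(P, s') \<in> closure achieved"
proof -
  obtain x where x: "\<And>n. x n \<in> achieved" "x \<longlonglongrightarrow> (P, s)"
    using assms(1) unfolding closure_sequential by blast
  have "x n + (0, s' - s) \<in> achieved" for n
    using x(1)[of n] assms(2) by (cases "x n") (force simp: achieved_def)
  moreover have "(\<lambda>n. x n + (0, s' - s)) \<longlonglongrightarrow> (P, s) + (0, s' - s)"
    by (intro tendsto_intros x)
  ultimately show ?thesis unfolding closure_sequential by force
qed

text \<open>The infimum defining \<open>h\<close> is attained, because the set is closed and
  increasing in the cost. Hence the epigraph of \<open>h\<close> is exactly the closure of
  \<open>achieved\<close>: its convexity makes \<open>h\<close> convex, and its closedness makes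
  \<open>h\<close> lower semicontinuous.\<close>

lemma envelope_achieved:
  assumes Q: "Q \<in> Msym" and s: "envelope f Q \<le> ereal s"
  shows "(Q, s) \<in> closure achieved"
proof -
  define h where "h P = (INF s\<in>{s. (P, s) \<in> closure achieved}. ereal s)" for P
  have key: "h P \<le> ereal t \<longleftrightarrow> (P, t) \<in> closure achieved" for P t
  proof
    assume "(P, t) \<in> closure achieved"
    then show "h P \<le> ereal t" unfolding h_def by (intro INF_lower) auto
  next
    assume le: "h P \<le> ereal t"
    have "(P, t + inverse (real (Suc n))) \<in> closure achieved" for n
    proof -
      have "h P < ereal (t + inverse (real (Suc n)))" using le by (rule le_less_trans) simp
      then obtain r where "(P, r) \<in> closure achieved" "r < t + inverse (real (Suc n))"
        unfolding h_def INF_less_iff by auto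
      then show ?thesis using closure_achieved_mono by (metis order_less_imp_le)
    qed
    moreover have "(\<lambda>n. (P, t + inverse (real (Suc n)))) \<longlonglongrightarrow> (P, t + 0)"
      by (intro tendsto_intros LIMSEQ_inverse_real_of_nat)
    ultimately show "(P, t) \<in> closure achieved"
      using closed_sequentially[OF closed_closure] by fastforce
  qed
  have "h Q \<le> envelope f Q"
  proof (rule envelope_greatest)
    have "{(x, t::real). x \<in> Msym \<and> h x \<le> ereal t} = (Msym \<times> UNIV) \<inter> closure achieved"
      by (auto simp: key)
    then show "econvex_on Msym h"
      unfolding econvex_on_def
      by (simp only:) (intro convex_Int convex_Times convex_Msym convex_UNIV convex_closure_achieved)
    show "lsc_on Msym h"
    proof (rule lsc_onI, rule ccontr)
      fix x r assume x: "x \<in> Msym" "r < h x" and n: "\<not> (\<forall>\<^sub>F y in at x within Msym. r < h y)"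
      obtain t where t: "r < ereal t" "ereal t < h x" using ereal_dense2[OF x(2)] by blast
      have "\<exists>y\<in>Msym. dist y x < inverse (real (Suc n)) \<and> h y \<le> ereal t" for n
      proof (rule ccontr)
        assume "\<not> ?thesis"
        then have "\<forall>y\<in>Msym. y \<noteq> x \<and> dist y x < inverse (real (Suc n)) \<longrightarrow> r < h y"
          using t(1) by (meson less_trans not_le)
        then have "\<forall>\<^sub>F y in at x within Msym. r < h y"
          unfolding eventually_at by (intro exI[of _ "inverse (real (Suc n))"]) auto
        then show False using n by simp
      qed
      then obtain y where y: "\<And>n. dist (y n) x < inverse (real (Suc n))" "\<And>n. h (y n) \<le> ereal t"
        by metis
      have "(\<lambda>n. dist (y n) x) \<longlonglongrightarrow> 0"
        by (rule tendsto_sandwich[OF _ always_eventually[OF allI[OF less_imp_le[OF y(1)]]] tendsto_const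
              LIMSEQ_inverse_real_of_nat]) simp
      then have "y \<longlonglongrightarrow> x" by (rule tendsto_dist_iff[THEN iffD2])
      then have "(\<lambda>n. (y n, t)) \<longlonglongrightarrow> (x, t)" by (intro tendsto_intros)
      moreover have "(y n, t) \<in> closure achieved" for n using y(2) key by blast
      ultimately have "(x, t) \<in> closure achieved"
        by (rule closed_sequentially[OF closed_closure, rotated])
      then show False using t(2) key[of x t] by simp
    qed
    show "h Y \<le> fhat f Y" if "Y \<in> Msym" for Y
    proof (rule ccontr)
      assume "\<not> h Y \<le> fhat f Y"
      then have "fhat f Y < h Y" by simp
      from ereal_dense2[OF this] obtain r where r: "fhat f Y < ereal r" "ereal r < h Y"
        by blast
      from r(1) obtain a b c d where abcd: "a \<in> S2" "b \<in> S2" "c \<in> S2" "d \<in> S2"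
        "Y = (1/4) *\<^sub>R (tensor a + tensor b + tensor c + tensor d)" "quad f a b c d < r"
        by (rule fhat_lessE)
      then have "(Y, quad f a b c d) \<in> closure achieved"
        using subsetD[OF closure_subset quad_achieved[OF abcd(1-4)]] by simp
      then have "(Y, r) \<in> closure achieved"
        by (rule closure_achieved_mono) (use abcd(6) in simp)
      then show False using r(2) key[of Y r] by simp
    qed
  qed
  then show ?thesis using s key order_trans by blast
qed

text \<open>A point of the closure is approximated by a true configuration in mean tensor and cost
  at the same time; this is the form in which the constructions use the envelope.\<close>

lemma envelope_periodic:
  assumes Q: "Q \<in> K" and e: "0 < e"
  shows "\<exists>N v. 0 < N \<and> (\<forall>i. v i \<in> S2) \<and> periodic N v \<and> norm (mean N (\<lambda>i. tensor (v i)) - Q) \<le> e \<and>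
     mean N (square_energy f v) \<le> 3 * (real_of_ereal (envelope f Q) + e)"
proof -
  have "(Q, real_of_ereal (envelope f Q)) \<in> closure achieved"
    using envelope_achieved[of Q] envelope_real[OF Q] Q K_subset_Msym by auto
  then obtain y where y: "y \<in> achieved" "dist y (Q, real_of_ereal (envelope f Q)) < e"
    using e unfolding closure_approachable by blast
  obtain P s where P: "y = (P, s)" by (cases y)
  have "dist P Q \<le> e" "dist s (real_of_ereal (envelope f Q)) \<le> e"
    using y(2) dist_fst_le[of y "(Q, real_of_ereal (envelope f Q))"]
      dist_snd_le[of y "(Q, real_of_ereal (envelope f Q))"] by (auto simp: P)
  then have 1: "norm (P - Q) \<le> e" "3 * s \<le> 3 * (real_of_ereal (envelope f Q) + e)"
    by (auto simp: dist_norm)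
  obtain N v where v: "N > 0" "\<forall>i. v i \<in> S2" "periodic N v"
     "mean N (\<lambda>i. tensor (v i)) = P" "mean N (square_energy f v) \<le> 3 * s"
    using y(1) by (auto simp: achieved_def P)
  then show ?thesis using 1 by (intro exI[of _ N] exI[of _ v]) auto
qed

text \<open>Every square costs at least the minorant at its mean tensor. In the three squares at
  \<open>i\<close> the vertex \<open>i\<close> has total weight 3/4, each of the three axis
  neighbours 1/2 and each of the three diagonal ones 1/4. Shifting the neighbours, of total weight
  9/4, back to \<open>i\<close> costs \<open>2 * norm A\<close> per collar site, and the energy is
  half of the square energies: this is the constant 9/4.\<close>

lemma energy_ge_affine:
  assumes S: "finite S" and u: "\<And>i. u i \<in> S2" and A: "aff_minorant f A b"
  shows "3/2 * (\<Sum>i\<in>S. A \<bullet> tensor (u i) + b) - (18 * M + 9/4 * norm A) * real (card (bd 1 S)) \<le> energy f S u"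
proof -
  define g where "g i = A \<bullet> tensor (u i)" for i
  have q: "1/4 * (g i + g j + g k + g l) + b \<le> quad f (u i) (u j) (u k) (u l)" for i j k l
  proof -
    let ?Y = "(1/4) *\<^sub>R (tensor (u i) + tensor (u j) + tensor (u k) + tensor (u l))"
    have le: "fhat f ?Y \<le> ereal (quad f (u i) (u j) (u k) (u l))"
      by (intro fhat_le_quad u)
    then have "?Y \<in> K" by (auto simp: fhat_def split: if_splits)
    from bspec[OF A[unfolded aff_minorant_def] this] have "ereal (A \<bullet> ?Y + b) \<le> fhat f ?Y" .
    from order_trans[OF this le] show ?thesis by (simp add: g_def inner_add_right)
  qed
  define G where "G = (\<Sum>i\<in>S. g i)"
  define B where "B = norm A * real (card (bd 1 S))"
  have gl: "\<bar>g i\<bar> \<le> norm A" for i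
    using Cauchy_Schwarz_ineq2[of A "tensor (u i)"] norm_tensor[OF u] by (simp add: g_def)
  have sh: "G - 2 * B \<le> (\<Sum>i\<in>S. g (i + \<eta>))" if "\<eta> \<in> site_box 1" for \<eta>
    using sum_shift_le[OF S that, of g "norm A"] gl by (simp add: G_def B_def)
  have "3 * (G + b * real (card S)) - 9/2 * B \<le>
     (\<Sum>i\<in>S. 3/4 * g i + 1/2 * g (i + (1,0,0)) + 1/2 * g (i + (0,1,0)) + 1/2 * g (i + (0,0,1))
       + 1/4 * g (i + (1,1,0)) + 1/4 * g (i + (1,0,1)) + 1/4 * g (i + (0,1,1)) + 3 * b)"
    using sh[of "(1,0,0)"] sh[of "(0,1,0)"] sh[of "(0,0,1)"] sh[of "(1,1,0)"] sh[of "(1,0,1)"] sh[of "(0,1,1)"]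
    by (simp add: sum.distrib site_box_def flip: sum_distrib_left sum_divide_distrib G_def)
  also have "\<dots> \<le> (\<Sum>i\<in>S. square_energy f u i)"
  proof (rule sum_mono)
    fix i
    show "3/4 * g i + 1/2 * g (i + (1,0,0)) + 1/2 * g (i + (0,1,0)) + 1/2 * g (i + (0,0,1))
       + 1/4 * g (i + (1,1,0)) + 1/4 * g (i + (1,0,1)) + 1/4 * g (i + (0,1,1)) + 3 * b \<le> square_energy f u i"
      using q[of i "i + (1,0,0)" "i + (0,1,0)" "i + (1,1,0)"] q[of i "i + (1,0,0)" "i + (0,0,1)" "i + (1,0,1)"]
        q[of i "i + (0,1,0)" "i + (0,0,1)" "i + (0,1,1)"]
      by (auto simp: square_energy_def field_simps)
  qed
  finally have "3/2 * (G + b * real (card S)) - 9/4 * B - 18 * M * real (card (bd 1 S)) \<le> energy f S u"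
    using energy_square_energy[where u=u, OF S u] unfolding abs_le_iff by argo
  then show ?thesis
    by (simp add: G_def g_def B_def sum.distrib algebra_simps)
qed

end

section \<open>Lattice cells and Lebesgue measure\<close>

definition emb :: "site \<Rightarrow> real^3" where
  "emb = (\<lambda>(a,b,c). vector [of_int a, of_int b, of_int c])"

text \<open>Rounding with the half-open convention of \<open>W3\<close>, so that every point belongs
  to exactly one cell.\<close>

definition nearest :: "real^3 \<Rightarrow> site" where
  "nearest x = (\<lfloor>x$1 + 1/2\<rfloor>, \<lfloor>x$2 + 1/2\<rfloor>, \<lfloor>x$3 + 1/2\<rfloor>)"

definition cells :: "real \<Rightarrow> site set \<Rightarrow> (real^3) set" where
  "cells \<epsilon> S = {x. nearest (x /\<^sub>R \<epsilon>) \<in> S}"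

text \<open>The radius is measured in lattice units, so that for fixed \<open>r\<close> the sites
  approach \<open>C\<close> as \<epsilon> tends to 0, and the collar of such a set lies in another
  one with a larger radius.\<close>

definition near :: "real \<Rightarrow> real \<Rightarrow> (real^3) set \<Rightarrow> site set" where
  "near \<epsilon> r C = {i. \<exists>y\<in>C. norm (\<epsilon> *\<^sub>R emb i - y) \<le> r * \<epsilon>}"

definition sites :: "real \<Rightarrow> (real^3) set \<Rightarrow> site set" where
  "sites \<epsilon> \<Omega> = {i. \<epsilon> *\<^sub>R emb i \<in> \<Omega>}"

lemma emb_nth: "emb i $ 1 = of_int (fst i)" "emb i $ 2 = of_int (fst (snd i))" "emb i $ 3 = of_int (snd (snd i))"
  by (simp_all add: emb_def vector_def split: prod.split)

lemma emb_add: "emb (i + j) = emb i + emb j"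
  by (simp add: vec_eq_iff forall_3 emb_nth)

lemma emb_diff: "emb (i - j) = emb i - emb j"
  by (simp add: vec_eq_iff forall_3 emb_nth)

lemma inj_emb: "inj emb"
  by (rule injI) (simp add: vec_eq_iff forall_3 emb_nth prod_eq_iff)

lemma range_emb: "range emb = Z3"
proof
  show "range emb \<subseteq> Z3"
    by (auto simp: Z3_def forall_3 emb_nth)
  show "Z3 \<subseteq> range emb"
  proof
    fix x assume "x \<in> Z3"
    then obtain a b c where "x$1 = of_int a" "x$2 = of_int b" "x$3 = of_int c"
      unfolding Z3_def forall_3 by (metis (mono_tags, lifting) Ints_cases mem_Collect_eq)
    then have "x = emb (a,b,c)" by (simp add: vec_eq_iff forall_3 emb_nth)
    then show "x \<in> range emb" by simp
  qed
qed

lemma norm_emb_squared: "(norm (emb (a,b,c)))\<^sup>2 = of_int (a\<^sup>2 + b\<^sup>2 + c\<^sup>2)"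
  unfolding power2_norm_eq_inner inner_vec_def sum_3 emb_nth by (simp add: power2_eq_square)

text \<open>Comparing squares turns the conditions \<open>norm \<xi> = 1\<close> and
  \<open>norm \<xi> = sqrt 2\<close> into equations between integers.\<close>

lemma c_weight_emb: "c_weight (emb \<xi>) = wt \<xi>"
proof -
  obtain a b c where \<xi>: "\<xi> = (a,b,c)" by (cases \<xi>)
  have "norm (emb \<xi>) = sqrt (of_int m) \<longleftrightarrow> a\<^sup>2 + b\<^sup>2 + c\<^sup>2 = m" if "0 \<le> m" for m
  proof -
    have "norm (emb \<xi>) = sqrt (of_int m) \<longleftrightarrow> (norm (emb \<xi>))\<^sup>2 = of_int m"
      using that by (metis norm_ge_zero of_int_0_le_iff real_sqrt_pow2 real_sqrt_unique)
    also have "\<dots> \<longleftrightarrow> a\<^sup>2 + b\<^sup>2 + c\<^sup>2 = m"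
      unfolding \<xi> norm_emb_squared of_int_eq_iff ..
    finally show ?thesis .
  qed
  from this[of 1] this[of 2] show ?thesis
    by (simp add: c_weight_def wt_def \<xi>)
qed

lemma norm_vec3_le: "norm (x :: real^3) \<le> \<bar>x$1\<bar> + \<bar>x$2\<bar> + \<bar>x$3\<bar>"
  using norm_le_l1_cart[of x] by (simp add: sum_3)

lemma norm_emb_site_box: "\<xi> \<in> site_box r \<Longrightarrow> norm (emb \<xi>) \<le> 3 * of_int r"
  using norm_vec3_le[of "emb \<xi>"] by (cases \<xi>) (auto simp: site_box_def emb_nth)

lemma nearest_eq_iff: "nearest x = i \<longleftrightarrow> (\<forall>k. emb i $ k - 1/2 \<le> x $ k \<and> x $ k < emb i $ k + 1/2)"
  by (cases i) (auto simp: nearest_def forall_3 emb_nth floor_eq_iff)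

lemma nearest_eq_iff_W3: "nearest x = i \<longleftrightarrow> x - emb i \<in> W3"
proof -
  have "- 1/2 \<le> y - e \<and> y - e < 1/2 \<longleftrightarrow> e - 1/2 \<le> y \<and> y < e + 1/2" for y e :: real
    by linarith
  then show ?thesis
    unfolding nearest_eq_iff W3_def by simp
qed

text \<open>The sum of the coordinates gives 3/2, rounded up to 2. This is the radius in
  \<open>near \<epsilon> 2 C\<close>, which makes the cells of these sites cover
  \<open>C\<close>.\<close>

lemma norm_nearest: "norm (x - emb (nearest x)) \<le> 2"
proof -
  have "- 1/2 \<le> (x - emb (nearest x)) $ k \<and> (x - emb (nearest x)) $ k < 1/2" for k
    using nearest_eq_iff_W3[of x "nearest x"] by (simp add: W3_def)
  moreover have "\<bar>y\<bar> \<le> 1/2" if "- 1/2 \<le> y \<and> y < 1/2" for y :: real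
    using that by linarith
  ultimately have "\<bar>(x - emb (nearest x)) $ k\<bar> \<le> 1/2" for k
    by blast
  from this[of 1] this[of 2] this[of 3] show ?thesis
    using norm_vec3_le[of "x - emb (nearest x)"] by linarith
qed

lemma norm_nearest_scaled:
  assumes "0 < \<epsilon>" "nearest (x /\<^sub>R \<epsilon>) = i" shows "norm (x - \<epsilon> *\<^sub>R emb i) \<le> 2 * \<epsilon>"
proof -
  have "x - \<epsilon> *\<^sub>R emb i = \<epsilon> *\<^sub>R (x /\<^sub>R \<epsilon> - emb i)"
    using assms(1) by (simp add: scaleR_right_diff_distrib)
  then show ?thesis
    using norm_nearest[of "x /\<^sub>R \<epsilon>"] assms by (simp add: mult.commute)
qed

lemma nearest_measurable: "(\<lambda>x. nearest (x /\<^sub>R \<epsilon>)) \<in> measurable borel (count_space UNIV)"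
proof -
  have "(\<lambda>x. nearest (x /\<^sub>R \<epsilon>)) -` {i} = (\<Inter>k. {x. emb i $ k - 1/2 \<le> (x /\<^sub>R \<epsilon>) $ k} \<inter> {x. (x /\<^sub>R \<epsilon>) $ k < emb i $ k + 1/2})" for i
    by (auto simp: nearest_eq_iff)
  also have "\<dots> i \<in> sets borel" for i
    by measurable
  finally show ?thesis
    by (simp add: measurable_count_space_eq2_countable)
qed

lemma cells_borel: "cells \<epsilon> S \<in> sets borel"
proof -
  have "cells \<epsilon> S = (\<lambda>x. nearest (x /\<^sub>R \<epsilon>)) -` S \<inter> space borel"
    by (auto simp: cells_def)
  then show ?thesis
    using measurable_sets[OF nearest_measurable, of S \<epsilon>] by simp
qed

text \<open>The half-open cell lies between an open and a closed box of the same volume.\<close>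

lemma measure_cell:
  assumes "0 < \<epsilon>" shows "cells \<epsilon> {i} \<in> lmeasurable" "measure lebesgue (cells \<epsilon> {i}) = \<epsilon>^3"
proof -
  define a where "a = \<epsilon> *\<^sub>R (emb i - (\<chi> k. 1/2))"
  define b where "b = \<epsilon> *\<^sub>R (emb i + (\<chi> k. 1/2))"
  have cell: "cells \<epsilon> {i} = {x. \<forall>k. a $ k \<le> x $ k \<and> x $ k < b $ k}"
    using assms by (auto simp: cells_def nearest_eq_iff a_def b_def field_simps)
  have sub: "box a b \<subseteq> cells \<epsilon> {i}" "cells \<epsilon> {i} \<subseteq> cbox a b"
    unfolding cell by (auto simp: mem_box_cart less_imp_le)
  show lm: "cells \<epsilon> {i} \<in> lmeasurable"
    by (rule bounded_set_imp_lmeasurable)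
       (auto intro: bounded_subset[OF bounded_cbox sub(2)] simp: cells_borel)
  have c: "measure lebesgue (cbox a b) = \<epsilon>^3"
  proof -
    have "a \<in> cbox a b" using assms by (simp add: mem_box_cart a_def b_def)
    then have "cbox a b \<noteq> {}" by blast
    then have "measure lborel (cbox a b) = (\<Prod>k\<in>UNIV. b $ k - a $ k)"
      by (simp add: content_cbox_cart)
    also have "\<dots> = \<epsilon>^3" by (simp add: a_def b_def algebra_simps power3_eq_cube)
    finally show ?thesis by simp
  qed
  moreover have "measure lebesgue (box a b) = measure lebesgue (cbox a b)"
    by (simp add: measure_lborel_box_eq measure_lborel_cbox_eq)
  ultimately show "measure lebesgue (cells \<epsilon> {i}) = \<epsilon>^3"
    using measure_mono_fmeasurable[OF sub(1) _ lm] measure_mono_fmeasurable[OF sub(2) _ lmeasurable_cbox] lm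
    by (simp add: fmeasurableD)
qed

lemma measure_cells:
  assumes "0 < \<epsilon>" "finite S"
  shows "cells \<epsilon> S \<in> lmeasurable" "measure lebesgue (cells \<epsilon> S) = \<epsilon>^3 * real (card S)"
proof -
  have eq: "cells \<epsilon> S = (\<Union>i\<in>S. cells \<epsilon> {i})" by (auto simp: cells_def)
  show "cells \<epsilon> S \<in> lmeasurable"
    unfolding eq using assms by (intro fmeasurable.finite_UN measure_cell) auto
  have "measure lebesgue (\<Union>i\<in>S. cells \<epsilon> {i}) = (\<Sum>i\<in>S. measure lebesgue (cells \<epsilon> {i}))"
  proof (intro measure_negligible_finite_Union_image measure_cell assms pairwiseI)
    fix i j :: site assume "i \<noteq> j"
    then have "cells \<epsilon> {i} \<inter> cells \<epsilon> {j} = {}" by (auto simp: cells_def)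
    then show "negligible (cells \<epsilon> {i} \<inter> cells \<epsilon> {j})" by simp
  qed
  then show "measure lebesgue (cells \<epsilon> S) = \<epsilon>^3 * real (card S)"
    using assms by (simp add: eq measure_cell)
qed

lemma finite_bounded_sites:
  assumes "0 < \<epsilon>" "\<And>i. i \<in> S \<Longrightarrow> norm (\<epsilon> *\<^sub>R emb i) \<le> R"
  shows "finite S"
proof (rule finite_subset)
  define m where "m = \<lceil>R / \<epsilon>\<rceil>"
  show "S \<subseteq> {-m..m} \<times> {-m..m} \<times> {-m..m}"
  proof
    fix i assume i: "i \<in> S"
    have "\<bar>emb i $ k\<bar> \<le> R / \<epsilon>" for k
    proof -
      have "\<bar>emb i $ k\<bar> \<le> norm (emb i)" by (rule component_le_norm_cart)
      also have "\<dots> \<le> R / \<epsilon>" using assms(2)[OF i] assms(1) by (simp add: field_simps)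
      finally show ?thesis .
    qed
    then have "\<bar>emb i $ k\<bar> \<le> of_int m" for k unfolding m_def by (meson le_of_int_ceiling order_trans)
    from this[of 1] this[of 2] this[of 3] show "i \<in> {-m..m} \<times> {-m..m} \<times> {-m..m}"
      unfolding emb_nth by (cases i) auto
  qed
qed simp

lemma finite_near: assumes "0 < \<epsilon>" "bounded C" shows "finite (near \<epsilon> r C)"
proof -
  obtain R where R: "\<And>y. y \<in> C \<Longrightarrow> norm y \<le> R" using assms(2) unfolding bounded_iff by blast
  show ?thesis
  proof (rule finite_bounded_sites[OF assms(1), of _ "R + r * \<epsilon>"])
    fix i assume "i \<in> near \<epsilon> r C"
    then obtain y where y: "y \<in> C" "norm (\<epsilon> *\<^sub>R emb i - y) \<le> r * \<epsilon>" by (auto simp: near_def)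
    show "norm (\<epsilon> *\<^sub>R emb i) \<le> R + r * \<epsilon>"
      using norm_triangle_sub[of "\<epsilon> *\<^sub>R emb i" y] R[OF y(1)] y(2) by linarith
  qed
qed

lemma finite_sites: assumes "0 < \<epsilon>" "bounded \<Omega>" shows "finite (sites \<epsilon> \<Omega>)"
proof -
  obtain R where R: "\<And>y. y \<in> \<Omega> \<Longrightarrow> norm y \<le> R" using assms(2) unfolding bounded_iff by blast
  show ?thesis
    by (rule finite_bounded_sites[OF assms(1), of _ R], rule R) (simp only: sites_def mem_Collect_eq)
qed

lemma near_mono: "0 < \<epsilon> \<Longrightarrow> r \<le> s \<Longrightarrow> near \<epsilon> r C \<subseteq> near \<epsilon> s C"
  unfolding near_def by (blast intro: order_trans mult_right_mono less_imp_le)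

text \<open>A step within \<open>site_box m\<close> has length at most \<open>3 * m\<close> lattice
  units, again by summing the coordinates.\<close>

lemma nb_near: assumes "0 < \<epsilon>" shows "nb m (near \<epsilon> r C) \<subseteq> near \<epsilon> (r + 3 * of_int m) C"
proof
  fix j assume "j \<in> nb m (near \<epsilon> r C)"
  then obtain i \<xi> y where i: "j = i + \<xi>" "\<xi> \<in> site_box m" "y \<in> C" "norm (\<epsilon> *\<^sub>R emb i - y) \<le> r * \<epsilon>"
    by (auto simp: nb_def near_def)
  have "\<epsilon> *\<^sub>R emb j - y = (\<epsilon> *\<^sub>R emb i - y) + \<epsilon> *\<^sub>R emb \<xi>"
    by (simp add: i emb_add scaleR_add_right)
  then have "norm (\<epsilon> *\<^sub>R emb j - y) \<le> r * \<epsilon> + \<epsilon> * norm (emb \<xi>)"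
    using norm_triangle_ineq[of "\<epsilon> *\<^sub>R emb i - y" "\<epsilon> *\<^sub>R emb \<xi>"] i(4) assms
    by (simp add: diff_add_eq)
  also have "\<dots> \<le> r * \<epsilon> + \<epsilon> * (3 * of_int m)"
    using norm_emb_site_box[OF i(2)] assms by (intro add_left_mono mult_left_mono) auto
  finally show "j \<in> near \<epsilon> (r + 3 * of_int m) C"
    using i(3) by (auto simp: near_def algebra_simps)
qed

lemma subset_cells_near: "0 < \<epsilon> \<Longrightarrow> C \<subseteq> cells \<epsilon> (near \<epsilon> 2 C)"
  using norm_nearest_scaled by (fastforce simp: cells_def near_def norm_minus_commute)

lemma eventually_at_right_0I: "0 < d \<Longrightarrow> (\<And>\<epsilon>::real. 0 < \<epsilon> \<Longrightarrow> \<epsilon> < d \<Longrightarrow> P \<epsilon>) \<Longrightarrow> eventually P (at_right 0)"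
  unfolding eventually_at_right_field by blast

text \<open>A compact subset of an open set has a uniform margin \<open>e\<close>, and a point of a
  selected cell is within \<open>(r + 2) * \<epsilon>\<close> of \<open>C\<close>. The larger factor
  \<open>\<bar>r\<bar> + 3\<close> is positive for every \<open>r\<close> and makes the inequality
  strict.\<close>

lemma eventually_cells_near_subset:
  assumes "compact C" "open T" "C \<subseteq> T"
  shows "eventually (\<lambda>\<epsilon>. cells \<epsilon> (near \<epsilon> r C) \<subseteq> T) (at_right 0)"
proof -
  obtain e where e: "e > 0" "(\<Union>x\<in>C. ball x e) \<subseteq> T"
    using compact_subset_open_imp_ball_epsilon_subset[OF assms] by blast
  show ?thesis
  proof (rule eventually_at_right_0I)
    show "0 < e / (\<bar>r\<bar> + 3)" using e(1) by simp
    fix \<epsilon> :: real assume \<epsilon>: "0 < \<epsilon>" "\<epsilon> < e / (\<bar>r\<bar> + 3)"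
    show "cells \<epsilon> (near \<epsilon> r C) \<subseteq> T"
    proof
      fix x assume "x \<in> cells \<epsilon> (near \<epsilon> r C)"
      then obtain y where y: "y \<in> C" "norm (\<epsilon> *\<^sub>R emb (nearest (x /\<^sub>R \<epsilon>)) - y) \<le> r * \<epsilon>"
        by (auto simp: cells_def near_def)
      define i where "i = nearest (x /\<^sub>R \<epsilon>)"
      have i: "nearest (x /\<^sub>R \<epsilon>) = i" "y \<in> C" "norm (\<epsilon> *\<^sub>R emb i - y) \<le> r * \<epsilon>"
        using y by (simp_all add: i_def)
      have "norm (x - y) \<le> norm (x - \<epsilon> *\<^sub>R emb i) + norm (\<epsilon> *\<^sub>R emb i - y)"
        using norm_triangle_ineq[of "x - \<epsilon> *\<^sub>R emb i" "\<epsilon> *\<^sub>R emb i - y"] by simp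
      also have "\<dots> \<le> 2 * \<epsilon> + r * \<epsilon>" using norm_nearest_scaled[OF \<epsilon>(1) i(1)] i(3) by linarith
      also have "\<dots> < (\<bar>r\<bar> + 3) * \<epsilon>"
        using \<epsilon>(1) mult_right_mono[OF abs_ge_self[of r] less_imp_le[OF \<epsilon>(1)]]
        unfolding distrib_right by linarith
      also have "\<dots> < e" using \<epsilon>(2) by (simp add: field_simps)
      finally have "x \<in> ball y e" by (simp add: dist_norm norm_minus_commute)
      then show "x \<in> T" using i(2) e(2) by blast
    qed
  qed
qed

section \<open>Counting sites near compact sets\<close>

lemma eventually_pos_at_right_0: "eventually (\<lambda>\<epsilon>::real. 0 < \<epsilon>) (at_right 0)"
  by (rule eventually_at_right_less)

text \<open>Outer regularity: the cells of the selected sites eventually fit into an open set whose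
  measure is close to that of \<open>C\<close>. Together with \<open>card_near_ge\<close>, the
  rescaled count for radius 2 converges to the measure of \<open>C\<close>.\<close>

lemma card_near_le:
  assumes C: "compact C" and e: "0 < e"
  shows "eventually (\<lambda>\<epsilon>. \<epsilon>^3 * real (card (near \<epsilon> r C)) \<le> measure lebesgue C + e) (at_right 0)"
proof -
  have Cm: "C \<in> lmeasurable" using C by (rule lmeasurable_compact)
  obtain T where T: "open T" "C \<subseteq> T" "T - C \<in> lmeasurable" "emeasure lebesgue (T - C) < ennreal e"
    using sets_lebesgue_outer_open[OF fmeasurableD[OF Cm] e] by blast
  have Te: "T \<in> lmeasurable" "measure lebesgue T \<le> measure lebesgue C + e"
  proof -
    have TC: "T = C \<union> (T - C)" using T(2) by blast
    then show "T \<in> lmeasurable" using Cm T(3) by (metis fmeasurable.Un)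
    have "measure lebesgue T \<le> measure lebesgue C + measure lebesgue (T - C)"
      using TC measure_Un_le[of C lebesgue "T - C"] Cm T(3) by (metis fmeasurableD)
    moreover have "measure lebesgue (T - C) \<le> e"
      using T(4) e by (simp add: measure_def enn2real_leI less_imp_le)
    ultimately show "measure lebesgue T \<le> measure lebesgue C + e" by simp
  qed
  show ?thesis
    using eventually_cells_near_subset[OF C T(1,2), of r] eventually_pos_at_right_0
  proof eventually_elim
    case (elim \<epsilon>)
    have fin: "finite (near \<epsilon> r C)" by (intro finite_near elim compact_imp_bounded C)
    have "\<epsilon>^3 * real (card (near \<epsilon> r C)) = measure lebesgue (cells \<epsilon> (near \<epsilon> r C))"
      using measure_cells[OF elim(2) fin] by simp
    also have "\<dots> \<le> measure lebesgue T"
      using elim(1) Te(1) measure_cells[OF elim(2) fin] by (intro measure_mono_fmeasurable) auto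
    finally show ?case using Te(2) by linarith
  qed
qed

lemma card_near_ge:
  assumes C: "compact C" and e: "0 < \<epsilon>"
  shows "measure lebesgue C \<le> \<epsilon>^3 * real (card (near \<epsilon> 2 C))"
proof -
  have fin: "finite (near \<epsilon> 2 C)" by (intro finite_near e compact_imp_bounded C)
  have "measure lebesgue C \<le> measure lebesgue (cells \<epsilon> (near \<epsilon> 2 C))"
    using measure_cells[OF e fin] subset_cells_near[OF e, of C] lmeasurable_compact[OF C]
    by (intro measure_mono_fmeasurable) auto
  then show ?thesis using measure_cells[OF e fin] by simp
qed

text \<open>The collar lies between the neighbourhoods of \<open>C\<close> with radii 2 and
  \<open>2 + 3 * m\<close>. The smaller count is at least the measure of \<open>C\<close> after
  rescaling, and the larger one exceeds it by little.\<close>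

lemma card_bd_near:
  assumes C: "compact C" and e: "0 < e" and m: "0 \<le> m"
  shows "eventually (\<lambda>\<epsilon>. \<epsilon>^3 * real (card (bd m (near \<epsilon> 2 C))) \<le> e) (at_right 0)"
  using card_near_le[OF C e, of "2 + 3 * of_int m"] eventually_pos_at_right_0
proof eventually_elim
  case (elim \<epsilon>)
  let ?A = "near \<epsilon> (2 + 3 * of_int m) C" and ?B = "near \<epsilon> 2 C"
  have fin: "finite ?A" "finite ?B" by (intro finite_near elim compact_imp_bounded C)+
  have sub: "?B \<subseteq> ?A" using m elim(2) by (intro near_mono) auto
  have "real (card (bd m ?B)) \<le> real (card (?A - ?B))"
    using nb_near[OF elim(2), of m 2 C] fin by (auto simp: bd_def intro!: card_mono)
  also have "\<dots> = real (card ?A) - real (card ?B)"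
    using fin sub by (simp add: card_Diff_subset card_mono of_nat_diff)
  finally have "\<epsilon>^3 * real (card (bd m ?B)) \<le> \<epsilon>^3 * real (card ?A) - \<epsilon>^3 * real (card ?B)"
    using elim(2) by (metis mult_left_mono right_diff_distrib zero_le_power less_imp_le)
  then show ?case using elim(1) card_near_ge[OF C elim(2)] by linarith
qed

section \<open>Counting sites of a domain and near its frontier\<close>

lemma segment_meets_frontier:
  fixes x y :: "'a::real_normed_vector"
  assumes "x \<in> \<Omega>" "y \<notin> \<Omega>"
  shows "\<exists>z\<in>frontier \<Omega>. norm (x - z) \<le> norm (x - y) \<and> norm (y - z) \<le> norm (x - y)"
proof -
  have "closed_segment x y \<inter> frontier \<Omega> \<noteq> {}"
    using assms by (intro connected_Int_frontier connected_segment) (auto simp: disjoint_iff)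
  then obtain z where "z \<in> closed_segment x y" "z \<in> frontier \<Omega>" by blast
  then show ?thesis
    using segment_bound[of z x y] by (auto simp: norm_minus_commute intro!: bexI[of _ z])
qed

lemma card_near_frontier:
  assumes "bounded \<Omega>" "negligible (frontier \<Omega>)" "0 < e"
  shows "eventually (\<lambda>\<epsilon>. \<epsilon>^3 * real (card (near \<epsilon> r (frontier \<Omega>))) \<le> e) (at_right 0)"
  using card_near_le[OF compact_frontier_bounded[OF assms(1)] assms(3), of r]
    negligible_imp_measure0[OF assms(2)] by simp

lemma bounded_frontier_if: "bounded \<Omega> \<Longrightarrow> bounded (frontier (\<Omega> :: (real^3) set))"
  by (rule compact_imp_bounded) (rule compact_frontier_bounded)

text \<open>The segment from a site inside to a site outside meets the frontier, no farther from the
  outer site than the length of the step.\<close>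

lemma bd_sites_subset: assumes "0 < \<epsilon>" shows "bd m (sites \<epsilon> \<Omega>) \<subseteq> near \<epsilon> (3 * of_int m) (frontier \<Omega>)"
proof
  fix j assume "j \<in> bd m (sites \<epsilon> \<Omega>)"
  then obtain i \<xi> where i: "j = i + \<xi>" "\<xi> \<in> site_box m" "\<epsilon> *\<^sub>R emb i \<in> \<Omega>" "\<epsilon> *\<^sub>R emb j \<notin> \<Omega>"
    by (auto simp: bd_def nb_def sites_def)
  obtain z where z: "z \<in> frontier \<Omega>" "norm (\<epsilon> *\<^sub>R emb j - z) \<le> norm (\<epsilon> *\<^sub>R emb i - \<epsilon> *\<^sub>R emb j)"
    using segment_meets_frontier[OF i(3,4)] by blast
  have "norm (\<epsilon> *\<^sub>R emb i - \<epsilon> *\<^sub>R emb j) = \<epsilon> * norm (emb \<xi>)"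
    using assms by (simp add: i(1) emb_add scaleR_add_right)
  also have "\<dots> \<le> \<epsilon> * (3 * of_int m)"
    using norm_emb_site_box[OF i(2)] assms by (intro mult_left_mono) auto
  finally show "j \<in> near \<epsilon> (3 * of_int m) (frontier \<Omega>)"
    using z unfolding near_def by (intro CollectI bexI[of _ z]) (simp_all add: mult.commute)
qed

lemma card_bd_sites:
  assumes "bounded \<Omega>" "negligible (frontier \<Omega>)" "0 < e"
  shows "eventually (\<lambda>\<epsilon>. \<epsilon>^3 * real (card (bd m (sites \<epsilon> \<Omega>))) \<le> e) (at_right 0)"
  using card_near_frontier[OF assms, of "3 * of_int m"] eventually_pos_at_right_0
proof eventually_elim
  case (elim \<epsilon>)
  have "card (bd m (sites \<epsilon> \<Omega>)) \<le> card (near \<epsilon> (3 * of_int m) (frontier \<Omega>))"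
    by (intro card_mono bd_sites_subset finite_near bounded_frontier_if assms elim)
  then have "\<epsilon>^3 * real (card (bd m (sites \<epsilon> \<Omega>))) \<le> \<epsilon>^3 * real (card (near \<epsilon> (3 * of_int m) (frontier \<Omega>)))"
    using elim(2) by (intro mult_left_mono) auto
  then show ?case using elim(1) by linarith
qed

text \<open>The union of the cells differs from the domain only at points separated by the frontier
  from their nearest site. Such points lie in cells of sites near the frontier, and these have small
  total volume.\<close>

lemma card_sites:
  assumes b: "bounded \<Omega>" and n: "negligible (frontier \<Omega>)" and l: "\<Omega> \<in> lmeasurable" and e: "0 < e"
  shows "eventually (\<lambda>\<epsilon>. \<bar>\<epsilon>^3 * real (card (sites \<epsilon> \<Omega>)) - measure lebesgue \<Omega>\<bar> \<le> e) (at_right 0)"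
  using card_near_frontier[OF b n e, of 2] eventually_pos_at_right_0
proof eventually_elim
  case (elim \<epsilon>)
  let ?S = "sites \<epsilon> \<Omega>" and ?N = "near \<epsilon> 2 (frontier \<Omega>)"
  have fin: "finite ?S" "finite ?N"
    using finite_sites[OF elim(2) b] finite_near[OF elim(2) bounded_frontier_if[OF b]] by auto
  note mS = measure_cells[OF elim(2) fin(1)] and mN = measure_cells[OF elim(2) fin(2)]
  have cross: "nearest (x /\<^sub>R \<epsilon>) \<in> ?N" if "(x \<in> \<Omega>) \<noteq> (nearest (x /\<^sub>R \<epsilon>) \<in> ?S)" for x
  proof -
    let ?i = "nearest (x /\<^sub>R \<epsilon>)"
    have "\<exists>z\<in>frontier \<Omega>. norm (\<epsilon> *\<^sub>R emb ?i - z) \<le> norm (x - \<epsilon> *\<^sub>R emb ?i)"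
    proof (cases "x \<in> \<Omega>")
      case True
      then have "\<epsilon> *\<^sub>R emb ?i \<notin> \<Omega>" using that by (simp add: sites_def)
      from segment_meets_frontier[OF True this] show ?thesis by blast
    next
      case False
      then have "\<epsilon> *\<^sub>R emb ?i \<in> \<Omega>" using that by (simp add: sites_def)
      from segment_meets_frontier[OF this False] show ?thesis
        unfolding norm_minus_commute[of "\<epsilon> *\<^sub>R emb ?i" x] by blast
    qed
    then obtain z where "z \<in> frontier \<Omega>" "norm (\<epsilon> *\<^sub>R emb ?i - z) \<le> norm (x - \<epsilon> *\<^sub>R emb ?i)"
      by blast
    then show ?thesis
      using norm_nearest_scaled[OF elim(2) refl, of x] by (force simp: near_def)
  qed
  have sub: "\<Omega> \<subseteq> cells \<epsilon> ?S \<union> cells \<epsilon> ?N" "cells \<epsilon> ?S \<subseteq> \<Omega> \<union> cells \<epsilon> ?N"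
    using cross by (auto simp: cells_def)
  have "measure lebesgue \<Omega> \<le> measure lebesgue (cells \<epsilon> ?S \<union> cells \<epsilon> ?N)"
    "measure lebesgue (cells \<epsilon> ?S) \<le> measure lebesgue (\<Omega> \<union> cells \<epsilon> ?N)"
    using mS(1) mN(1) l by (auto intro!: measure_mono_fmeasurable[OF sub(1)] measure_mono_fmeasurable[OF sub(2)])
  moreover have "measure lebesgue (cells \<epsilon> ?S \<union> cells \<epsilon> ?N) \<le> measure lebesgue (cells \<epsilon> ?S) + measure lebesgue (cells \<epsilon> ?N)"
    "measure lebesgue (\<Omega> \<union> cells \<epsilon> ?N) \<le> measure lebesgue \<Omega> + measure lebesgue (cells \<epsilon> ?N)"
    using mS(1) mN(1) l by (auto intro!: measure_Un_le)
  ultimately show ?case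
    using elim(1) mS mN by (simp add: abs_le_iff)
qed

text \<open>Locally the frontier lies in a graph, which in the coordinates \<open>T\<close> is the
  image of a plane under a Lipschitz map; the inverse of \<open>T\<close> carries null sets back to
  null sets. Negligibility is a local property.\<close>

lemma negligible_frontier_if_lipschitz:
  assumes "lipschitz_boundary \<Omega>" shows "negligible (frontier \<Omega>)"
proof (rule locally_negligible_alt[THEN iffD2], intro ballI)
  fix x0 assume "x0 \<in> frontier \<Omega>"
  then obtain r T L \<gamma> where r: "r > 0" and T: "orthogonal_transformation (T :: real^3 \<Rightarrow> real^3)"
    and L: "L-lipschitz_on UNIV (\<gamma> :: real \<times> real \<Rightarrow> real)"
    and G: "\<And>y. y \<in> ball x0 r \<Longrightarrow> y \<in> \<Omega> \<longleftrightarrow> \<gamma> (T y $ 1, T y $ 2) < T y $ 3"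
    using assms unfolding lipschitz_boundary_def by meson
  have lT: "linear T" "inj T" "surj T"
    using T orthogonal_transformation_linear orthogonal_transformation_inj orthogonal_transformation_surj by blast+
  have cont: "continuous_on UNIV \<gamma>" using L by (rule lipschitz_on_continuous_on)
  have cT: "continuous_on UNIV T" using lT(1) by (simp add: linear_continuous_on linear_conv_bounded_linear)
  define P where "P = {z :: real^3. z $ 3 = 0}"
  define g where "g z = (\<chi> k. if k = 3 then \<gamma> (z $ 1, z $ 2) else z $ k)" for z :: "real^3"
  have "negligible P" unfolding P_def by (rule negligible_standard_hyperplane_cart)
  then have ng: "negligible (g ` P)"
  proof (rule negligible_locally_Lipschitz_image[rotated])
    fix x assume "x \<in> P"
    have "norm (g y - g x) \<le> (L + 3) * norm (y - x)" for y
    proof -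
      have L0: "0 \<le> L" using L by (rule lipschitz_on_nonneg)
      have "\<bar>\<gamma> (y $ 1, y $ 2) - \<gamma> (x $ 1, x $ 2)\<bar> \<le> L * norm ((y $ 1, y $ 2) - (x $ 1, x $ 2))"
        using lipschitz_onD[OF L, of "(y $ 1, y $ 2)" "(x $ 1, x $ 2)"] by (simp add: dist_norm)
      also have "norm ((y $ 1, y $ 2) - (x $ 1, x $ 2)) \<le> norm (y - x)"
        by (simp add: norm_Pair norm_vec_def L2_set_def sum_3)
      finally have "\<bar>\<gamma> (y $ 1, y $ 2) - \<gamma> (x $ 1, x $ 2)\<bar> \<le> L * norm (y - x)"
        using L0 by (simp add: mult_left_mono)
      moreover have "\<bar>y $ 1 - x $ 1\<bar> \<le> norm (y - x)" "\<bar>y $ 2 - x $ 2\<bar> \<le> norm (y - x)"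
        using component_le_norm_cart[of "y - x"] by (metis vector_minus_component)+
      moreover have "norm (g y - g x) \<le> \<bar>y $ 1 - x $ 1\<bar> + \<bar>y $ 2 - x $ 2\<bar> + \<bar>\<gamma> (y $ 1, y $ 2) - \<gamma> (x $ 1, x $ 2)\<bar>"
        using norm_vec3_le[of "g y - g x"] by (simp add: g_def)
      moreover have "(L + 3) * norm (y - x) = L * norm (y - x) + 3 * norm (y - x)" by (simp add: distrib_right)
      ultimately show ?thesis using norm_ge_zero[of "y - x"] by linarith
    qed
    then show "\<exists>U B. open U \<and> x \<in> U \<and> (\<forall>y\<in>P \<inter> U. norm (g y - g x) \<le> B * norm (y - x))"
      by (intro exI[of _ UNIV] exI[of _ "L + 3"]) auto
  qed simp
  define S where "S = {y. T y $ 3 = \<gamma> (T y $ 1, T y $ 2)}"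
  have "S \<subseteq> inv T ` (g ` P)"
  proof
    fix y assume y: "y \<in> S"
    define z where "z = (\<chi> k. if k = 3 then 0 else T y $ k)"
    have "z \<in> P" by (simp add: P_def z_def)
    moreover have "g z = T y" using y by (simp add: g_def z_def S_def vec_eq_iff forall_3)
    then have "y = inv T (g z)" using lT(2) by simp
    ultimately show "y \<in> inv T ` (g ` P)" by blast
  qed
  moreover have "negligible (inv T ` (g ` P))"
    using negligible_differentiable_image_negligible[OF _ ng linear_imp_differentiable_on[OF
          inj_linear_imp_inv_linear[OF lT(1,2)]]] by simp
  ultimately have nS: "negligible S" by (rule negligible_subset[rotated])
  \<comment> \<open>By continuity of \<open>d\<close>, a point with \<open>d y > 0\<close> is
    interior to the domain and one with \<open>d y < 0\<close> has a neighbourhood missing it, so on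
    the frontier \<open>d\<close> vanishes.\<close>
  have "frontier \<Omega> \<inter> ball x0 r \<subseteq> S"
  proof
    fix y assume y: "y \<in> frontier \<Omega> \<inter> ball x0 r"
    define d where "d y = T y $ 3 - \<gamma> (T y $ 1, T y $ 2)" for y
    have cd: "continuous_on UNIV d"
      unfolding d_def
      by (intro continuous_intros continuous_on_compose2[OF cont] cT) auto
    have "d y \<le> 0"
    proof (rule ccontr)
      assume "\<not> d y \<le> 0"
      then have "y \<in> {y. 0 < d y} \<inter> ball x0 r" using y by auto
      moreover have "open ({y. 0 < d y} \<inter> ball x0 r)"
        using cd by (intro open_Int open_ball open_Collect_less continuous_on_const) auto
      moreover have "{y. 0 < d y} \<inter> ball x0 r \<subseteq> \<Omega>" using G by (auto simp: d_def)
      ultimately have "y \<in> interior \<Omega>" by (meson interiorI)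
      then show False using y by (simp add: frontier_def)
    qed
    moreover have "\<not> d y < 0"
    proof
      assume "d y < 0"
      then have "y \<in> {y. d y < 0} \<inter> ball x0 r" using y by auto
      moreover have "open ({y. d y < 0} \<inter> ball x0 r)"
        using cd by (intro open_Int open_ball open_Collect_less continuous_on_const) auto
      moreover have "({y. d y < 0} \<inter> ball x0 r) \<inter> \<Omega> = {}" using G by (force simp: d_def)
      ultimately have "y \<notin> closure \<Omega>" by (metis disjoint_iff open_Int_closure_eq_empty)
      then show False using y by (simp add: frontier_def)
    qed
    ultimately show "y \<in> S" by (simp add: d_def S_def)
  qed
  then have "negligible (frontier \<Omega> \<inter> ball x0 r)" using nS negligible_subset by blast
  then show "\<exists>U. openin (top_of_set (frontier \<Omega>)) U \<and> x0 \<in> U \<and> negligible U"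
    using r \<open>x0 \<in> frontier \<Omega>\<close> by (intro exI[of _ "frontier \<Omega> \<inter> ball x0 r"]) auto
qed

section \<open>Weak* convergence\<close>

text \<open>The regularity of the boundary enters as a null frontier, which makes the sites near the
  boundary a vanishing fraction of all sites.\<close>

locale bounded_domain =
  fixes \<Omega> :: "(real^3) set"
  assumes open_domain: "open \<Omega>" and bounded_domain: "bounded \<Omega>" and negligible_frontier: "negligible (frontier \<Omega>)"
begin

abbreviation "\<mu> \<equiv> lebesgue_on \<Omega>"

lemma lmeasurable_domain: "\<Omega> \<in> lmeasurable"
  by (intro lmeasurable_open bounded_domain open_domain)

lemma sets_domain [measurable]: "\<Omega> \<in> sets lebesgue"
  using lmeasurable_domain by (rule fmeasurableD)

lemma finite_measure_mu: "finite_measure \<mu>"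
  using lmeasurable_domain by (rule finite_measure_lebesgue_on)

lemma sets_mu: "A \<in> sets \<mu> \<longleftrightarrow> A \<subseteq> \<Omega> \<and> A \<in> sets lebesgue"
  by (auto simp: sets_restrict_space_iff)

lemma measure_mu: "A \<subseteq> \<Omega> \<Longrightarrow> measure \<mu> A = measure lebesgue A"
  by (intro measure_restrict_space) auto

lemma compact_sets_mu: "compact C \<Longrightarrow> C \<subseteq> \<Omega> \<Longrightarrow> C \<in> sets \<mu>"
  by (auto simp: sets_mu intro: fmeasurableD lmeasurable_compact)

lemma integrable_bounded:
  fixes y :: "real^3 \<Rightarrow> 'b::{banach, second_countable_topology}"
  assumes "y \<in> borel_measurable \<mu>" "AE x in \<mu>. norm (y x) \<le> c"
  shows "integrable \<mu> y"
  using finite_measure.integrable_const_bound[OF finite_measure_mu assms(2,1)] .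

lemma set_integrable_bounded:
  fixes y :: "real^3 \<Rightarrow> 'b::{banach, second_countable_topology}"
  assumes "y \<in> borel_measurable \<mu>" "AE x in \<mu>. norm (y x) \<le> c" "A \<in> sets \<mu>"
  shows "set_integrable \<mu> A y"
  unfolding set_integrable_def
  by (intro integrable_mult_indicator assms(3) integrable_bounded[OF assms(1,2)])

lemma integrable_indicator_mu: "A \<in> sets \<mu> \<Longrightarrow> integrable \<mu> (indicat_real A)"
  by (intro integrable_bounded[where c=1]) (auto simp: indicator_def)

lemma norm_set_integral_le:
  fixes y :: "real^3 \<Rightarrow> 'b::{banach, second_countable_topology}"
  assumes "y \<in> borel_measurable \<mu>" "AE x in \<mu>. norm (y x) \<le> c" "A \<in> sets \<mu>" "0 \<le> c"
  shows "norm (LINT x:A|\<mu>. y x) \<le> c * measure \<mu> A"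
proof -
  interpret finite_measure \<mu> by (rule finite_measure_mu)
  have "norm (LINT x:A|\<mu>. y x) \<le> (LINT x|\<mu>. norm (indicator A x *\<^sub>R y x))"
    unfolding set_lebesgue_integral_def by (rule integral_norm_bound)
  also have "\<dots> \<le> (LINT x|\<mu>. c * indicator A x)"
  proof (rule integral_mono_AE)
    show "integrable \<mu> (\<lambda>x. norm (indicator A x *\<^sub>R y x))"
      using set_integrable_bounded[OF assms(1-3)] by (intro integrable_norm) (simp add: set_integrable_def)
    show "integrable \<mu> (\<lambda>x. c * indicator A x)"
      using integrable_indicator_mu[OF assms(3)] by simp
    show "AE x in \<mu>. norm (indicator A x *\<^sub>R y x) \<le> c * indicator A x"
      using assms(2) by eventually_elim (auto simp: indicator_def)
  qed
  also have "\<dots> = c * measure \<mu> A"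
    using assms(3) by (simp add: sets_mu Int_absorb2)
  finally show ?thesis .
qed

lemma inner_compact:
  assumes E: "E \<in> sets \<mu>" and d: "0 < d"
  shows "\<exists>C. compact C \<and> C \<subseteq> E \<and> measure \<mu> (E - C) < d"
proof -
  have E': "E \<subseteq> \<Omega>" "E \<in> sets lebesgue" using E by (auto simp: sets_mu)
  obtain C where C: "closed C" "C \<subseteq> E" "E - C \<in> lmeasurable" "emeasure lebesgue (E - C) < ennreal d"
    using sets_lebesgue_inner_closed[OF E'(2) d] by blast
  have "compact C"
    using C(1,2) E'(1) bounded_domain bounded_subset by (metis compact_eq_bounded_closed)
  moreover have "measure \<mu> (E - C) < d"
    using C E' d by (subst measure_mu) (auto simp: measure_def enn2real_less_iff fmeasurable_def)
  ultimately show ?thesis using C(2) by blast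
qed

text \<open>The integral of a cell-wise constant field over whole cells is a lattice sum.
  Restricting to the part \<open>C\<close>, where \<open>y\<close> agrees with such a field, costs
  the measure of the rest, since the values have norm at most 1.\<close>

lemma set_integral_cells:
  fixes t :: "site \<Rightarrow> 'b::euclidean_space"
  assumes e: "0 < \<epsilon>" and S: "finite S" "cells \<epsilon> S \<subseteq> \<Omega>" and C: "C \<in> sets \<mu>" "C \<subseteq> cells \<epsilon> S"
    and t: "\<And>i. norm (t i) \<le> 1" and y: "y \<in> borel_measurable \<mu>"
      "AE x in \<mu>. x \<in> C \<longrightarrow> y x = t (nearest (x /\<^sub>R \<epsilon>))"
  shows "norm ((LINT x:C|\<mu>. y x) - \<epsilon>^3 *\<^sub>R (\<Sum>i\<in>S. t i)) \<le> \<epsilon>^3 * real (card S) - measure \<mu> C"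
proof -
  interpret finite_measure \<mu> by (rule finite_measure_mu)
  define T where "T x = t (nearest (x /\<^sub>R \<epsilon>))" for x
  have "T \<in> borel_measurable borel"
    unfolding T_def by (rule measurable_compose[OF nearest_measurable]) simp
  then have Tm: "T \<in> borel_measurable \<mu>"
    by (intro measurable_restrict_space1 measurable_completion) simp
  have Tb: "AE x in \<mu>. norm (T x) \<le> 1" using t by (simp add: T_def)
  have cm: "cells \<epsilon> S' \<in> sets \<mu>" if "S' \<subseteq> S" for S'
  proof -
    have "cells \<epsilon> S' \<subseteq> \<Omega>" using S(2) that by (auto simp: cells_def)
    then show ?thesis using cells_borel[of \<epsilon> S'] by (auto simp: sets_mu)
  qed
  have 1: "(LINT x:C|\<mu>. y x) = (LINT x:C|\<mu>. T x)"
    unfolding set_lebesgue_integral_def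
  proof (rule integral_cong_AE)
    show "AE x in \<mu>. indicator C x *\<^sub>R y x = indicator C x *\<^sub>R T x"
      using y(2) by eventually_elim (auto simp: T_def indicator_def)
  qed (use y(1) C(1) Tm in auto)
  have "(LINT x:cells \<epsilon> S|\<mu>. T x) = (LINT x|\<mu>. (\<Sum>i\<in>S. indicator (cells \<epsilon> {i}) x *\<^sub>R t i))"
    unfolding set_lebesgue_integral_def
  proof (rule Bochner_Integration.integral_cong[OF refl])
    fix x
    have "(\<Sum>i\<in>S. indicator (cells \<epsilon> {i}) x *\<^sub>R t i) = (\<Sum>i\<in>S. if i = nearest (x /\<^sub>R \<epsilon>) then t i else 0)"
      by (intro sum.cong) (auto simp: cells_def indicator_def)
    then show "indicator (cells \<epsilon> S) x *\<^sub>R T x = (\<Sum>i\<in>S. indicator (cells \<epsilon> {i}) x *\<^sub>R t i)"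
      using S(1) by (simp add: T_def cells_def indicator_def)
  qed
  also have "\<dots> = (\<Sum>i\<in>S. (LINT x|\<mu>. indicator (cells \<epsilon> {i}) x *\<^sub>R t i))"
    using cm by (intro Bochner_Integration.integral_sum integrable_scaleR_left impI integrable_indicator_mu) auto
  also have "\<dots> = (\<Sum>i\<in>S. \<epsilon>^3 *\<^sub>R t i)"
  proof (rule sum.cong[OF refl])
    fix i assume i: "i \<in> S"
    have "cells \<epsilon> {i} \<subseteq> \<Omega>" using S(2) i by (auto simp: cells_def)
    then have "measure \<mu> (cells \<epsilon> {i}) = \<epsilon>^3" using measure_cell[OF e, of i] by (simp add: measure_mu)
    then show "(LINT x|\<mu>. indicator (cells \<epsilon> {i}) x *\<^sub>R t i) = \<epsilon>^3 *\<^sub>R t i"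
      using cm[of "{i}"] i \<open>cells \<epsilon> {i} \<subseteq> \<Omega>\<close>
      by (subst integral_scaleR_left) (auto simp: integrable_indicator_mu Int_absorb2)
  qed
  finally have 2: "(LINT x:cells \<epsilon> S|\<mu>. T x) = \<epsilon>^3 *\<^sub>R (\<Sum>i\<in>S. t i)"
    by (simp add: scaleR_sum_right)
  have D: "cells \<epsilon> S - C \<in> sets \<mu>" using cm[of S] C(1) by auto
  have "(LINT x:cells \<epsilon> S|\<mu>. T x) = (LINT x:C|\<mu>. T x) + (LINT x:cells \<epsilon> S - C|\<mu>. T x)"
    using set_integral_Un[of C "cells \<epsilon> S - C" \<mu> T] C set_integrable_bounded[OF Tm Tb C(1)] set_integrable_bounded[OF Tm Tb D]
    by (simp add: Un_absorb1)
  then have "norm ((LINT x:C|\<mu>. y x) - \<epsilon>^3 *\<^sub>R (\<Sum>i\<in>S. t i)) = norm (LINT x:cells \<epsilon> S - C|\<mu>. T x)"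
    by (simp add: 1 2[symmetric])
  also have "\<dots> \<le> 1 * measure \<mu> (cells \<epsilon> S - C)"
    by (rule norm_set_integral_le[OF Tm Tb D]) simp
  also have "\<dots> = measure \<mu> (cells \<epsilon> S) - measure \<mu> C"
    using cm[of S] C by (simp add: finite_measure_Diff)
  also have "measure \<mu> (cells \<epsilon> S) = \<epsilon>^3 * real (card S)"
    using measure_cells[OF e S(1)] S(2) by (simp add: measure_mu)
  finally show ?thesis .
qed

lemma LinfD:
  assumes "Q \<in> Linf \<Omega>"
  shows "Q \<in> borel_measurable \<mu>" "\<exists>c\<ge>0. AE x in \<mu>. norm (Q x) \<le> c"
proof -
  show "Q \<in> borel_measurable \<mu>" using assms by (simp add: Linf_def)
  obtain C where "AE x in \<mu>. norm (Q x) \<le> C" using assms by (auto simp: Linf_def)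
  then have "AE x in \<mu>. norm (Q x) \<le> max C 0" by eventually_elim auto
  then show "\<exists>c\<ge>0. AE x in \<mu>. norm (Q x) \<le> c" by (intro exI[of _ "max C 0"]) auto
qed

lemma integrable_inner_bounded:
  fixes y \<Phi> :: "real^3 \<Rightarrow> 'b::euclidean_space"
  assumes y: "y \<in> borel_measurable \<mu>" "AE x in \<mu>. norm (y x) \<le> c" and \<Phi>: "integrable \<mu> \<Phi>"
  shows "integrable \<mu> (\<lambda>x. y x \<bullet> \<Phi> x)"
proof (rule Bochner_Integration.integrable_bound[of _ "\<lambda>x. c * norm (\<Phi> x)"])
  show "integrable \<mu> (\<lambda>x. c * norm (\<Phi> x))" using \<Phi> by simp
  have "\<Phi> \<in> borel_measurable \<mu>" using \<Phi> by simp
  then show "(\<lambda>x. y x \<bullet> \<Phi> x) \<in> borel_measurable \<mu>" using y(1) by simp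
  show "AE x in \<mu>. norm (y x \<bullet> \<Phi> x) \<le> norm (c * norm (\<Phi> x))"
    using y(2)
  proof eventually_elim
    case (elim x)
    have "norm (y x \<bullet> \<Phi> x) \<le> norm (y x) * norm (\<Phi> x)" by (simp add: Cauchy_Schwarz_ineq2)
    also have "\<dots> \<le> c * norm (\<Phi> x)" using elim by (intro mult_right_mono) auto
    finally show ?case using abs_ge_self[of "c * norm (\<Phi> x)"] unfolding real_norm_def by linarith
  qed
qed

lemma abs_integral_inner_le:
  fixes y \<Phi> :: "real^3 \<Rightarrow> 'b::euclidean_space"
  assumes y: "y \<in> borel_measurable \<mu>" "AE x in \<mu>. norm (y x) \<le> c" and \<Phi>: "integrable \<mu> \<Phi>"
  shows "\<bar>LINT x|\<mu>. y x \<bullet> \<Phi> x\<bar> \<le> c * (LINT x|\<mu>. norm (\<Phi> x))"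
proof -
  have "\<bar>LINT x|\<mu>. y x \<bullet> \<Phi> x\<bar> \<le> (LINT x|\<mu>. norm (y x \<bullet> \<Phi> x))"
    using integral_norm_bound[of \<mu> "\<lambda>x. y x \<bullet> \<Phi> x"] by simp
  also have "\<dots> \<le> (LINT x|\<mu>. c * norm (\<Phi> x))"
  proof (rule integral_mono_AE)
    show "integrable \<mu> (\<lambda>x. norm (y x \<bullet> \<Phi> x))"
      by (intro integrable_norm integrable_inner_bounded[OF y \<Phi>])
    show "integrable \<mu> (\<lambda>x. c * norm (\<Phi> x))" using \<Phi> by simp
    show "AE x in \<mu>. norm (y x \<bullet> \<Phi> x) \<le> c * norm (\<Phi> x)"
      using y(2)
    proof eventually_elim
      case (elim x)
      have "norm (y x \<bullet> \<Phi> x) \<le> norm (y x) * norm (\<Phi> x)" by (simp add: Cauchy_Schwarz_ineq2)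
      also have "\<dots> \<le> c * norm (\<Phi> x)" using elim by (intro mult_right_mono) auto
      finally show ?case .
    qed
  qed
  finally show ?thesis by simp
qed

text \<open>Convergence of the integrals over measurable sets handles indicators, hence sums; the
  uniform bound then permits limits in \<open>L1\<close>. The filter is arbitrary because the result
  serves both for \<epsilon> tending to 0 and for a sequence of approximating fields.\<close>

lemma tendsto_integral_inner:
  fixes y :: "'i \<Rightarrow> real^3 \<Rightarrow> real^3^3"
  assumes y: "\<And>i. y i \<in> borel_measurable \<mu>" "\<And>i. AE x in \<mu>. norm (y i x) \<le> c"
    and Q: "Q \<in> borel_measurable \<mu>" "AE x in \<mu>. norm (Q x) \<le> c" and c: "0 \<le> c"
    and conv: "\<And>E. E \<in> sets \<mu> \<Longrightarrow> ((\<lambda>i. LINT x:E|\<mu>. y i x) \<longlongrightarrow> (LINT x:E|\<mu>. Q x)) F"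
    and \<Phi>: "integrable \<mu> \<Phi>"
  shows "((\<lambda>i. LINT x|\<mu>. y i x \<bullet> \<Phi> x) \<longlongrightarrow> (LINT x|\<mu>. Q x \<bullet> \<Phi> x)) F"
  using \<Phi>
proof (induction rule: integrable_induct)
  case (base A a)
  have eq: "(LINT x|\<mu>. z x \<bullet> (indicator A x *\<^sub>R a)) = (LINT x:A|\<mu>. z x) \<bullet> a"
    if "z \<in> borel_measurable \<mu>" "AE x in \<mu>. norm (z x) \<le> c" for z
  proof -
    have "(LINT x|\<mu>. (indicator A x *\<^sub>R z x) \<bullet> a) = (LINT x:A|\<mu>. z x) \<bullet> a"
      unfolding set_lebesgue_integral_def
      by (rule integral_inner_left)
         (use set_integrable_bounded[OF that base(1)] in \<open>simp add: set_integrable_def\<close>)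
    then show ?thesis by (simp only: inner_scaleR_left inner_scaleR_right)
  qed
  show ?case
    unfolding eq[OF y] eq[OF Q] by (intro tendsto_intros conv base)
next
  case (add g h)
  have eq: "(LINT x|\<mu>. z x \<bullet> (g x + h x)) = (LINT x|\<mu>. z x \<bullet> g x) + (LINT x|\<mu>. z x \<bullet> h x)"
    if "z \<in> borel_measurable \<mu>" "AE x in \<mu>. norm (z x) \<le> c" for z
    using integrable_inner_bounded[OF that add(1)] integrable_inner_bounded[OF that add(2)]
    by (simp add: inner_add_right)
  show ?case
    unfolding eq[OF y] eq[OF Q] by (intro tendsto_intros add)
next
  case (lim g s)
  have int: "integrable \<mu> (\<lambda>x. g x - s n x)" for n using lim by simp
  have eq: "(LINT x|\<mu>. z x \<bullet> g x) - (LINT x|\<mu>. z x \<bullet> s n x) = (LINT x|\<mu>. z x \<bullet> (g x - s n x))"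
    if "z \<in> borel_measurable \<mu>" "AE x in \<mu>. norm (z x) \<le> c" for z n
    using integrable_inner_bounded[OF that lim(4)] integrable_inner_bounded[OF that lim(1)]
    by (simp add: inner_diff_right)
  have "(\<lambda>n. LINT x|\<mu>. norm (g x - s n x)) \<longlonglongrightarrow> (LINT x|\<mu>. 0 :: real)"
  proof (rule integral_dominated_convergence)
    show "integrable \<mu> (\<lambda>x. 3 * norm (g x))" using lim(4) by simp
    show "AE x in \<mu>. (\<lambda>n. norm (g x - s n x)) \<longlonglongrightarrow> 0"
    proof (rule AE_I2)
      fix x assume "x \<in> space \<mu>"
      then have "(\<lambda>n. s n x) \<longlonglongrightarrow> g x" using lim by blast
      then have "(\<lambda>n. norm (g x - s n x)) \<longlonglongrightarrow> norm (g x - g x)" by (intro tendsto_intros)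
      then show "(\<lambda>n. norm (g x - s n x)) \<longlonglongrightarrow> 0" by simp
    qed
    show "AE x in \<mu>. norm (norm (g x - s n x)) \<le> 3 * norm (g x)" for n
    proof (rule AE_I2)
      fix x assume "x \<in> space \<mu>"
      then have "norm (s n x) \<le> 2 * norm (g x)" using lim by blast
      then show "norm (norm (g x - s n x)) \<le> 3 * norm (g x)"
        using norm_triangle_ineq4[of "g x" "s n x"] by simp
    qed
  qed (use int lim in auto)
  then have small: "(\<lambda>n. LINT x|\<mu>. norm (g x - s n x)) \<longlonglongrightarrow> 0" by simp
  show ?case
  proof (rule tendstoI)
    fix e :: real assume e: "0 < e"
    have "eventually (\<lambda>n. (LINT x|\<mu>. norm (g x - s n x)) < e / (3 * (c + 1))) sequentially"
      using small e c by (intro order_tendstoD) auto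
    then obtain n where n: "(LINT x|\<mu>. norm (g x - s n x)) < e / (3 * (c + 1))"
      by (auto simp: eventually_sequentially)
    have "c * (LINT x|\<mu>. norm (g x - s n x)) \<le> c * (e / (3 * (c + 1)))"
      using n c by (intro mult_left_mono) auto
    also have "\<dots> < e / 3" using c e by (simp add: divide_simps mult_less_cancel_left)
    finally have b: "c * (LINT x|\<mu>. norm (g x - s n x)) < e / 3" .
    have "eventually (\<lambda>i. dist (LINT x|\<mu>. y i x \<bullet> s n x) (LINT x|\<mu>. Q x \<bullet> s n x) < e / 3) F"
      using lim(5) e by (intro tendstoD) auto
    then show "eventually (\<lambda>i. dist (LINT x|\<mu>. y i x \<bullet> g x) (LINT x|\<mu>. Q x \<bullet> g x) < e) F"
    proof eventually_elim
      case (elim i)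
      have "\<bar>(LINT x|\<mu>. y i x \<bullet> g x) - (LINT x|\<mu>. y i x \<bullet> s n x)\<bar> < e / 3"
        "\<bar>(LINT x|\<mu>. Q x \<bullet> g x) - (LINT x|\<mu>. Q x \<bullet> s n x)\<bar> < e / 3"
        unfolding eq[OF y] eq[OF Q]
        using abs_integral_inner_le[OF y int, of i n] abs_integral_inner_le[OF Q int, of n] b by linarith+
      then show ?case using elim unfolding dist_real_def by linarith
    qed
  qed
qed

text \<open>The zero test function with \<open>U = UNIV\<close> makes all of
  \<open>Linf \<Omega>\<close> a subbasic set.\<close>

lemma topspace_weak_star: "topspace (weak_star \<Omega>) = Linf \<Omega>"
proof -
  have "(0 :: real^3^3) \<in> Msym" by (simp add: Msym_def transpose_def vec_eq_iff)
  then have "(\<lambda>_. 0) \<in> L1 \<Omega>" by (simp add: L1_def)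
  then have "Linf \<Omega> \<in> {{Q \<in> Linf \<Omega>. (LINT x|\<mu>. Q x \<bullet> \<Phi> x) \<in> U} | \<Phi> U. \<Phi> \<in> L1 \<Omega> \<and> open U}"
    by (intro CollectI exI[of _ "\<lambda>_. 0"] exI[of _ UNIV]) auto
  then show ?thesis unfolding weak_star_def by auto
qed

lemma openin_weak_star:
  "\<Phi> \<in> L1 \<Omega> \<Longrightarrow> open U \<Longrightarrow> openin (weak_star \<Omega>) {Q \<in> Linf \<Omega>. (LINT x|\<mu>. Q x \<bullet> \<Phi> x) \<in> U}"
  unfolding weak_star_def by (rule topology_generated_by_Basis) blast

text \<open>The topology is given by a subbasis, so the claim follows by induction over the
  generation of its open sets.\<close>

lemma eventually_in_weak_star_open:
  assumes U: "openin (weak_star \<Omega>) U" and y: "\<And>i. y i \<in> Linf \<Omega>" and Q: "Q \<in> U"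
    and conv: "\<And>\<Phi>. \<Phi> \<in> L1 \<Omega> \<Longrightarrow> ((\<lambda>i. LINT x|\<mu>. y i x \<bullet> \<Phi> x) \<longlongrightarrow> (LINT x|\<mu>. Q x \<bullet> \<Phi> x)) F"
  shows "eventually (\<lambda>i. y i \<in> U) F"
proof -
  have "generate_topology_on {{Q \<in> Linf \<Omega>. (LINT x|\<mu>. Q x \<bullet> \<Phi> x) \<in> U} | \<Phi> U. \<Phi> \<in> L1 \<Omega> \<and> open U} U"
    using U unfolding weak_star_def by (rule openin_topology_generated_by)
  then have "Q \<in> U \<longrightarrow> eventually (\<lambda>i. y i \<in> U) F"
  proof induction
    case Empty
    show ?case by simp
  next
    case (Int a b)
    then show ?case by (auto intro: eventually_conj)
  next
    case (UN K)
    show ?case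
    proof
      assume "Q \<in> \<Union>K"
      then obtain k where k: "k \<in> K" "Q \<in> k" by blast
      with UN have "eventually (\<lambda>i. y i \<in> k) F" by blast
      then show "eventually (\<lambda>i. y i \<in> \<Union>K) F" using k(1) by (auto elim: eventually_mono)
    qed
  next
    case (Basis s)
    then obtain \<Phi> V where s: "s = {Q \<in> Linf \<Omega>. (LINT x|\<mu>. Q x \<bullet> \<Phi> x) \<in> V}" "\<Phi> \<in> L1 \<Omega>" "open V"
      by blast
    show ?case
    proof
      assume "Q \<in> s"
      then have "(LINT x|\<mu>. Q x \<bullet> \<Phi> x) \<in> V" by (simp add: s)
      then have "eventually (\<lambda>i. (LINT x|\<mu>. y i x \<bullet> \<Phi> x) \<in> V) F"
        using conv[OF s(2)] s(3) by (rule topological_tendstoD[rotated -1])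
      then show "eventually (\<lambda>i. y i \<in> s) F" using y by (auto simp: s elim: eventually_mono)
    qed
  qed
  then show ?thesis using Q by blast
qed

end

section \<open>Criteria for \<Gamma>-limits in terms of neighbourhoods\<close>

lemma Gamma_liminf_ge:
  assumes "\<And>s. ereal s < L \<Longrightarrow> \<exists>U. openin X U \<and> x \<in> U \<and> eventually (\<lambda>\<epsilon>. \<forall>y\<in>U. ereal s \<le> \<F> \<epsilon> y) G"
  shows "L \<le> Gamma_liminf X G \<F> x"
proof (rule dense_le)
  fix r assume "r < L"
  from ereal_dense2[OF this] obtain s where s: "r < ereal s" "ereal s < L" by blast
  obtain U where U: "openin X U" "x \<in> U" "eventually (\<lambda>\<epsilon>. \<forall>y\<in>U. ereal s \<le> \<F> \<epsilon> y) G"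
    using assms[OF s(2)] by blast
  have "ereal s \<le> Liminf G (\<lambda>\<epsilon>. INF y\<in>U. \<F> \<epsilon> y)"
    using U(3) by (intro Liminf_bounded) (auto elim!: eventually_mono intro!: INF_greatest)
  also have "\<dots> \<le> Gamma_liminf X G \<F> x"
    unfolding Gamma_liminf_def using U by (intro SUP_upper) auto
  finally show "r \<le> Gamma_liminf X G \<F> x" using s(1) by (metis less_imp_le order_trans)
qed

lemma Gamma_limsup_le:
  assumes "\<And>U s. openin X U \<Longrightarrow> x \<in> U \<Longrightarrow> L < ereal s \<Longrightarrow> eventually (\<lambda>\<epsilon>. \<exists>y\<in>U. \<F> \<epsilon> y \<le> ereal s) G"
  shows "Gamma_limsup X G \<F> x \<le> L"
  unfolding Gamma_limsup_def
proof (rule SUP_least, rule dense_ge)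
  fix U r assume U: "U \<in> {U. openin X U \<and> x \<in> U}" and "L < r"
  from ereal_dense2[OF this(2)] obtain s where s: "L < ereal s" "ereal s < r" by blast
  have "Limsup G (\<lambda>\<epsilon>. INF y\<in>U. \<F> \<epsilon> y) \<le> ereal s"
    using assms[of U s] U s(1) by (intro Limsup_bounded) (auto elim!: eventually_mono intro: INF_lower2)
  then show "Limsup G (\<lambda>\<epsilon>. INF y\<in>U. \<F> \<epsilon> y) \<le> r" using s(2) by (metis less_imp_le order_trans)
qed

lemma Gamma_liminf_le_limsup: "G \<noteq> bot \<Longrightarrow> Gamma_liminf X G \<F> x \<le> Gamma_limsup X G \<F> x"
  unfolding Gamma_liminf_def Gamma_limsup_def by (intro SUP_mono') (rule Liminf_le_Limsup)

section \<open>The lower bound\<close>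

text \<open>Disjoint compact sets have a distance \<open>d > 0\<close>, and all sites involved are
  within a multiple of \<epsilon> of them. The collar is included because disjoint pieces of the
  lattice could still interact when adjacent.\<close>

lemma eventually_near_disjoint:
  assumes "compact C" "compact D" "C \<inter> D = {}"
  shows "eventually (\<lambda>\<epsilon>. nb m (near \<epsilon> r C) \<inter> near \<epsilon> r D = {}) (at_right 0)"
proof -
  obtain d where d: "0 < d" "\<And>x y. x \<in> C \<Longrightarrow> y \<in> D \<Longrightarrow> d \<le> dist x y"
    using separate_compact_closed[OF assms(1) compact_imp_closed[OF assms(2)] assms(3)] by blast
  define B where "B = 2 * \<bar>r\<bar> + 3 * \<bar>of_int m\<bar> + 1"
  have B: "0 < B" by (simp add: B_def)
  show ?thesis
  proof (rule eventually_at_right_0I)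
    show "0 < d / B" using d(1) B by simp
    fix \<epsilon> :: real assume e: "0 < \<epsilon>" "\<epsilon> < d / B"
    show "nb m (near \<epsilon> r C) \<inter> near \<epsilon> r D = {}"
    proof (rule ccontr)
      assume "nb m (near \<epsilon> r C) \<inter> near \<epsilon> r D \<noteq> {}"
      then obtain j where "j \<in> near \<epsilon> (r + 3 * of_int m) C" "j \<in> near \<epsilon> r D"
        using nb_near[OF e(1), of m r C] by blast
      then obtain x y where xy: "x \<in> C" "norm (\<epsilon> *\<^sub>R emb j - x) \<le> (r + 3 * of_int m) * \<epsilon>"
        "y \<in> D" "norm (\<epsilon> *\<^sub>R emb j - y) \<le> r * \<epsilon>"
        by (auto simp: near_def)
      have "d \<le> dist x y" using d(2) xy by blast
      also have "\<dots> \<le> norm (\<epsilon> *\<^sub>R emb j - x) + norm (\<epsilon> *\<^sub>R emb j - y)"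
        using dist_triangle3[of x y "\<epsilon> *\<^sub>R emb j"] by (simp add: dist_norm)
      also have "\<dots> \<le> (r + 3 * of_int m) * \<epsilon> + r * \<epsilon>" using xy by linarith
      also have "\<dots> = (2 * r + 3 * of_int m) * \<epsilon>" by (simp add: algebra_simps)
      also have "\<dots> \<le> B * \<epsilon>" using e(1) by (intro mult_right_mono) (auto simp: B_def)
      also have "\<dots> < d" using e(2) B by (simp add: field_simps)
      finally show False by simp
    qed
  qed
qed

lemma eventually_pieces_separated:
  assumes I: "finite I" and C: "\<And>k. k \<in> I \<Longrightarrow> compact (C k)"
    and dis: "\<And>k l. k \<in> I \<Longrightarrow> l \<in> I \<Longrightarrow> k \<noteq> l \<Longrightarrow> C k \<inter> C l = {}"
  shows "eventually (\<lambda>\<epsilon>. \<forall>k\<in>I. \<forall>l\<in>I. k \<noteq> l \<longrightarrow> nb m (near \<epsilon> r (C k)) \<inter> near \<epsilon> r (C l) = {}) (at_right 0)"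
proof (intro eventually_ball_finite I ballI)
  fix k l assume kl: "k \<in> I" "l \<in> I"
  show "eventually (\<lambda>\<epsilon>. k \<noteq> l \<longrightarrow> nb m (near \<epsilon> r (C k)) \<inter> near \<epsilon> r (C l) = {}) (at_right 0)"
  proof (cases "k = l")
    case False
    from eventually_near_disjoint[OF C(1)[OF kl(1)] C(1)[OF kl(2)] dis[OF kl False], of m r]
    show ?thesis by eventually_elim simp
  qed simp
qed

lemma near_subset_sites:
  assumes "compact C" "open \<Omega>" "C \<subseteq> \<Omega>"
  shows "eventually (\<lambda>\<epsilon>. near \<epsilon> r C \<subseteq> sites \<epsilon> \<Omega>) (at_right 0)"
  using eventually_cells_near_subset[OF assms, of r] eventually_pos_at_right_0
proof eventually_elim
  case (elim \<epsilon>)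
  show ?case
  proof
    fix i assume "i \<in> near \<epsilon> r C"
    have "nearest (emb i) = i" by (simp add: nearest_eq_iff)
    then have "\<epsilon> *\<^sub>R emb i \<in> cells \<epsilon> (near \<epsilon> r C)"
      using elim(2) \<open>i \<in> _\<close> by (simp add: cells_def)
    then show "i \<in> sites \<epsilon> \<Omega>" using elim(1) by (auto simp: sites_def)
  qed
qed

text \<open>An interacting pair with its ends in two pieces would put a site of one piece into the
  collar of the other, so the pair sums split.\<close>

lemma energy_separated:
  assumes I: "finite I" and S: "\<And>k. k \<in> I \<Longrightarrow> finite (S k)"
    and sep: "\<And>k l. k \<in> I \<Longrightarrow> l \<in> I \<Longrightarrow> k \<noteq> l \<Longrightarrow> nb 1 (S k) \<inter> S l = {}"
  shows "energy f (\<Union>k\<in>I. S k) u = (\<Sum>k\<in>I. energy f (S k) u)"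
proof -
  have "pairs_sum f (\<Union>k\<in>I. S k) u \<xi> = (\<Sum>k\<in>I. pairs_sum f (S k) u \<xi>)" if \<xi>: "\<xi> \<in> site_box 1" for \<xi>
  proof -
    have "{i \<in> \<Union>k\<in>I. S k. i + \<xi> \<in> (\<Union>k\<in>I. S k)} = (\<Union>k\<in>I. {i \<in> S k. i + \<xi> \<in> S k})"
    proof (intro equalityI subsetI)
      fix i assume "i \<in> {i \<in> \<Union>k\<in>I. S k. i + \<xi> \<in> (\<Union>k\<in>I. S k)}"
      then obtain k l where kl: "k \<in> I" "l \<in> I" "i \<in> S k" "i + \<xi> \<in> S l" by blast
      then have "k = l" using sep[of k l] add_mem_nb[OF kl(3) \<xi>] by blast
      then show "i \<in> (\<Union>k\<in>I. {i \<in> S k. i + \<xi> \<in> S k})" using kl by blast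
    qed blast
    moreover have "S k \<inter> S l = {}" if "k \<in> I" "l \<in> I" "k \<noteq> l" for k l
      using sep[OF that] subset_nb[of 1 "S k"] by auto
    ultimately show ?thesis
      unfolding pairs_sum_def using I S by (simp only:) (intro sum.UNION_disjoint, auto)
  qed
  then have "energy f (\<Union>k\<in>I. S k) u = (\<Sum>\<xi>\<in>site_box 1. \<Sum>k\<in>I. wt \<xi> * pairs_sum f (S k) u \<xi>)"
    by (simp add: energy_def sum_distrib_left)
  also have "\<dots> = (\<Sum>k\<in>I. energy f (S k) u)"
    unfolding energy_def by (rule sum.swap)
  finally show ?thesis .
qed

lemma energy_cong:
  assumes "\<And>i. i \<in> S \<Longrightarrow> u i = v i" shows "energy f S u = energy f S v"
  unfolding energy_def pairs_sum_def
  by (intro sum.cong refl arg_cong2[where f="(*)"]) (use assms in auto)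

section \<open>From sums over lattice vectors to sums over integer sites\<close>

lemma Z_eps_eq: "Z_eps \<Omega> \<epsilon> = emb ` sites \<epsilon> \<Omega>"
proof -
  have "Z_eps \<Omega> \<epsilon> = {i \<in> range emb. \<epsilon> *\<^sub>R i \<in> \<Omega>}"
    by (simp add: Z_eps_def range_emb)
  then show ?thesis by (auto simp: sites_def)
qed

text \<open>Ordered pairs are parametrized by their difference and first site. As \<open>c\<close>
  is less than 2, every coordinate of the difference is -1, 0 or 1.\<close>

lemma sum_pairs_eq:
  fixes g :: "real^3 \<Rightarrow> real^3 \<Rightarrow> real"
  assumes "finite S" "0 < c" "c \<le> sqrt 2"
  shows "(\<Sum>(i,j)\<in>{(i,j). i \<in> emb ` S \<and> j \<in> emb ` S \<and> norm (i - j) = c}. g i j)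
    = (\<Sum>\<xi>\<in>site_box 1. if norm (emb \<xi>) = c then \<Sum>i\<in>{i\<in>S. i + \<xi> \<in> S}. g (emb i) (emb (i + \<xi>)) else 0)"
proof -
  let ?D = "{\<xi>\<in>site_box 1. norm (emb \<xi>) = c}"
  let ?X = "SIGMA \<xi>:?D. {i\<in>S. i + \<xi> \<in> S}"
  define h where "h = (\<lambda>(\<xi>,i). (emb i, emb (i + \<xi>)))"
  have small: "\<xi> \<in> site_box 1" if "norm (emb \<xi>) = c" for \<xi>
  proof -
    obtain a b d where \<xi>: "\<xi> = (a,b,d)" by (cases \<xi>)
    have "\<bar>emb \<xi> $ k\<bar> < 2" for k
    proof -
      have "\<bar>emb \<xi> $ k\<bar> \<le> norm (emb \<xi>)" by (rule component_le_norm_cart)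
      also have "\<dots> \<le> sqrt 2" using that assms by simp
      also have "\<dots> < 2" using real_sqrt_less_mono[of 2 4] by simp
      finally show ?thesis .
    qed
    from this[of 1] this[of 2] this[of 3] show ?thesis
      by (auto simp: emb_nth \<xi> site_box_def)
  qed
  have "bij_betw h ?X {(i,j). i \<in> emb ` S \<and> j \<in> emb ` S \<and> norm (i - j) = c}"
  proof (rule bij_betwI')
    fix p q assume "p \<in> ?X" "q \<in> ?X"
    show "h p = h q \<longleftrightarrow> p = q"
      using inj_emb by (cases p; cases q) (auto simp: h_def inj_eq)
  next
    fix p assume p: "p \<in> ?X"
    have "norm (emb i - emb (i + \<xi>)) = norm (emb \<xi>)" for i \<xi> by (simp add: emb_add)
    then show "h p \<in> {(i,j). i \<in> emb ` S \<and> j \<in> emb ` S \<and> norm (i - j) = c}"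
      using p by (auto simp: h_def simp del: add_Pair)
  next
    fix q assume "q \<in> {(i,j). i \<in> emb ` S \<and> j \<in> emb ` S \<and> norm (i - j) = c}"
    then obtain i j where q: "q = (emb i, emb j)" "i \<in> S" "j \<in> S" "norm (emb (j - i)) = c"
      by (auto simp: emb_diff norm_minus_commute)
    then have "(j - i, i) \<in> ?X" "q = h (j - i, i)"
      using small by (auto simp: h_def)
    then show "\<exists>p\<in>?X. q = h p" by blast
  qed
  from sum.reindex_bij_betw[OF this, of "\<lambda>(i,j). g i j"]
  have "(\<Sum>(i,j)\<in>{(i,j). i \<in> emb ` S \<and> j \<in> emb ` S \<and> norm (i - j) = c}. g i j)
      = (\<Sum>(\<xi>,i)\<in>?X. g (emb i) (emb (i + \<xi>)))"
    by (simp add: h_def case_prod_beta)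
  also have "\<dots> = (\<Sum>\<xi>\<in>?D. \<Sum>i\<in>{i\<in>S. i + \<xi> \<in> S}. g (emb i) (emb (i + \<xi>)))"
    using assms(1) by (intro sum.Sigma[symmetric]) auto
  also have "\<dots> = (\<Sum>\<xi>\<in>site_box 1. if norm (emb \<xi>) = c then \<Sum>i\<in>{i\<in>S. i + \<xi> \<in> S}. g (emb i) (emb (i + \<xi>)) else 0)"
    by (rule sum.inter_filter) simp
  finally show ?thesis .
qed

lemma lattice_energy_eq:
  assumes "finite (sites \<epsilon> \<Omega>)"
  shows "lattice_energy f \<Omega> \<epsilon> u = \<epsilon>^3 * energy f (sites \<epsilon> \<Omega>) (\<lambda>i. u (emb i))"
proof -
  let ?S = "sites \<epsilon> \<Omega>"
  let ?p = "pairs_sum f ?S (\<lambda>i. u (emb i))"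
  have p: "(\<Sum>i\<in>{i\<in>?S. i + \<xi> \<in> ?S}. \<epsilon>^3 * f (u (emb i)) (u (emb (i + \<xi>)))) = \<epsilon>^3 * ?p \<xi>" for \<xi>
    by (simp add: pairs_sum_def sum_distrib_left)
  have wt: "wt \<xi> = (if norm (emb \<xi>) = 1 then 1 else 0) + (if norm (emb \<xi>) = sqrt 2 then 1/4 else 0)" for \<xi>
    using c_weight_emb[of \<xi>] by (auto simp: c_weight_def)
  have "lattice_energy f \<Omega> \<epsilon> u = (\<Sum>\<xi>\<in>site_box 1. if norm (emb \<xi>) = 1 then \<epsilon>^3 * ?p \<xi> else 0)
      + 1/4 * (\<Sum>\<xi>\<in>site_box 1. if norm (emb \<xi>) = sqrt 2 then \<epsilon>^3 * ?p \<xi> else 0)"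
    unfolding lattice_energy_def Z_eps_eq
    using sum_pairs_eq[OF assms, of 1 "\<lambda>i j. \<epsilon>^3 * f (u i) (u j)"]
      sum_pairs_eq[OF assms, of "sqrt 2" "\<lambda>i j. \<epsilon>^3 * f (u i) (u j)"]
    by (simp only: p) simp
  also have "\<dots> = \<epsilon>^3 * energy f ?S (\<lambda>i. u (emb i))"
    unfolding energy_def sum_distrib_left sum.distrib[symmetric]
    by (intro sum.cong refl) (simp add: wt)
  finally show ?thesis .
qed

context spin
begin

text \<open>Two-sided, so that it serves both bounds: the sites outside the pieces are removed at a
  cost of \<open>18 * M\<close> each.\<close>

lemma energy_separated_ge:
  assumes Z: "finite Z" and I: "finite I" and S: "\<And>k. k \<in> I \<Longrightarrow> S k \<subseteq> Z"
    and sep: "\<And>k l. k \<in> I \<Longrightarrow> l \<in> I \<Longrightarrow> k \<noteq> l \<Longrightarrow> nb 1 (S k) \<inter> S l = {}"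
    and u: "\<And>i. u i \<in> S2"
  shows "\<bar>energy f Z u - (\<Sum>k\<in>I. energy f (S k) u)\<bar> \<le> 18 * M * (real (card Z) - (\<Sum>k\<in>I. real (card (S k))))"
proof -
  let ?U = "\<Union>k\<in>I. S k"
  have fS: "finite (S k)" if "k \<in> I" for k using S[OF that] Z finite_subset by blast
  have "S k \<inter> S l = {}" if "k \<in> I" "l \<in> I" "k \<noteq> l" for k l
    using sep[OF that] subset_nb[of 1 "S k"] by auto
  then have "card ?U = (\<Sum>k\<in>I. card (S k))"
    using I fS by (intro card_UN_disjoint) blast+
  moreover have "real (card (Z - ?U)) = real (card Z) - real (card ?U)"
    using Z S by (metis UN_least card_Diff_subset card_mono finite_subset of_nat_diff)
  ultimately have "real (card (Z - ?U)) = real (card Z) - (\<Sum>k\<in>I. real (card (S k)))"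
    by simp
  moreover have "energy f ?U u = (\<Sum>k\<in>I. energy f (S k) u)"
    by (intro energy_separated I fS sep) auto
  moreover have "\<bar>energy f Z u - energy f ?U u\<bar> \<le> 18 * M * real (card (Z - ?U))"
    using S by (intro abs_energy_diff Z u) auto
  ultimately show ?thesis by simp
qed

end

locale domain_spin = bounded_domain \<Omega> + spin f M for \<Omega> f M
begin

text \<open>Each compact piece has its own minorant, and the sites outside the pieces are estimated
  by boundedness of \<open>f\<close>. The outcome depends on \<open>Q\<close> only through its
  integrals over the pieces, and \<epsilon> is chosen before \<open>Q\<close>: this uniformity is
  what a weak* neighbourhood requires.\<close>

lemma eventually_affine_lower_bound:
  assumes I: "finite I" and C: "\<And>k. k \<in> I \<Longrightarrow> compact (C k)" "\<And>k. k \<in> I \<Longrightarrow> C k \<subseteq> \<Omega>"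
    and dis: "\<And>k l. k \<in> I \<Longrightarrow> l \<in> I \<Longrightarrow> k \<noteq> l \<Longrightarrow> C k \<inter> C l = {}"
    and ab: "\<And>k. k \<in> I \<Longrightarrow> aff_minorant f (A k) (b k)" and \<delta>: "0 < \<delta>"
  shows "eventually (\<lambda>\<epsilon>. \<forall>Q\<in>Linf \<Omega>. ereal (3/2 * (\<Sum>k\<in>I. A k \<bullet> (LINT x:C k|\<mu>. Q x) + b k * measure \<mu> (C k))
     - 18 * M * (measure \<mu> \<Omega> - (\<Sum>k\<in>I. measure \<mu> (C k))) - \<delta>) \<le> F_eps f \<Omega> \<epsilon> Q) (at_right 0)"
proof -
  \<comment> \<open>Per piece, \<open>18 * M + 9/4 * norm (A k)\<close> comes from the collar,
    \<open>3/2 * norm (A k)\<close> from replacing the integral of \<open>Q\<close> by a lattice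
    sum, and \<open>3/2 * \<bar>b k\<bar>\<close> from replacing the measure by a count. The leading
    \<open>18 * M\<close> belongs to the count of the sites outside all pieces.\<close>
  define B where "B = 18 * M + (\<Sum>k\<in>I. 18 * M + 9/4 * norm (A k) + 3/2 * norm (A k) + 3/2 * \<bar>b k\<bar>)"
  have B0: "0 \<le> B" using M_nonneg by (auto simp: B_def intro!: add_nonneg_nonneg sum_nonneg)
  define e where "e = \<delta> / (B + 1)"
  have e: "0 < e" "B * e \<le> \<delta>" using \<delta> B0 by (auto simp: e_def divide_simps mult_left_mono)
  let ?S = "\<lambda>\<epsilon> k. near \<epsilon> 2 (C k)"
  have ev1: "eventually (\<lambda>\<epsilon>. \<forall>k\<in>I. \<forall>l\<in>I. k \<noteq> l \<longrightarrow> nb 1 (?S \<epsilon> k) \<inter> ?S \<epsilon> l = {}) (at_right 0)"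
    by (rule eventually_pieces_separated[OF I C(1) dis])
  have ev2: "eventually (\<lambda>\<epsilon>. \<forall>k\<in>I. ?S \<epsilon> k \<subseteq> sites \<epsilon> \<Omega>) (at_right 0)"
    using I C open_domain by (intro eventually_ball_finite ballI near_subset_sites) auto
  have ev3: "eventually (\<lambda>\<epsilon>. \<forall>k\<in>I. cells \<epsilon> (?S \<epsilon> k) \<subseteq> \<Omega>) (at_right 0)"
    using I C open_domain by (intro eventually_ball_finite ballI eventually_cells_near_subset) auto
  have ev4: "eventually (\<lambda>\<epsilon>. \<forall>k\<in>I. \<epsilon>^3 * real (card (bd 1 (?S \<epsilon> k))) \<le> e) (at_right 0)"
    using I C e by (intro eventually_ball_finite ballI card_bd_near) auto
  have ev5: "eventually (\<lambda>\<epsilon>. \<forall>k\<in>I. \<epsilon>^3 * real (card (?S \<epsilon> k)) \<le> measure lebesgue (C k) + e) (at_right 0)"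
    using I C e by (intro eventually_ball_finite ballI card_near_le) auto
  have ev6: "eventually (\<lambda>\<epsilon>. \<bar>\<epsilon>^3 * real (card (sites \<epsilon> \<Omega>)) - measure lebesgue \<Omega>\<bar> \<le> e) (at_right 0)"
    using e by (intro card_sites bounded_domain negligible_frontier lmeasurable_domain)
  show ?thesis
    using ev1 ev2 ev3 ev4 ev5 ev6 eventually_pos_at_right_0
  proof eventually_elim
    case (elim \<epsilon>)
    note el = elim
    have pos: "0 \<le> \<epsilon>^3" using elim by simp
    have fin: "finite (sites \<epsilon> \<Omega>)" using elim bounded_domain by (intro finite_sites) auto
    have finS: "finite (?S \<epsilon> k)" if "k \<in> I" for k using elim(2) that fin finite_subset by blast
    show ?case
    proof (intro ballI)
      fix Q assume Q: "Q \<in> Linf \<Omega>"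
      show "ereal (3/2 * (\<Sum>k\<in>I. A k \<bullet> (LINT x:C k|\<mu>. Q x) + b k * measure \<mu> (C k))
        - 18 * M * (measure \<mu> \<Omega> - (\<Sum>k\<in>I. measure \<mu> (C k))) - \<delta>) \<le> F_eps f \<Omega> \<epsilon> Q"
        unfolding F_eps_def
      proof (rule INF_greatest)
        fix Pu assume "Pu \<in> spin_lifts \<Omega> \<epsilon> Q"
        then obtain P u where Pu: "Pu = (P, u)" "(P, u) \<in> spin_lifts \<Omega> \<epsilon> Q" by (cases Pu) auto
        have P: "P \<in> C_eps \<Omega> \<epsilon>" "AE x in \<mu>. P x = Q x"
          and uP: "\<And>i. i \<in> sites \<epsilon> \<Omega> \<Longrightarrow> u (emb i) \<in> S2 \<and> P (\<epsilon> *\<^sub>R emb i) = tensor (u (emb i))"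
          using Pu(2) by (auto simp: spin_lifts_def Z_eps_eq)
        \<comment> \<open>A lift is constrained on the sites of the domain only; elsewhere an
          arbitrary unit vector is put, since the energy estimates require unit values
          everywhere.\<close>
        define v where "v i = (if i \<in> sites \<epsilon> \<Omega> then u (emb i) else axis 1 1)" for i
        have v: "v i \<in> S2" for i using uP by (auto simp: v_def S2_def)
        have len: "lattice_energy f \<Omega> \<epsilon> u = \<epsilon>^3 * energy f (sites \<epsilon> \<Omega>) v"
          unfolding lattice_energy_eq[OF fin]
          by (intro arg_cong2[where f="(*)"] refl energy_cong) (simp add: v_def)
        have AEc: "AE x in \<mu>. x \<in> C k \<longrightarrow> Q x = tensor (v (nearest (x /\<^sub>R \<epsilon>)))" if k: "k \<in> I" for k
          using P(2) AE_space
        proof eventually_elim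
          case (elim x)
          show ?case
          proof
            assume x: "x \<in> C k"
            let ?i = "nearest (x /\<^sub>R \<epsilon>)"
            have "x \<in> cells \<epsilon> (?S \<epsilon> k)" using subset_cells_near[of \<epsilon> "C k"] el(7) x by blast
            then have i: "?i \<in> sites \<epsilon> \<Omega>" using el(2) k by (auto simp: cells_def)
            have "x \<in> (\<lambda>w. \<epsilon> *\<^sub>R (emb ?i + w)) ` W3"
              using nearest_eq_iff_W3[of "x /\<^sub>R \<epsilon>" ?i] el(7)
              by (intro image_eqI[of _ _ "x /\<^sub>R \<epsilon> - emb ?i"]) auto
            then have "P x = P (\<epsilon> *\<^sub>R emb ?i)"
              using P(1) i elim(2) unfolding C_eps_def Z_eps_eq by auto
            then show "Q x = tensor (v ?i)"
              using elim(1) uP[OF i] i by (simp add: v_def)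
          qed
        qed
        have piece: "3/2 * (A k \<bullet> (LINT x:C k|\<mu>. Q x) + b k * measure \<mu> (C k))
            - (18 * M + 9/4 * norm (A k) + 3/2 * norm (A k) + 3/2 * \<bar>b k\<bar>) * e \<le> \<epsilon>^3 * energy f (?S \<epsilon> k) v"
          if k: "k \<in> I" for k
        proof -
          define X where "X = \<epsilon>^3 *\<^sub>R (\<Sum>i\<in>?S \<epsilon> k. tensor (v i))"
          define m where "m = \<epsilon>^3 * real (card (?S \<epsilon> k))"
          have mC: "measure \<mu> (C k) = measure lebesgue (C k)" using C(2)[OF k] by (rule measure_mu)
          have m: "measure \<mu> (C k) \<le> m" "m \<le> measure \<mu> (C k) + e"
            using card_near_ge[OF C(1)[OF k] elim(7)] elim(5) k by (auto simp: mC m_def)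
          have "norm ((LINT x:C k|\<mu>. Q x) - X) \<le> m - measure \<mu> (C k)"
            unfolding X_def m_def
            using elim(3,7) k finS[OF k] C subset_cells_near[of \<epsilon> "C k"] LinfD(1)[OF Q] AEc[OF k]
            by (intro set_integral_cells) (auto simp: compact_sets_mu norm_tensor v)
          then have "norm ((LINT x:C k|\<mu>. Q x) - X) \<le> e" using m by linarith
          then have 1: "\<bar>A k \<bullet> (LINT x:C k|\<mu>. Q x) - A k \<bullet> X\<bar> \<le> norm (A k) * e"
            using Cauchy_Schwarz_ineq2[of "A k" "(LINT x:C k|\<mu>. Q x) - X"]
            by (smt (verit) inner_diff_right mult_left_mono norm_ge_zero)
          have 2: "\<bar>b k * measure \<mu> (C k) - b k * m\<bar> \<le> \<bar>b k\<bar> * e"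
            using m by (simp add: abs_mult mult_left_mono flip: right_diff_distrib)
          have "\<epsilon>^3 * (3/2 * (\<Sum>i\<in>?S \<epsilon> k. A k \<bullet> tensor (v i) + b k)
              - (18 * M + 9/4 * norm (A k)) * real (card (bd 1 (?S \<epsilon> k)))) \<le> \<epsilon>^3 * energy f (?S \<epsilon> k) v"
            by (intro mult_left_mono pos energy_ge_affine finS k v ab)
          moreover have "\<epsilon>^3 * (3/2 * (\<Sum>i\<in>?S \<epsilon> k. A k \<bullet> tensor (v i) + b k)
              - (18 * M + 9/4 * norm (A k)) * real (card (bd 1 (?S \<epsilon> k))))
              = 3/2 * (A k \<bullet> X + b k * m) - (18 * M + 9/4 * norm (A k)) * (\<epsilon>^3 * real (card (bd 1 (?S \<epsilon> k))))"
            by (simp add: X_def m_def sum.distrib inner_sum_right algebra_simps)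
          moreover have "(18 * M + 9/4 * norm (A k)) * (\<epsilon>^3 * real (card (bd 1 (?S \<epsilon> k)))) \<le> (18 * M + 9/4 * norm (A k)) * e"
            using elim(4) k M_nonneg by (intro mult_left_mono) auto
          ultimately have "3/2 * (A k \<bullet> X + b k * m) - (18 * M + 9/4 * norm (A k)) * e \<le> \<epsilon>^3 * energy f (?S \<epsilon> k) v"
            by linarith
          moreover have "3/2 * (A k \<bullet> (LINT x:C k|\<mu>. Q x) + b k * measure \<mu> (C k)) - 3/2 * (norm (A k) * e) - 3/2 * (\<bar>b k\<bar> * e)
              \<le> 3/2 * (A k \<bullet> X + b k * m)"
            using 1 2 unfolding abs_le_iff by argo
          moreover have "(18 * M + 9/4 * norm (A k) + 3/2 * norm (A k) + 3/2 * \<bar>b k\<bar>) * e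
              = (18 * M + 9/4 * norm (A k)) * e + 3/2 * (norm (A k) * e) + 3/2 * (\<bar>b k\<bar> * e)"
            by (simp add: algebra_simps)
          ultimately show ?thesis by linarith
        qed
        let ?n = "\<epsilon>^3 * real (card (sites \<epsilon> \<Omega>)) - (\<Sum>k\<in>I. \<epsilon>^3 * real (card (?S \<epsilon> k)))"
        have "\<bar>energy f (sites \<epsilon> \<Omega>) v - (\<Sum>k\<in>I. energy f (?S \<epsilon> k) v)\<bar>
            \<le> 18 * M * (real (card (sites \<epsilon> \<Omega>)) - (\<Sum>k\<in>I. real (card (?S \<epsilon> k))))"
          using elim(1,2) by (intro energy_separated_ge fin I v) auto
        then have "(\<Sum>k\<in>I. energy f (?S \<epsilon> k) v) - 18 * M * (real (card (sites \<epsilon> \<Omega>)) - (\<Sum>k\<in>I. real (card (?S \<epsilon> k))))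
            \<le> energy f (sites \<epsilon> \<Omega>) v" by linarith
        from mult_left_mono[OF this pos]
        have "(\<Sum>k\<in>I. \<epsilon>^3 * energy f (?S \<epsilon> k) v) - 18 * M * ?n \<le> \<epsilon>^3 * energy f (sites \<epsilon> \<Omega>) v"
          by (simp add: sum_distrib_left right_diff_distrib mult.assoc mult.left_commute)
        moreover have "?n \<le> measure \<mu> \<Omega> - (\<Sum>k\<in>I. measure \<mu> (C k)) + e"
        proof -
          have "(\<Sum>k\<in>I. measure \<mu> (C k)) \<le> (\<Sum>k\<in>I. \<epsilon>^3 * real (card (?S \<epsilon> k)))"
            using card_near_ge[OF C(1) elim(7)] C(2) by (intro sum_mono) (simp add: measure_mu)
          then show ?thesis using elim(6) measure_mu[of \<Omega>] by (simp add: abs_le_iff)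
        qed
        then have "18 * M * ?n \<le> 18 * M * (measure \<mu> \<Omega> - (\<Sum>k\<in>I. measure \<mu> (C k)) + e)"
          using M_nonneg by (intro mult_left_mono) auto
        moreover have "(\<Sum>k\<in>I. 3/2 * (A k \<bullet> (LINT x:C k|\<mu>. Q x) + b k * measure \<mu> (C k))
            - (18 * M + 9/4 * norm (A k) + 3/2 * norm (A k) + 3/2 * \<bar>b k\<bar>) * e) \<le> (\<Sum>k\<in>I. \<epsilon>^3 * energy f (?S \<epsilon> k) v)"
          by (intro sum_mono piece)
        moreover have "B * e = 18 * M * e + (\<Sum>k\<in>I. (18 * M + 9/4 * norm (A k) + 3/2 * norm (A k) + 3/2 * \<bar>b k\<bar>) * e)"
          by (simp add: B_def distrib_right sum_distrib_right)
        ultimately show "ereal (3/2 * (\<Sum>k\<in>I. A k \<bullet> (LINT x:C k|\<mu>. Q x) + b k * measure \<mu> (C k))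
          - 18 * M * (measure \<mu> \<Omega> - (\<Sum>k\<in>I. measure \<mu> (C k))) - \<delta>)
          \<le> (case Pu of (P, u) \<Rightarrow> ereal (lattice_energy f \<Omega> \<epsilon> u))"
          using e(2) by (simp add: Pu(1) len sum_subtractf sum_distrib_left distrib_left)
      qed
    qed
  qed
qed

end

section \<open>Countable families of affine functions\<close>

lemma Lindelof_enum:
  fixes \<U> :: "'i \<Rightarrow> 'a::second_countable_topology set"
  assumes "\<And>i. i \<in> I \<Longrightarrow> open (\<U> i)" "I \<noteq> {}"
  shows "\<exists>e :: nat \<Rightarrow> 'i. range e \<subseteq> I \<and> (\<Union>n. \<U> (e n)) = (\<Union>i\<in>I. \<U> i)"
proof -
  obtain \<F> where F: "\<F> \<subseteq> \<U> ` I" "countable \<F>" "\<Union>\<F> = (\<Union>i\<in>I. \<U> i)"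
    using Lindelof[of "\<U> ` I"] assms(1) by blast
  obtain i0 where i0: "i0 \<in> I" using assms(2) by blast
  define \<G> where "\<G> = insert (\<U> i0) \<F>"
  have G: "\<G> \<subseteq> \<U> ` I" "countable \<G>" "\<G> \<noteq> {}" "\<Union>\<G> = (\<Union>i\<in>I. \<U> i)"
    using F i0 by (auto simp: \<G>_def)
  have "\<forall>n. \<exists>i\<in>I. \<U> i = from_nat_into \<G> n"
    using G(1) from_nat_into[OF G(3)] by blast
  then obtain e where e: "\<And>n. e n \<in> I" "\<And>n. \<U> (e n) = from_nat_into \<G> n" by metis
  have "(\<Union>n. \<U> (e n)) = \<Union>(range (from_nat_into \<G>))" by (simp add: e(2))
  also have "\<dots> = (\<Union>i\<in>I. \<U> i)" using range_from_nat_into[OF G(3,2)] G(4) by simp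
  finally show ?thesis using e(1) by blast
qed

text \<open>Test functions in \<open>L1\<close> have symmetric values; passing to the symmetric part
  does not change inner products with symmetric matrices.\<close>

definition symm :: "real^3^3 \<Rightarrow> real^3^3" where
  "symm A = (1/2) *\<^sub>R (A + transpose A)"

lemma symm_Msym: "symm A \<in> Msym"
  by (simp add: symm_def Msym_def transpose_def vec_eq_iff add.commute)

lemma inner_transpose: "transpose A \<bullet> transpose B = A \<bullet> (B :: real^3^3)"
  by (simp add: inner_vec_def transpose_def sum_3)

lemma symm_inner: assumes "Y \<in> Msym" shows "symm A \<bullet> Y = A \<bullet> Y"
  using assms inner_transpose[of A Y] by (simp add: symm_def inner_add_left Msym_def)

lemma open_affine_hypograph: "open {(Y, s :: real). s < A \<bullet> Y + b}"
proof -
  have "{(Y, s :: real). s < A \<bullet> Y + b} = {z. snd z < A \<bullet> fst z + b}" by auto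
  also have "open \<dots>" by (intro open_Collect_less continuous_intros)
  finally show ?thesis .
qed

lemma Msym_closed: "closed Msym"
proof -
  have eq: "Msym = (\<Inter>i. \<Inter>j. {A. A $ i $ j = A $ j $ i})"
    by (auto simp: Msym_def transpose_def vec_eq_iff)
  show ?thesis
    unfolding eq by (intro closed_INT ballI closed_Collect_eq continuous_intros)
qed

text \<open>The open half-spaces that miss \<open>K\<close> cover its complement, and Lindelof
  extracts a countable subcover. Countability allows the quantifier over \<open>n\<close> to be
  exchanged with the one over almost all points.\<close>

lemma countable_separation_K:
  "\<exists>(A :: nat \<Rightarrow> real^3^3) b. (\<forall>n. A n \<in> Msym) \<and> (\<forall>n. \<forall>Y\<in>K. b n \<le> A n \<bullet> Y) \<and> (\<forall>Y\<in>Msym - K. \<exists>n. A n \<bullet> Y < b n)"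
proof -
  define I where "I = {(A, b). \<forall>Y\<in>K. b \<le> A \<bullet> Y}"
  define U where "U = (\<lambda>(A :: real^3^3, b :: real). {Y. A \<bullet> Y < b})"
  have "(0, 0) \<in> I" by (simp add: I_def)
  moreover have "open (U i)" for i
    by (cases i) (auto simp: U_def intro!: open_Collect_less continuous_intros)
  ultimately obtain e :: "nat \<Rightarrow> _" where e: "range e \<subseteq> I" "(\<Union>n. U (e n)) = (\<Union>i\<in>I. U i)"
    using Lindelof_enum[of I U] by blast
  have eI: "\<forall>Y\<in>K. snd (e n) \<le> fst (e n) \<bullet> Y" for n
    using e(1) by (auto simp: I_def dest: subsetD[of _ _ "e n"])
  have cover: "\<exists>n. fst (e n) \<bullet> Y < snd (e n)" if Y: "Y \<notin> K" for Y
  proof -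
    obtain a b where "a \<bullet> Y < b" "\<forall>x\<in>K. b < a \<bullet> x"
      using separating_hyperplane_closed_point[OF convex_K closed_K Y] by blast
    then have "(a, b) \<in> I" "Y \<in> U (a, b)" by (auto simp: I_def U_def intro: less_imp_le)
    then have "Y \<in> (\<Union>n. U (e n))" unfolding e(2) by blast
    then show ?thesis by (auto simp: U_def case_prod_beta)
  qed
  show ?thesis
    using eI cover K_subset_Msym
    by (intro exI[of _ "\<lambda>n. symm (fst (e n))"] exI[of _ "\<lambda>n. snd (e n)"])
       (auto simp: symm_Msym symm_inner subset_eq)
qed

text \<open>The strict hypographs of the affine minorants are open and cover the strict hypograph of
  the envelope over \<open>K\<close>; a countable subcover still approximates the envelope from
  below at every point.\<close>

lemma (in spin) countable_minorants:
  "\<exists>(A :: nat \<Rightarrow> real^3^3) b. (\<forall>n. A n \<in> Msym) \<and> (\<forall>n. aff_minorant f (A n) (b n)) \<and>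
     (\<forall>Y\<in>K. \<forall>s<real_of_ereal (envelope f Y). \<exists>n. s < A n \<bullet> Y + b n)"
proof -
  define I where "I = {(A, b). aff_minorant f A b}"
  define U where "U = (\<lambda>(A :: real^3^3, b :: real). {(Y, s). s < A \<bullet> Y + b})"
  have "(0, - 6 * M) \<in> I" using fhat_ge by (simp add: I_def aff_minorant_def)
  moreover have "open (U i)" for i
    using open_affine_hypograph by (cases i) (auto simp: U_def)
  ultimately obtain e :: "nat \<Rightarrow> _" where e: "range e \<subseteq> I" "(\<Union>n. U (e n)) = (\<Union>i\<in>I. U i)"
    using Lindelof_enum[of I U] by blast
  have eI: "aff_minorant f (fst (e n)) (snd (e n))" for n
    using e(1) by (auto simp: I_def dest: subsetD[of _ _ "e n"])
  have cover: "\<exists>n. s < fst (e n) \<bullet> Y + snd (e n)" if Y: "Y \<in> K" "s < real_of_ereal (envelope f Y)" for Y s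
  proof -
    have "ereal s < envelope f Y" using Y(2) by (subst envelope_real[OF Y(1)]) simp
    then obtain A b where "aff_minorant f A b" "s < A \<bullet> Y + b"
      using envelope_aff_minorant[OF Y(1)] by blast
    then have "(A, b) \<in> I" "(Y, s) \<in> U (A, b)" by (auto simp: I_def U_def)
    then have "(Y, s) \<in> (\<Union>n. U (e n))" unfolding e(2) by blast
    then show ?thesis by (auto simp: U_def case_prod_beta)
  qed
  have "aff_minorant f (symm (fst (e n))) (snd (e n))" for n
    using eI[of n] K_subset_Msym by (auto simp: aff_minorant_def symm_inner subset_eq)
  moreover have "\<exists>n. s < symm (fst (e n)) \<bullet> Y + snd (e n)" if "Y \<in> K" "s < real_of_ereal (envelope f Y)" for Y s
    using cover[OF that] that(1) K_subset_Msym by (auto simp: symm_inner subset_eq)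
  ultimately show ?thesis
    using symm_Msym by (intro exI[of _ "\<lambda>n. symm (fst (e n))"] exI[of _ "\<lambda>n. snd (e n)"]) blast
qed

text \<open>Competitors are constrained on \<open>Msym\<close> only, so one that is infinite
  elsewhere is admissible. This settles the part of the matrix space off \<open>Msym\<close> in the
  proof of measurability.\<close>

lemma (in spin) envelope_outside: assumes "Y \<notin> Msym" shows "envelope f Y = \<infinity>"
proof -
  define h where "h = (\<lambda>Y. if Y \<in> Msym then ereal (- 6 * M) else \<infinity>)"
  have "h Y \<le> envelope f Y"
  proof (rule envelope_greatest)
    have "{(x, t::real). x \<in> Msym \<and> h x \<le> ereal t} = Msym \<times> {- 6 * M..}"
      by (auto simp: h_def)
    then show "econvex_on Msym h"
      unfolding econvex_on_def by (simp only:) (intro convex_Times convex_Msym convex_real_interval)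
    show "lsc_on Msym h"
      by (rule lsc_onI) (auto simp: h_def eventually_at_filter)
    show "h Z \<le> fhat f Z" if "Z \<in> Msym" for Z
      using that fhat_ge by (simp add: h_def)
  qed
  then show ?thesis using assms by (simp add: h_def)
qed

text \<open>Superlevel sets within the closed set \<open>Msym\<close> are relatively open by lower
  semicontinuity; for a finite level the whole complement of \<open>Msym\<close> is added.\<close>

lemma (in spin) envelope_measurable: "envelope f \<in> borel_measurable borel"
proof (rule borel_measurableI_greater)
  fix s :: ereal
  have "openin (top_of_set Msym) {Y \<in> Msym. s < envelope f Y}"
    unfolding openin_euclidean_subtopology_iff
    using lsc_onD[OF lsc_envelope] by auto
  then obtain T where T: "open T" "{Y \<in> Msym. s < envelope f Y} = Msym \<inter> T"
    by (auto simp: openin_open)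
  have "{Y \<in> space borel. s < envelope f Y} = (Msym \<inter> T) \<union> (if s < \<infinity> then - Msym else {})"
    unfolding T(2)[symmetric] using envelope_outside by auto
  also have "\<dots> \<in> sets borel"
    using T(1) Msym_closed by (auto intro!: sets.Un sets.Int borel_open borel_closed borel_comp)
  finally show "{Y \<in> space borel. s < envelope f Y} \<in> sets borel" .
qed

context domain_spin
begin

abbreviation real_envelope where "real_envelope Y \<equiv> real_of_ereal (envelope f Y)"

lemma g_measurable: assumes "Q \<in> borel_measurable \<mu>" shows "(\<lambda>x. real_envelope (Q x)) \<in> borel_measurable \<mu>"
proof -
  have "real_envelope \<in> borel_measurable borel" using envelope_measurable by simp
  then show ?thesis using assms by (rule measurable_compose[rotated])
qed

text \<open>A field that leaves \<open>K\<close> on a non-null set violates one of countably many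
  half-space conditions on a non-null set \<open>E\<close>. Testing with the normal vector on
  \<open>E\<close> separates it from all fields with values in \<open>K\<close>, hence from all
  fields of finite energy, whatever \<epsilon> is.\<close>

lemma liminf_outside_K:
  assumes Q: "Q \<in> Linf \<Omega>" and nK: "\<not> (AE x in \<mu>. Q x \<in> K)"
  shows "\<exists>U. openin (weak_star \<Omega>) U \<and> Q \<in> U \<and> (\<forall>\<epsilon>. \<forall>P\<in>U. F_eps f \<Omega> \<epsilon> P = \<infinity>)"
proof -
  interpret finite_measure \<mu> by (rule finite_measure_mu)
  obtain A :: "nat \<Rightarrow> real^3^3" and b where Ab: "\<And>n. A n \<in> Msym" "\<And>n Y. Y \<in> K \<Longrightarrow> b n \<le> A n \<bullet> Y"
    "\<And>Y. Y \<in> Msym - K \<Longrightarrow> \<exists>n. A n \<bullet> Y < b n"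
    using countable_separation_K by blast
  have Qm: "Q \<in> borel_measurable \<mu>" by (rule LinfD(1)[OF Q])
  obtain c where c: "0 \<le> c" "AE x in \<mu>. norm (Q x) \<le> c" using LinfD(2)[OF Q] by blast
  have QM: "AE x in \<mu>. Q x \<in> Msym" using Q by (simp add: Linf_def)
  have "\<exists>n. \<not> (AE x in \<mu>. b n \<le> A n \<bullet> Q x)"
  proof (rule ccontr)
    assume "\<nexists>n. \<not> (AE x in \<mu>. b n \<le> A n \<bullet> Q x)"
    then have "AE x in \<mu>. \<forall>n. b n \<le> A n \<bullet> Q x" by (simp add: AE_all_countable)
    then have "AE x in \<mu>. Q x \<in> K" using QM
      by eventually_elim (metis Ab(3) DiffI not_less)
    then show False using nK by simp
  qed
  then obtain n where n: "\<not> (AE x in \<mu>. b n \<le> A n \<bullet> Q x)" by blast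
  define E where "E = {x \<in> space \<mu>. A n \<bullet> Q x < b n}"
  have E: "E \<in> sets \<mu>" unfolding E_def using Qm by measurable
  define \<Phi> where "\<Phi> x = indicator E x *\<^sub>R A n" for x
  have "(0 :: real^3^3) \<in> Msym" by (simp add: Msym_def transpose_def vec_eq_iff)
  then have \<Phi>: "\<Phi> \<in> L1 \<Omega>"
    unfolding L1_def \<Phi>_def[abs_def] using E Ab(1)[of n]
    by (auto simp: indicator_def intro!: integrable_scaleR_left[OF integrable_indicator_mu, unfolded indicator_def])
  have \<Phi>i: "integrable \<mu> \<Phi>" using \<Phi> by (simp add: L1_def)
  have bi: "integrable \<mu> (\<lambda>x. b n * indicator E x)" using integrable_indicator_mu[OF E] by simp
  have bE: "(LINT x|\<mu>. b n * indicator E x) = b n * measure \<mu> E"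
    using E by (simp add: sets_mu Int_absorb2)
  have "(LINT x|\<mu>. Q x \<bullet> \<Phi> x) < (LINT x|\<mu>. b n * indicator E x)"
  proof (rule integral_less_AE)
    show "integrable \<mu> (\<lambda>x. Q x \<bullet> \<Phi> x)" by (rule integrable_inner_bounded[OF Qm c(2) \<Phi>i])
    show "AE x in \<mu>. x \<in> E \<longrightarrow> Q x \<bullet> \<Phi> x \<noteq> b n * indicator E x"
      by (rule AE_I2) (auto simp: E_def \<Phi>_def inner_commute)
    show "AE x in \<mu>. Q x \<bullet> \<Phi> x \<le> b n * indicator E x"
      by (rule AE_I2) (auto simp: E_def \<Phi>_def inner_commute indicator_def)
    show "emeasure \<mu> E \<noteq> 0"
    proof
      assume "emeasure \<mu> E = 0"
      then have "AE x in \<mu>. \<not> A n \<bullet> Q x < b n"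
        using E by (subst AE_iff_measurable[OF _ refl]) (auto simp: E_def)
      then show False using n by (simp add: not_less)
    qed
  qed (use E bi in auto)
  then have Ql: "(LINT x|\<mu>. Q x \<bullet> \<Phi> x) < b n * measure \<mu> E" by (simp only: bE)
  let ?U = "{P \<in> Linf \<Omega>. (LINT x|\<mu>. P x \<bullet> \<Phi> x) \<in> {..< b n * measure \<mu> E}}"
  have "F_eps f \<Omega> \<epsilon> P = \<infinity>" if P: "P \<in> ?U" for \<epsilon> P
  proof -
    have "spin_lifts \<Omega> \<epsilon> P = {}"
    proof (rule ccontr)
      assume "spin_lifts \<Omega> \<epsilon> P \<noteq> {}"
      then obtain P' where P': "P' \<in> C_eps \<Omega> \<epsilon>" "AE x in \<mu>. P' x = P x" by (auto simp: spin_lifts_def)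
      have PK: "AE x in \<mu>. P x \<in> K"
        using P'(2) AE_space
      proof eventually_elim
        case (elim x)
        have "P' x \<in> tensor ` S2" using P'(1) elim(2) by (simp add: C_eps_def)
        then show ?case using tensor_in_K elim(1) by fastforce
      qed
      have "(LINT x|\<mu>. b n * indicator E x) \<le> (LINT x|\<mu>. P x \<bullet> \<Phi> x)"
      proof (rule integral_mono_AE[OF bi])
        have "P \<in> Linf \<Omega>" using P by simp
        then show "integrable \<mu> (\<lambda>x. P x \<bullet> \<Phi> x)"
          using LinfD[of P] integrable_inner_bounded[OF _ _ \<Phi>i] by blast
        show "AE x in \<mu>. b n * indicator E x \<le> P x \<bullet> \<Phi> x"
          using PK
        proof eventually_elim
          case (elim x)
          then show ?case using Ab(2)[OF elim, of n] by (auto simp: \<Phi>_def indicator_def inner_commute)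
        qed
      qed
      then show False using P unfolding bE by simp
    qed
    then show ?thesis by (simp add: F_eps_def top_ereal_def)
  qed
  then show ?thesis
    using openin_weak_star[OF \<Phi>, of "{..< b n * measure \<mu> E}"] Q Ql by (intro exI[of _ ?U]) auto
qed

section \<open>Exhaustion by disjoint compact sets\<close>

lemma measure_UN_approx:
  assumes E: "\<And>n. E n \<in> sets \<mu>" and cover: "AE x in \<mu>. \<exists>n. x \<in> E n" and \<eta>: "0 < \<eta>"
  shows "\<exists>m::nat. measure \<mu> \<Omega> - \<eta> < measure \<mu> (\<Union>n<m. E n)"
proof -
  interpret finite_measure \<mu> by (rule finite_measure_mu)
  have "(\<lambda>m. measure \<mu> (\<Union>n<m. E n)) \<longlonglongrightarrow> measure \<mu> (\<Union>m. \<Union>n<m. E n)"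
    using E by (intro finite_Lim_measure_incseq) (auto intro!: monoI intro: less_le_trans)
  moreover have "measure \<mu> (\<Union>m. \<Union>n<m. E n) = measure \<mu> \<Omega>"
  proof (rule measure_eq_AE)
    show "AE x in \<mu>. x \<in> (\<Union>m. \<Union>n<m. E n) \<longleftrightarrow> x \<in> \<Omega>"
      using cover AE_space by eventually_elim auto
    show "\<Omega> \<in> sets \<mu>" using sets.top[of \<mu>] by simp
  qed (use E in auto)
  ultimately have "eventually (\<lambda>m. measure \<mu> \<Omega> - \<eta> < measure \<mu> (\<Union>n<m. E n)) sequentially"
    using \<eta> by (intro order_tendstoD) auto
  then show ?thesis by (auto simp: eventually_sequentially)
qed

text \<open>Half of the error is spent on cutting the countable cover down to \<open>m\<close> sets,
  the other half, shared among the \<open>m\<close> disjointed sets, on inner regularity.\<close>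

lemma compact_pieces:
  assumes E: "\<And>n. E n \<in> sets \<mu>" and cover: "AE x in \<mu>. \<exists>n. x \<in> E n" and \<eta>: "0 < \<eta>"
  shows "\<exists>(m::nat) C. (\<forall>n<m. compact (C n) \<and> C n \<subseteq> E n) \<and> (\<forall>k<m. \<forall>l<m. k \<noteq> l \<longrightarrow> C k \<inter> C l = {}) \<and>
     measure \<mu> \<Omega> - \<eta> < (\<Sum>n<m. measure \<mu> (C n))"
proof -
  interpret finite_measure \<mu> by (rule finite_measure_mu)
  obtain m where m: "measure \<mu> \<Omega> - \<eta> / 2 < measure \<mu> (\<Union>n<m. E n)"
    using measure_UN_approx[OF E cover, of "\<eta> / 2"] \<eta> by auto
  have D: "disjointed E n \<in> sets \<mu>" for n
    using sets.range_disjointed_sets[of E \<mu>] E by blast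
  have "\<exists>C. compact C \<and> C \<subseteq> disjointed E n \<and> measure \<mu> (disjointed E n - C) < \<eta> / (2 * real (Suc m))" for n
    using \<eta> by (intro inner_compact D) simp
  then have "\<forall>n. \<exists>C. compact C \<and> C \<subseteq> disjointed E n \<and> measure \<mu> (disjointed E n - C) < \<eta> / (2 * real (Suc m))"
    by blast
  from choice[OF this] obtain C where
    "\<forall>n. compact (C n) \<and> C n \<subseteq> disjointed E n \<and> measure \<mu> (disjointed E n - C n) < \<eta> / (2 * real (Suc m))"
    by (rule exE)
  then have C: "\<And>n. compact (C n)" "\<And>n. C n \<subseteq> disjointed E n"
    "\<And>n. measure \<mu> (disjointed E n - C n) < \<eta> / (2 * real (Suc m))" by simp_all
  have CE: "C n \<subseteq> E n" for n by (rule subset_trans[OF C(2) disjointed_subset])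
  have Cs: "C n \<in> sets \<mu>" for n
    using C(1) CE[of n] E[of n] by (intro compact_sets_mu) (auto simp: sets_mu)
  have dis: "C k \<inter> C l = {}" if "k \<noteq> l" for k l
  proof -
    have "disjointed E k \<inter> disjointed E l = {}"
      using disjoint_family_disjointed[of E] that by (simp add: disjoint_family_on_def)
    then show ?thesis using C(2)[of k] C(2)[of l] by blast
  qed
  have "measure \<mu> (\<Union>n<m. E n) = measure \<mu> (\<Union>n<m. disjointed E n)"
    using finite_UN_disjointed_eq[of E m] by (simp add: lessThan_atLeast0)
  also have "\<dots> = (\<Sum>n<m. measure \<mu> (disjointed E n))"
    using D disjoint_family_disjointed[of E]
    by (intro finite_measure_finite_Union) (auto simp: disjoint_family_on_def)
  also have "\<dots> \<le> (\<Sum>n<m. measure \<mu> (C n) + \<eta> / (2 * real (Suc m)))"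
  proof (rule sum_mono)
    fix n
    have "measure \<mu> (disjointed E n - C n) = measure \<mu> (disjointed E n) - measure \<mu> (C n)"
      using C(2) D Cs by (intro finite_measure_Diff) auto
    then show "measure \<mu> (disjointed E n) \<le> measure \<mu> (C n) + \<eta> / (2 * real (Suc m))"
      using C(3)[of n] by linarith
  qed
  also have "\<dots> = (\<Sum>n<m. measure \<mu> (C n)) + real m * (\<eta> / (2 * real (Suc m)))"
    by (simp add: sum.distrib)
  also have "real m * (\<eta> / (2 * real (Suc m))) \<le> \<eta> / 2"
    using \<eta> by (simp add: field_simps)
  finally have "measure \<mu> \<Omega> - \<eta> < (\<Sum>n<m. measure \<mu> (C n))" using m by linarith
  then show ?thesis using C(1) CE dis by (intro exI[of _ m] exI[of _ C]) auto
qed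

end

context domain_spin
begin

lemma integrable_g:
  assumes "Q \<in> Linf \<Omega>" "AE x in \<mu>. Q x \<in> K"
  shows "integrable \<mu> (\<lambda>x. real_envelope (Q x))" "AE x in \<mu>. \<bar>real_envelope (Q x)\<bar> \<le> 6 * M"
proof -
  show b: "AE x in \<mu>. \<bar>real_envelope (Q x)\<bar> \<le> 6 * M"
    using assms(2) by eventually_elim (rule abs_envelope_le)
  then show "integrable \<mu> (\<lambda>x. real_envelope (Q x))"
    by (intro integrable_bounded[where c="6 * M"] g_measurable LinfD(1)[OF assms(1)]) simp
qed

lemma integral_split_pieces:
  fixes y :: "real^3 \<Rightarrow> real"
  assumes I: "finite I" and C: "\<And>k. k \<in> I \<Longrightarrow> C k \<in> sets \<mu>"
    and dis: "\<And>k l. k \<in> I \<Longrightarrow> l \<in> I \<Longrightarrow> k \<noteq> l \<Longrightarrow> C k \<inter> C l = {}"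
    and y: "y \<in> borel_measurable \<mu>" "AE x in \<mu>. \<bar>y x\<bar> \<le> c" and c: "0 \<le> c"
  shows "\<bar>(LINT x|\<mu>. y x) - (\<Sum>k\<in>I. LINT x:C k|\<mu>. y x)\<bar> \<le> c * (measure \<mu> \<Omega> - (\<Sum>k\<in>I. measure \<mu> (C k)))"
proof -
  interpret finite_measure \<mu> by (rule finite_measure_mu)
  let ?U = "\<Union>k\<in>I. C k"
  have U: "?U \<in> sets \<mu>" "\<Omega> - ?U \<in> sets \<mu>" "\<Omega> \<in> sets \<mu>"
    using I C sets.top[of \<mu>] by auto
  have yb: "AE x in \<mu>. norm (y x) \<le> c" using y(2) by simp
  have int: "set_integrable \<mu> A y" if "A \<in> sets \<mu>" for A
    by (rule set_integrable_bounded[OF y(1) yb that])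
  have "?U \<subseteq> \<Omega>" using C by (auto simp: sets_mu)
  then have un: "?U \<union> (\<Omega> - ?U) = \<Omega>" by blast
  have "(LINT x|\<mu>. y x) = (LINT x:\<Omega>|\<mu>. y x)"
    using set_integral_space[OF integrable_bounded[OF y(1) yb]] by simp
  also have "\<dots> = (LINT x:?U|\<mu>. y x) + (LINT x:\<Omega> - ?U|\<mu>. y x)"
    using set_integral_Un[OF _ int[OF U(1)] int[OF U(2)]] un by simp
  also have "(LINT x:?U|\<mu>. y x) = (\<Sum>k\<in>I. LINT x:C k|\<mu>. y x)"
  proof (intro set_integral_finite_UN_AE I int C)
    fix k l assume kl: "k \<in> I" "l \<in> I"
    show "AE x in \<mu>. (x \<in> C k \<and> x \<in> C l) \<longrightarrow> k = l"
      using dis[OF kl] by (intro AE_I2) blast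
  qed
  finally have "\<bar>(LINT x|\<mu>. y x) - (\<Sum>k\<in>I. LINT x:C k|\<mu>. y x)\<bar> = norm (LINT x:\<Omega> - ?U|\<mu>. y x)"
    by simp
  also have "\<dots> \<le> c * measure \<mu> (\<Omega> - ?U)"
    by (rule norm_set_integral_le[OF y(1) yb U(2) c])
  also have "measure \<mu> (\<Omega> - ?U) = measure \<mu> \<Omega> - measure \<mu> ?U"
    using U \<open>?U \<subseteq> \<Omega>\<close> by (intro finite_measure_Diff) auto
  also have "measure \<mu> ?U = (\<Sum>k\<in>I. measure \<mu> (C k))"
    using I C dis by (intro finite_measure_finite_Union) (auto simp: disjoint_family_on_def)
  finally show ?thesis .
qed

text \<open>The pieces are compact subsets of the sets where the \<open>n\<close>-th minorant is
  within \<eta> of the envelope along \<open>Q\<close>. The simple field with value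
  \<open>A n\<close> on \<open>C n\<close> is the test function, and the neighbourhood consists of
  the fields whose pairing with it drops by less than \<eta>.\<close>

lemma liminf_bound:
  assumes Q: "Q \<in> Linf \<Omega>" and K: "AE x in \<mu>. Q x \<in> K" and s: "s < 3/2 * (LINT x|\<mu>. real_envelope (Q x))"
  shows "\<exists>U. openin (weak_star \<Omega>) U \<and> Q \<in> U \<and> eventually (\<lambda>\<epsilon>. \<forall>P\<in>U. ereal s \<le> F_eps f \<Omega> \<epsilon> P) (at_right 0)"
proof -
  interpret finite_measure \<mu> by (rule finite_measure_mu)
  define L where "L = measure \<mu> \<Omega>"
  \<comment> \<open>Losses in multiples of \<eta>. Under the factor 3/2: \<open>6 * M\<close> for
    the envelope outside the pieces, \<open>L\<close> for the minorants that are only nearly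
    optimal, 1 for the neighbourhood. Then \<open>18 * M\<close> for the sites outside the pieces
    and 1 for the discretization.\<close>
  define D where "D = 3/2 * (6 * M + L + 1) + 18 * M + 1"
  have L0: "0 \<le> L" by (simp add: L_def)
  have D: "0 < D" using M_nonneg L0 by (simp add: D_def add_nonneg_pos)
  define \<eta> where "\<eta> = (3/2 * (LINT x|\<mu>. real_envelope (Q x)) - s) / D"
  have \<eta>: "0 < \<eta>" "D * \<eta> = 3/2 * (LINT x|\<mu>. real_envelope (Q x)) - s" using s D by (simp_all add: \<eta>_def)
  obtain A :: "nat \<Rightarrow> real^3^3" and b where Ab: "\<And>n. A n \<in> Msym" "\<And>n. aff_minorant f (A n) (b n)"
     "\<And>Y s. Y \<in> K \<Longrightarrow> s < real_envelope Y \<Longrightarrow> \<exists>n. s < A n \<bullet> Y + b n"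
    using countable_minorants by blast
  have Qm: "Q \<in> borel_measurable \<mu>" by (rule LinfD(1)[OF Q])
  have gm: "(\<lambda>x. real_envelope (Q x)) \<in> borel_measurable \<mu>" by (rule g_measurable[OF Qm])
  obtain c where c: "0 \<le> c" "AE x in \<mu>. norm (Q x) \<le> c" using LinfD(2)[OF Q] by blast
  define E where "E n = {x \<in> space \<mu>. real_envelope (Q x) - \<eta> < A n \<bullet> Q x + b n}" for n
  have E: "E n \<in> sets \<mu>" for n
  proof -
    have "(\<lambda>x. A n \<bullet> Q x + b n) \<in> borel_measurable \<mu>" using Qm by simp
    moreover have "(\<lambda>x. real_envelope (Q x) - \<eta>) \<in> borel_measurable \<mu>" using gm by simp
    ultimately show ?thesis unfolding E_def by (rule borel_measurable_less[rotated])
  qed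
  have cover: "AE x in \<mu>. \<exists>n. x \<in> E n"
    using K AE_space
  proof eventually_elim
    case (elim x)
    then show ?case using Ab(3)[of "Q x" "real_envelope (Q x) - \<eta>"] \<eta>(1) by (auto simp: E_def)
  qed
  obtain m C where C: "\<forall>n<m. compact (C n) \<and> C n \<subseteq> E n" "\<forall>k<m. \<forall>l<m. k \<noteq> l \<longrightarrow> C k \<inter> C l = {}"
     and mC: "L - \<eta> < (\<Sum>n<m. measure \<mu> (C n))"
    using compact_pieces[OF E cover \<eta>(1)] unfolding L_def by metis
  have CO: "C n \<subseteq> \<Omega>" "C n \<in> sets \<mu>" if "n < m" for n
  proof -
    show "C n \<subseteq> \<Omega>" using C(1) that E[of n] by (auto simp: sets_mu)
    then show "C n \<in> sets \<mu>" using C(1) that by (intro compact_sets_mu) auto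
  qed
  have mCle: "(\<Sum>n<m. measure \<mu> (C n)) \<le> L"
  proof -
    have "(\<Sum>n<m. measure \<mu> (C n)) = measure \<mu> (\<Union>n<m. C n)"
      using CO C(2) by (intro finite_measure_finite_Union[symmetric]) (auto simp: disjoint_family_on_def)
    also have "\<dots> \<le> L" unfolding L_def using bounded_measure[of "\<Union>n<m. C n"] by simp
    finally show ?thesis .
  qed
  define \<Phi> where "\<Phi> x = (\<Sum>n<m. indicator (C n) x *\<^sub>R A n)" for x
  have ind: "integrable \<mu> (\<lambda>x. indicator (C n) x *\<^sub>R A n)" if "n < m" for n
    using CO(2)[OF that] by (intro integrable_scaleR_left integrable_indicator_mu)
  have \<Phi>i: "integrable \<mu> \<Phi>"
    unfolding \<Phi>_def[abs_def] using ind by (intro Bochner_Integration.integrable_sum) auto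
  have "\<Phi> x \<in> Msym" for x
  proof -
    have "transpose (\<Phi> x) = (\<Sum>n<m. indicator (C n) x *\<^sub>R transpose (A n))"
      by (simp add: \<Phi>_def transpose_def vec_eq_iff sum_component)
    also have "\<dots> = \<Phi> x" using Ab(1) by (simp add: Msym_def \<Phi>_def)
    finally show ?thesis by (simp add: Msym_def)
  qed
  then have \<Phi>: "\<Phi> \<in> L1 \<Omega>" using \<Phi>i by (simp add: L1_def)
  have test: "(LINT x|\<mu>. P x \<bullet> \<Phi> x) = (\<Sum>n<m. A n \<bullet> (LINT x:C n|\<mu>. P x))" if P: "P \<in> Linf \<Omega>" for P
  proof -
    obtain c where c: "0 \<le> c" "AE x in \<mu>. norm (P x) \<le> c" using LinfD(2)[OF P] by blast
    have pi: "set_integrable \<mu> (C n) P" if "n < m" for n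
      by (rule set_integrable_bounded[OF LinfD(1)[OF P] c(2) CO(2)[OF that]])
    have "(LINT x|\<mu>. P x \<bullet> \<Phi> x) = (LINT x|\<mu>. (\<Sum>n<m. A n \<bullet> (indicator (C n) x *\<^sub>R P x)))"
      by (simp add: \<Phi>_def inner_sum_right inner_commute)
    also have "\<dots> = (\<Sum>n<m. LINT x|\<mu>. A n \<bullet> (indicator (C n) x *\<^sub>R P x))"
      using pi unfolding set_integrable_def by (intro Bochner_Integration.integral_sum integrable_inner_right) auto
    also have "\<dots> = (\<Sum>n<m. A n \<bullet> (LINT x:C n|\<mu>. P x))"
      using pi unfolding set_integrable_def set_lebesgue_integral_def
      by (intro sum.cong refl integral_inner_right) auto
    finally show ?thesis .
  qed
  define V where "V = {(LINT x|\<mu>. Q x \<bullet> \<Phi> x) - \<eta> <..}"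
  let ?U = "{P \<in> Linf \<Omega>. (LINT x|\<mu>. P x \<bullet> \<Phi> x) \<in> V}"
  have piece: "(LINT x:C n|\<mu>. real_envelope (Q x)) - \<eta> * measure \<mu> (C n) \<le> A n \<bullet> (LINT x:C n|\<mu>. Q x) + b n * measure \<mu> (C n)"
    if n: "n < m" for n
  proof -
    have si: "integrable \<mu> (\<lambda>x. indicator (C n) x *\<^sub>R Q x)"
      using set_integrable_bounded[OF Qm c(2) CO(2)[OF n]] by (simp add: set_integrable_def)
    have gi: "integrable \<mu> (\<lambda>x. indicator (C n) x *\<^sub>R real_envelope (Q x))"
      using CO(2)[OF n] by (intro integrable_mult_indicator integrable_g Q K)
    have ii: "integrable \<mu> (indicat_real (C n))" using CO(2)[OF n] by (rule integrable_indicator_mu)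
    have mi: "(LINT x|\<mu>. indicator (C n) x) = measure \<mu> (C n)"
      using CO[OF n] by (simp add: Int_absorb2)
    have "(LINT x|\<mu>. indicator (C n) x *\<^sub>R real_envelope (Q x) - \<eta> * indicator (C n) x)
       \<le> (LINT x|\<mu>. A n \<bullet> (indicator (C n) x *\<^sub>R Q x) + b n * indicator (C n) x)"
    proof (rule integral_mono)
      show "integrable \<mu> (\<lambda>x. indicator (C n) x *\<^sub>R real_envelope (Q x) - \<eta> * indicator (C n) x)"
        using gi ii by (intro Bochner_Integration.integrable_diff integrable_mult_right) auto
      show "integrable \<mu> (\<lambda>x. A n \<bullet> (indicator (C n) x *\<^sub>R Q x) + b n * indicator (C n) x)"
        using si ii by (intro Bochner_Integration.integrable_add integrable_mult_right integrable_inner_right) auto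
      fix x
      have "x \<in> C n \<Longrightarrow> real_envelope (Q x) - \<eta> < A n \<bullet> Q x + b n" using C(1) n by (auto simp: E_def)
      then show "indicator (C n) x *\<^sub>R real_envelope (Q x) - \<eta> * indicator (C n) x
         \<le> A n \<bullet> (indicator (C n) x *\<^sub>R Q x) + b n * indicator (C n) x"
        by (auto simp: indicator_def)
    qed
    moreover have "(LINT x|\<mu>. indicator (C n) x *\<^sub>R real_envelope (Q x) - \<eta> * indicator (C n) x)
        = (LINT x:C n|\<mu>. real_envelope (Q x)) - \<eta> * measure \<mu> (C n)"
      unfolding set_lebesgue_integral_def
      by (subst Bochner_Integration.integral_diff[OF gi integrable_mult_right[OF ii]])
         (simp only: integral_mult_right_zero mi)
    moreover have "(LINT x|\<mu>. A n \<bullet> (indicator (C n) x *\<^sub>R Q x) + b n * indicator (C n) x)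
        = A n \<bullet> (LINT x:C n|\<mu>. Q x) + b n * measure \<mu> (C n)"
      unfolding set_lebesgue_integral_def
      by (subst Bochner_Integration.integral_add[OF integrable_inner_right[OF si] integrable_mult_right[OF ii]])
         (simp only: integral_mult_right_zero mi integral_inner_right[OF si])
    ultimately show ?thesis by simp
  qed
  have low: "(LINT x|\<mu>. real_envelope (Q x)) - 6 * M * \<eta> - \<eta> * L \<le> (LINT x|\<mu>. Q x \<bullet> \<Phi> x) + (\<Sum>n<m. b n * measure \<mu> (C n))"
  proof -
    have "\<bar>(LINT x|\<mu>. real_envelope (Q x)) - (\<Sum>n<m. LINT x:C n|\<mu>. real_envelope (Q x))\<bar> \<le> 6 * M * (L - (\<Sum>n<m. measure \<mu> (C n)))"
      unfolding L_def using CO C(2) M_nonneg by (intro integral_split_pieces gm integrable_g(2)[OF Q K]) auto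
    moreover have "6 * M * (L - (\<Sum>n<m. measure \<mu> (C n))) \<le> 6 * M * \<eta>"
      using mC M_nonneg by (intro mult_left_mono) auto
    moreover have "(\<Sum>n<m. (LINT x:C n|\<mu>. real_envelope (Q x)) - \<eta> * measure \<mu> (C n))
        \<le> (\<Sum>n<m. A n \<bullet> (LINT x:C n|\<mu>. Q x) + b n * measure \<mu> (C n))"
      using piece by (intro sum_mono) auto
    moreover have "\<eta> * (\<Sum>n<m. measure \<mu> (C n)) \<le> \<eta> * L"
      using mCle \<eta>(1) by (intro mult_left_mono) auto
    ultimately show ?thesis
      unfolding test[OF Q] sum.distrib sum_subtractf sum_distrib_left[symmetric] abs_le_iff by linarith
  qed
  have "eventually (\<lambda>\<epsilon>. \<forall>P\<in>Linf \<Omega>. ereal (3/2 * (\<Sum>n<m. A n \<bullet> (LINT x:C n|\<mu>. P x) + b n * measure \<mu> (C n))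
     - 18 * M * (measure \<mu> \<Omega> - (\<Sum>n<m. measure \<mu> (C n))) - \<eta>) \<le> F_eps f \<Omega> \<epsilon> P) (at_right 0)"
    using C CO Ab(2) \<eta>(1) by (intro eventually_affine_lower_bound) auto
  then have "eventually (\<lambda>\<epsilon>. \<forall>P\<in>?U. ereal s \<le> F_eps f \<Omega> \<epsilon> P) (at_right 0)"
  proof eventually_elim
    case (elim \<epsilon>)
    show ?case
    proof
      fix P assume P: "P \<in> ?U"
      have arith: "s \<le> 3/2 * (T + B) - p - \<eta>"
        if "q - \<eta> < T" "p \<le> r" "d = 3/2 * (a + l + \<eta>) + r + \<eta>" "G - a - l \<le> q + B" "d = 3/2 * G - s"
        for q T p r a l B G d :: real
        using that by argo
      have 1: "(LINT x|\<mu>. Q x \<bullet> \<Phi> x) - \<eta> < (\<Sum>n<m. A n \<bullet> (LINT x:C n|\<mu>. P x))"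
        using P test[of P] by (simp add: V_def)
      have 2: "18 * M * (L - (\<Sum>n<m. measure \<mu> (C n))) \<le> 18 * M * \<eta>"
        using mC M_nonneg by (intro mult_left_mono) auto
      have 3: "D * \<eta> = 3/2 * (6 * M * \<eta> + \<eta> * L + \<eta>) + 18 * M * \<eta> + \<eta>"
        by (simp add: D_def algebra_simps)
      have "s \<le> 3/2 * (\<Sum>n<m. A n \<bullet> (LINT x:C n|\<mu>. P x) + b n * measure \<mu> (C n))
         - 18 * M * (measure \<mu> \<Omega> - (\<Sum>n<m. measure \<mu> (C n))) - \<eta>"
        unfolding L_def[symmetric] sum.distrib by (rule arith[OF 1 2 3 low \<eta>(2)])
      also have "ereal \<dots> \<le> F_eps f \<Omega> \<epsilon> P" using elim P by blast
      finally show "ereal s \<le> F_eps f \<Omega> \<epsilon> P" by simp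
    qed
  qed
  moreover have "openin (weak_star \<Omega>) ?U" by (rule openin_weak_star[OF \<Phi>]) (simp add: V_def)
  moreover have "Q \<in> ?U" using Q \<eta>(1) by (simp add: V_def)
  ultimately show ?thesis by blast
qed

lemma Gamma_liminf_F_eps:
  assumes Q: "Q \<in> Linf \<Omega>"
  shows "F_lim f \<Omega> Q \<le> Gamma_liminf (weak_star \<Omega>) (at_right 0) (F_eps f \<Omega>) Q"
proof (rule Gamma_liminf_ge)
  fix s assume s: "ereal s < F_lim f \<Omega> Q"
  show "\<exists>U. openin (weak_star \<Omega>) U \<and> Q \<in> U \<and> eventually (\<lambda>\<epsilon>. \<forall>y\<in>U. ereal s \<le> F_eps f \<Omega> \<epsilon> y) (at_right 0)"
  proof (cases "AE x in \<mu>. Q x \<in> K")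
    case True
    then show ?thesis using s Q by (intro liminf_bound) (auto simp: F_lim_def)
  next
    case False
    obtain U where U: "openin (weak_star \<Omega>) U" "Q \<in> U" "\<And>\<epsilon> P. P \<in> U \<Longrightarrow> F_eps f \<Omega> \<epsilon> P = \<infinity>"
      using liminf_outside_K[OF Q False] by blast
    have "eventually (\<lambda>\<epsilon>. \<forall>y\<in>U. ereal s \<le> F_eps f \<Omega> \<epsilon> y) (at_right 0)"
      by (rule always_eventually) (simp add: U(3))
    with U(1,2) show ?thesis by blast
  qed
qed

end

section \<open>The upper bound\<close>

lemma eventually_not_near:
  assumes "compact C" "compact D" "C \<inter> D = {}"
  shows "eventually (\<lambda>\<epsilon>. near \<epsilon> r C \<inter> near \<epsilon> r D = {}) (at_right 0)"
  using eventually_near_disjoint[OF assms, of 0 r]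
proof eventually_elim
  case (elim \<epsilon>)
  show ?case using elim subset_nb[of 0 "near \<epsilon> r C"] by auto
qed

section \<open>Cell-wise constant fields and their weak* limits\<close>

context domain_spin
begin

definition step_field :: "real \<Rightarrow> (site \<Rightarrow> real^3) \<Rightarrow> real^3 \<Rightarrow> real^3^3" where
  "step_field \<epsilon> u x = tensor (u (nearest (x /\<^sub>R \<epsilon>)))"

lemma step_field_measurable: "step_field \<epsilon> u \<in> borel_measurable \<mu>"
proof -
  have "step_field \<epsilon> u \<in> borel_measurable borel"
    unfolding step_field_def[abs_def] by (rule measurable_compose[OF nearest_measurable]) simp
  then show ?thesis by (intro measurable_restrict_space1 measurable_completion) simp
qed

lemma norm_step_field: "(\<And>i. u i \<in> S2) \<Longrightarrow> norm (step_field \<epsilon> u x) = 1"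
  by (simp add: step_field_def norm_tensor)

lemma step_field_Linf: assumes "\<And>i. u i \<in> S2" shows "step_field \<epsilon> u \<in> Linf \<Omega>"
proof -
  have "step_field \<epsilon> u x \<in> Msym" for x
    unfolding step_field_def by (rule subsetD[OF K_subset_Msym tensor_in_K[OF assms]])
  then show ?thesis
    unfolding Linf_def using step_field_measurable norm_step_field[OF assms, of \<epsilon>] by auto
qed

text \<open>\<open>nearest\<close> follows the half-open cells of \<open>C_eps\<close>, so the step
  field is its own representative there, and \<open>inv emb\<close> turns the spins on integer sites
  into a lift.\<close>

lemma F_eps_step_field:
  assumes e: "0 < \<epsilon>" and u: "\<And>i. u i \<in> S2"
  shows "F_eps f \<Omega> \<epsilon> (step_field \<epsilon> u) \<le> ereal (\<epsilon>^3 * energy f (sites \<epsilon> \<Omega>) u)"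
proof -
  define U where "U = (\<lambda>z. u (inv emb z))"
  have Ue: "U (emb i) = u i" for i by (simp add: U_def inv_f_f[OF inj_emb])
  have near: "nearest (emb i) = i" for i by (simp add: nearest_eq_iff)
  have at: "step_field \<epsilon> u (\<epsilon> *\<^sub>R emb i) = tensor (u i)" for i
    using e by (simp add: step_field_def near)
  have "step_field \<epsilon> u \<in> C_eps \<Omega> \<epsilon>"
    unfolding C_eps_def
  proof (intro CollectI conjI ballI impI)
    fix x show "step_field \<epsilon> u x \<in> tensor ` S2" using u by (simp add: step_field_def)
  next
    fix i x assume "i \<in> Z_eps \<Omega> \<epsilon>" "x \<in> (\<lambda>w. \<epsilon> *\<^sub>R (i + w)) ` W3"
    then obtain j w where j: "i = emb j" "w \<in> W3" "x = \<epsilon> *\<^sub>R (emb j + w)" by (auto simp: Z_eps_eq)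
    then have "nearest (x /\<^sub>R \<epsilon>) = j" using e by (simp add: nearest_eq_iff_W3)
    then show "step_field \<epsilon> u x = step_field \<epsilon> u (\<epsilon> *\<^sub>R i)"
      unfolding j(1) at by (simp add: step_field_def)
  qed
  then have "(step_field \<epsilon> u, U) \<in> spin_lifts \<Omega> \<epsilon> (step_field \<epsilon> u)"
    using u at Ue by (auto simp: spin_lifts_def Z_eps_eq)
  then have "F_eps f \<Omega> \<epsilon> (step_field \<epsilon> u) \<le> ereal (lattice_energy f \<Omega> \<epsilon> U)"
    unfolding F_eps_def by (rule INF_lower2) simp
  also have "lattice_energy f \<Omega> \<epsilon> U = \<epsilon>^3 * energy f (sites \<epsilon> \<Omega>) u"
    using lattice_energy_eq[OF finite_sites[OF e bounded_domain], of f U] by (simp add: Ue)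
  finally show ?thesis .
qed

lemma set_integral_const: "A \<in> sets \<mu> \<Longrightarrow> (LINT x:A|\<mu>. (P :: 'b::euclidean_space)) = measure \<mu> A *\<^sub>R P"
  unfolding set_lebesgue_integral_def
  by (subst integral_scaleR_left) (auto simp: integrable_indicator_mu sets_mu Int_absorb2)

text \<open>Three replacements: the integral by a lattice sum, the sum by the mean times the number
  of sites, and the rescaled number by the measure, with errors \<open>e/8\<close>,
  \<open>e/4\<close> and \<open>e/8\<close>.\<close>

lemma tendsto_step_field_compact:
  assumes D: "compact D" "D \<subseteq> \<Omega>" and v: "\<And>i. v i \<in> S2" and N: "0 < N" and p: "periodic N v"
    and u: "\<And>\<epsilon> i. u \<epsilon> i \<in> S2"
    and eq: "eventually (\<lambda>\<epsilon>. \<forall>i\<in>near \<epsilon> 2 D. u \<epsilon> i = v i) (at_right 0)"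
  shows "((\<lambda>\<epsilon>. LINT x:D|\<mu>. step_field \<epsilon> (u \<epsilon>) x) \<longlongrightarrow> (LINT x:D|\<mu>. mean N (\<lambda>i. tensor (v i)))) (at_right 0)"
proof (rule tendstoI)
  fix e :: real assume e: "0 < e"
  let ?P = "mean N (\<lambda>i. tensor (v i))"
  have Ds: "D \<in> sets \<mu>" using D by (rule compact_sets_mu)
  have mD: "measure \<mu> D = measure lebesgue D" using D(2) by (rule measure_mu)
  have nP: "norm ?P \<le> 1" using norm_mean_le[OF N, of "\<lambda>i. tensor (v i)" 1] norm_tensor[OF v] by simp
  have ev1: "eventually (\<lambda>\<epsilon>. \<epsilon>^3 * real (card (near \<epsilon> 2 D)) \<le> measure lebesgue D + e/8) (at_right 0)"
    using e by (intro card_near_le D) auto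
  have ev2: "eventually (\<lambda>\<epsilon>. \<epsilon>^3 * real (card (bd N (near \<epsilon> 2 D))) \<le> e/8) (at_right 0)"
    using e N by (intro card_bd_near D) auto
  have ev3: "eventually (\<lambda>\<epsilon>. cells \<epsilon> (near \<epsilon> 2 D) \<subseteq> \<Omega>) (at_right 0)"
    by (intro eventually_cells_near_subset D open_domain)
  show "eventually (\<lambda>\<epsilon>. dist (LINT x:D|\<mu>. step_field \<epsilon> (u \<epsilon>) x) (LINT x:D|\<mu>. ?P) < e) (at_right 0)"
    using ev1 ev2 ev3 eq eventually_pos_at_right_0
  proof eventually_elim
    case (elim \<epsilon>)
    let ?S = "near \<epsilon> 2 D"
    have fin: "finite ?S" using elim(5) D by (intro finite_near compact_imp_bounded)
    define m where "m = \<epsilon>^3 * real (card ?S)"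
    have m: "measure \<mu> D \<le> m" "m \<le> measure \<mu> D + e/8"
      using elim(1) card_near_ge[OF D(1) elim(5)] by (auto simp: m_def mD)
    have "norm ((LINT x:D|\<mu>. step_field \<epsilon> (u \<epsilon>) x) - \<epsilon>^3 *\<^sub>R (\<Sum>i\<in>?S. tensor (u \<epsilon> i))) \<le> m - measure \<mu> D"
      unfolding m_def using norm_tensor[OF u]
      by (intro set_integral_cells elim fin Ds subset_cells_near step_field_measurable) (auto simp: step_field_def)
    then have 1: "norm ((LINT x:D|\<mu>. step_field \<epsilon> (u \<epsilon>) x) - \<epsilon>^3 *\<^sub>R (\<Sum>i\<in>?S. tensor (u \<epsilon> i))) \<le> e/8"
      using m by linarith
    have s: "(\<Sum>i\<in>?S. tensor (u \<epsilon> i)) = (\<Sum>i\<in>?S. tensor (v i))"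
      using elim(4) by (intro sum.cong) auto
    have "norm ((\<Sum>i\<in>?S. tensor (v i)) - real (card ?S) *\<^sub>R ?P) \<le> 2 * 1 * real (card (bd N ?S))"
      using norm_tensor[OF v] by (intro sum_periodic N fin periodic_comp[OF p]) auto
    then have "\<epsilon>^3 * norm ((\<Sum>i\<in>?S. tensor (v i)) - real (card ?S) *\<^sub>R ?P) \<le> \<epsilon>^3 * (2 * real (card (bd N ?S)))"
      using elim(5) by (intro mult_left_mono) auto
    moreover have "\<epsilon>^3 * norm ((\<Sum>i\<in>?S. tensor (v i)) - real (card ?S) *\<^sub>R ?P)
        = norm (\<epsilon>^3 *\<^sub>R (\<Sum>i\<in>?S. tensor (v i)) - m *\<^sub>R ?P)"
    proof -
      have "\<epsilon>^3 *\<^sub>R (\<Sum>i\<in>?S. tensor (v i)) - m *\<^sub>R ?P = \<epsilon>^3 *\<^sub>R ((\<Sum>i\<in>?S. tensor (v i)) - real (card ?S) *\<^sub>R ?P)"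
        by (simp add: m_def scaleR_right_diff_distrib)
      then show ?thesis using elim(5) by simp
    qed
    ultimately have 2: "norm (\<epsilon>^3 *\<^sub>R (\<Sum>i\<in>?S. tensor (v i)) - m *\<^sub>R ?P) \<le> e/4"
      using elim(2) by simp
    have "norm (m *\<^sub>R ?P - measure \<mu> D *\<^sub>R ?P) = (m - measure \<mu> D) * norm ?P"
      using m by (simp flip: scaleR_left_diff_distrib)
    also have "\<dots> \<le> (e/8) * 1" using m nP by (intro mult_mono) auto
    finally have 3: "norm (m *\<^sub>R ?P - measure \<mu> D *\<^sub>R ?P) \<le> e/8" by simp
    have "norm ((LINT x:D|\<mu>. step_field \<epsilon> (u \<epsilon>) x) - measure \<mu> D *\<^sub>R ?P) \<le> e/8 + e/4 + e/8"
      by (rule norm_diff_triangle_le[OF norm_diff_triangle_le[OF 1[unfolded s] 2] 3])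
    then show ?case
      using e by (simp add: dist_norm set_integral_const[OF Ds])
  qed
qed

text \<open>For fields bounded by 1 the integral over \<open>E - D\<close> is at most the measure of
  this set, so inner regularity carries convergence from compact to measurable sets.\<close>

lemma tendsto_from_inner_compact:
  fixes y :: "real \<Rightarrow> real^3 \<Rightarrow> real^3^3"
  assumes E: "E \<in> sets \<mu>" and y: "\<And>\<epsilon>. y \<epsilon> \<in> borel_measurable \<mu>" "\<And>\<epsilon>. AE x in \<mu>. norm (y \<epsilon> x) \<le> 1"
    and P: "norm P \<le> 1"
    and conv: "\<And>D. compact D \<Longrightarrow> D \<subseteq> E \<Longrightarrow> ((\<lambda>\<epsilon>. LINT x:D|\<mu>. y \<epsilon> x) \<longlongrightarrow> (LINT x:D|\<mu>. P)) F"
  shows "((\<lambda>\<epsilon>. LINT x:E|\<mu>. y \<epsilon> x) \<longlongrightarrow> (LINT x:E|\<mu>. P)) F"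
proof (rule tendstoI)
  fix e :: real assume e: "0 < e"
  obtain D where D: "compact D" "D \<subseteq> E" "measure \<mu> (E - D) < e/4"
    using inner_compact[OF E, of "e/4"] e by auto
  have Ds: "D \<in> sets \<mu>" using D E by (intro compact_sets_mu) (auto simp: sets_mu)
  have R: "E - D \<in> sets \<mu>" using E Ds by auto
  have split: "norm ((LINT x:E|\<mu>. z x) - (LINT x:D|\<mu>. z x)) \<le> measure \<mu> (E - D)"
    if z: "z \<in> borel_measurable \<mu>" "AE x in \<mu>. norm (z x) \<le> 1" for z :: "real^3 \<Rightarrow> real^3^3"
  proof -
    have "(LINT x:D \<union> (E - D)|\<mu>. z x) = (LINT x:D|\<mu>. z x) + (LINT x:E - D|\<mu>. z x)"
      by (intro set_integral_Un set_integrable_bounded[OF z] Ds R) auto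
    moreover have "D \<union> (E - D) = E" using D(2) by blast
    ultimately have "(LINT x:E|\<mu>. z x) - (LINT x:D|\<mu>. z x) = (LINT x:E - D|\<mu>. z x)" by simp
    then show ?thesis using norm_set_integral_le[OF z R] by simp
  qed
  have "eventually (\<lambda>\<epsilon>. dist (LINT x:D|\<mu>. y \<epsilon> x) (LINT x:D|\<mu>. P) < e/4) F"
    using conv[OF D(1,2)] e by (intro tendstoD) auto
  then show "eventually (\<lambda>\<epsilon>. dist (LINT x:E|\<mu>. y \<epsilon> x) (LINT x:E|\<mu>. P) < e) F"
  proof eventually_elim
    case (elim \<epsilon>)
    have "dist (LINT x:E|\<mu>. y \<epsilon> x) (LINT x:D|\<mu>. y \<epsilon> x) < e/4"
      using split[OF y, of \<epsilon>] D(3) by (simp add: dist_norm)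
    moreover have "dist (LINT x:E|\<mu>. P) (LINT x:D|\<mu>. P) < e/4"
      using split[of "\<lambda>_. P"] P D(3) by (simp add: dist_norm)
    ultimately show ?case
      using elim e dist_triangle[of "LINT x:E|\<mu>. y \<epsilon> x" "LINT x:E|\<mu>. P" "LINT x:D|\<mu>. y \<epsilon> x"]
        dist_triangle2[of "LINT x:D|\<mu>. y \<epsilon> x" "LINT x:E|\<mu>. P" "LINT x:D|\<mu>. P"] by linarith
  qed
qed

text \<open>For small \<open>\<epsilon>\<close> the neighbourhoods of disjoint compact sets are disjoint, and the choice is unique.\<close>

definition mixture :: "'k set \<Rightarrow> ('k \<Rightarrow> (real^3) set) \<Rightarrow> ('k \<Rightarrow> site \<Rightarrow> real^3) \<Rightarrow> real \<Rightarrow> site \<Rightarrow> real^3" where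
  "mixture I C v \<epsilon> i = (if \<exists>k\<in>I. i \<in> near \<epsilon> 2 (C k) then v (SOME k. k \<in> I \<and> i \<in> near \<epsilon> 2 (C k)) i else axis 1 1)"

text \<open>Near a piece the mixture is eventually a single periodic configuration; near a compact
  set off the pieces it is eventually the constant spin \<open>axis 1 1\<close>, of period 1. Both
  cases reduce to \<open>tendsto_step_field_compact\<close>, and \<open>R\<close> collects the
  limits.\<close>

lemma recovery:
  assumes I: "finite I" and C: "\<And>k. k \<in> I \<Longrightarrow> compact (C k)" "\<And>k. k \<in> I \<Longrightarrow> C k \<subseteq> \<Omega>"
    and dis: "\<And>k l. k \<in> I \<Longrightarrow> l \<in> I \<Longrightarrow> k \<noteq> l \<Longrightarrow> C k \<inter> C l = {}"
    and v: "\<And>k i. v k i \<in> S2" and N: "\<And>k. 0 < N k" and p: "\<And>k. periodic (N k) (v k)"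
    and R: "R \<in> borel_measurable \<mu>" "\<And>k x. k \<in> I \<Longrightarrow> x \<in> C k \<Longrightarrow> R x = mean (N k) (\<lambda>i. tensor (v k i))"
      "\<And>x. (\<And>k. k \<in> I \<Longrightarrow> x \<notin> C k) \<Longrightarrow> R x = tensor (axis 1 1)"
    and \<Phi>: "integrable \<mu> \<Phi>"
  shows "((\<lambda>\<epsilon>. LINT x|\<mu>. step_field \<epsilon> (mixture I C v \<epsilon>) x \<bullet> \<Phi> x) \<longlongrightarrow> (LINT x|\<mu>. R x \<bullet> \<Phi> x)) (at_right 0)"
proof -
  define e1 :: "real^3" where "e1 = axis 1 1"
  have e1: "e1 \<in> S2" by (simp add: S2_def e1_def)
  let ?u = "mixture I C v"
  let ?P = "\<lambda>k. mean (N k) (\<lambda>i. tensor (v k i))"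
  have u: "?u \<epsilon> i \<in> S2" for \<epsilon> i using v e1 by (simp add: mixture_def e1_def)
  have nP: "norm (?P k) \<le> 1" for k using norm_mean_le[OF N[of k], of "\<lambda>i. tensor (v k i)" 1] norm_tensor[OF v] by simp
  have Rb: "norm (R x) \<le> 1" for x
    using R(2,3) nP norm_tensor[OF e1] by (cases "\<exists>k\<in>I. x \<in> C k") (force simp: e1_def)+
  have yb: "AE x in \<mu>. norm (step_field \<epsilon> (?u \<epsilon>) x) \<le> 1" for \<epsilon>
    using norm_step_field[of "?u \<epsilon>"] u by simp
  have Cs: "C k \<in> sets \<mu>" if "k \<in> I" for k using C that by (intro compact_sets_mu) auto
  have ev: "eventually (\<lambda>\<epsilon>. \<forall>k\<in>I. \<forall>l\<in>I. k \<noteq> l \<longrightarrow> near \<epsilon> 2 (C k) \<inter> near \<epsilon> 2 (C l) = {}) (at_right 0)"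
  proof -
    have "eventually (\<lambda>\<epsilon>. \<forall>k\<in>I. \<forall>l\<in>I. k \<noteq> l \<longrightarrow> nb 0 (near \<epsilon> 2 (C k)) \<inter> near \<epsilon> 2 (C l) = {}) (at_right 0)"
      by (rule eventually_pieces_separated[OF I C(1) dis])
    then show ?thesis
    proof eventually_elim
      case (elim \<epsilon>)
      show ?case
      proof (intro ballI impI)
        fix k l assume kl: "k \<in> I" "l \<in> I" "k \<noteq> l"
        then have "nb 0 (near \<epsilon> 2 (C k)) \<inter> near \<epsilon> 2 (C l) = {}" using elim by metis
        then show "near \<epsilon> 2 (C k) \<inter> near \<epsilon> 2 (C l) = {}" using subset_nb[of 0 "near \<epsilon> 2 (C k)"] by auto
      qed
    qed
  qed
  have on: "((\<lambda>\<epsilon>. LINT x:E|\<mu>. step_field \<epsilon> (?u \<epsilon>) x) \<longlongrightarrow> (LINT x:E|\<mu>. ?P k)) (at_right 0)"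
    if k: "k \<in> I" and E: "E \<in> sets \<mu>" "E \<subseteq> C k" for k E
  proof (rule tendsto_from_inner_compact[OF E(1) step_field_measurable yb nP])
    fix D assume D: "compact D" "D \<subseteq> E"
    show "((\<lambda>\<epsilon>. LINT x:D|\<mu>. step_field \<epsilon> (?u \<epsilon>) x) \<longlongrightarrow> (LINT x:D|\<mu>. ?P k)) (at_right 0)"
    proof (rule tendsto_step_field_compact[OF D(1) _ v N p u])
      show "D \<subseteq> \<Omega>" using D(2) E(2) C(2)[OF k] by blast
      show "eventually (\<lambda>\<epsilon>. \<forall>i\<in>near \<epsilon> 2 D. ?u \<epsilon> i = v k i) (at_right 0)"
        using ev
      proof eventually_elim
        case (elim \<epsilon>)
        show ?case
        proof
          fix i assume "i \<in> near \<epsilon> 2 D"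
          then have i: "i \<in> near \<epsilon> 2 (C k)" using D(2) E(2) by (auto simp: near_def)
          then have "(SOME l. l \<in> I \<and> i \<in> near \<epsilon> 2 (C l)) = k"
            using elim k by (intro some_equality) blast+
          then show "?u \<epsilon> i = v k i" using i k by (auto simp: mixture_def)
        qed
      qed
    qed
  qed
  have off: "((\<lambda>\<epsilon>. LINT x:E|\<mu>. step_field \<epsilon> (?u \<epsilon>) x) \<longlongrightarrow> (LINT x:E|\<mu>. tensor e1)) (at_right 0)"
    if E: "E \<in> sets \<mu>" "\<And>k. k \<in> I \<Longrightarrow> E \<inter> C k = {}" for E
  proof (rule tendsto_from_inner_compact[OF E(1) step_field_measurable yb])
    show "norm (tensor e1) \<le> 1" using norm_tensor[OF e1] by simp
    fix D assume D: "compact D" "D \<subseteq> E"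
    have m1: "mean 1 (\<lambda>i. tensor e1) = tensor e1" by (simp add: mean_def cell0_def)
    have "eventually (\<lambda>\<epsilon>. \<forall>k\<in>I. near \<epsilon> 2 D \<inter> near \<epsilon> 2 (C k) = {}) (at_right 0)"
      using I C(1) D E(2) by (intro eventually_ball_finite ballI eventually_not_near) blast+
    then have "eventually (\<lambda>\<epsilon>. \<forall>i\<in>near \<epsilon> 2 D. ?u \<epsilon> i = e1) (at_right 0)"
      by eventually_elim (auto simp: mixture_def e1_def)
    moreover have "D \<subseteq> \<Omega>" using D(2) E(1) by (auto simp: sets_mu)
    ultimately show "((\<lambda>\<epsilon>. LINT x:D|\<mu>. step_field \<epsilon> (?u \<epsilon>) x) \<longlongrightarrow> (LINT x:D|\<mu>. tensor e1)) (at_right 0)"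
      using tendsto_step_field_compact[OF D(1) _ e1 _ _ u, of 1] by (simp add: m1 periodic_def)
  qed
  have conv: "((\<lambda>\<epsilon>. LINT x:E|\<mu>. step_field \<epsilon> (?u \<epsilon>) x) \<longlongrightarrow> (LINT x:E|\<mu>. R x)) (at_right 0)"
    if E: "E \<in> sets \<mu>" for E
  proof -
    let ?U = "\<Union>k\<in>I. C k"
    have Us: "E - ?U \<in> sets \<mu>" "\<And>k. k \<in> I \<Longrightarrow> E \<inter> C k \<in> sets \<mu>" "(\<Union>k\<in>I. E \<inter> C k) \<in> sets \<mu>"
      using E Cs I by auto
    have split: "(LINT x:E|\<mu>. z x) = (\<Sum>k\<in>I. LINT x:E \<inter> C k|\<mu>. z x) + (LINT x:E - ?U|\<mu>. z x)"
      if z: "z \<in> borel_measurable \<mu>" "AE x in \<mu>. norm (z x) \<le> 1" for z :: "real^3 \<Rightarrow> real^3^3"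
    proof -
      have "(LINT x:(\<Union>k\<in>I. E \<inter> C k) \<union> (E - ?U)|\<mu>. z x) = (LINT x:(\<Union>k\<in>I. E \<inter> C k)|\<mu>. z x) + (LINT x:E - ?U|\<mu>. z x)"
        by (intro set_integral_Un set_integrable_bounded[OF z] Us) auto
      moreover have "(\<Union>k\<in>I. E \<inter> C k) \<union> (E - ?U) = E" by blast
      moreover have "(LINT x:(\<Union>k\<in>I. E \<inter> C k)|\<mu>. z x) = (\<Sum>k\<in>I. LINT x:E \<inter> C k|\<mu>. z x)"
      proof (intro set_integral_finite_UN_AE I set_integrable_bounded[OF z] Us)
        fix k l assume kl: "k \<in> I" "l \<in> I"
        show "AE x in \<mu>. (x \<in> E \<inter> C k \<and> x \<in> E \<inter> C l) \<longrightarrow> k = l"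
          using dis[OF kl] by (intro AE_I2) blast
      qed
      ultimately show ?thesis by simp
    qed
    have R1: "(LINT x:E \<inter> C k|\<mu>. R x) = (LINT x:E \<inter> C k|\<mu>. ?P k)" if "k \<in> I" for k
      using R(2)[OF that] by (intro set_lebesgue_integral_cong Us that) auto
    have R2: "(LINT x:E - ?U|\<mu>. R x) = (LINT x:E - ?U|\<mu>. tensor e1)"
      using R(3) by (intro set_lebesgue_integral_cong Us) (auto simp: e1_def)
    show ?thesis
      unfolding split[OF step_field_measurable yb] split[OF R(1) AE_I2[OF Rb]] R2
      using R1 Us by (intro tendsto_intros off) (auto simp: R1 intro!: on)
  qed
  show ?thesis
    by (rule tendsto_integral_inner[OF step_field_measurable yb R(1) AE_I2[OF Rb] _ conv \<Phi>]) simp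
qed

end

text \<open>The collar of width 1 pays for the regrouping into squares, the one of width
  \<open>N\<close> for incomplete period cells; the latter error \<open>2 * (18 * M)\<close> is
  halved together with the square energies.\<close>

lemma (in spin) energy_periodic_le:
  assumes S: "finite S" and v: "\<And>i. v i \<in> S2" and N: "0 < N" and p: "periodic N v"
  shows "energy f S v \<le> 1/2 * (real (card S) * mean N (square_energy f v))
     + 18 * M * (real (card (bd 1 S)) + real (card (bd N S)))"
proof -
  have "norm ((\<Sum>i\<in>S. square_energy f v i) - real (card S) *\<^sub>R mean N (square_energy f v)) \<le> 2 * (18 * M) * real (card (bd N S))"
    using abs_square_energy_le[OF v] by (intro sum_periodic N periodic_square_energy p S) simp
  then have 1: "(\<Sum>i\<in>S. square_energy f v i) \<le> real (card S) * mean N (square_energy f v) + 2 * (18 * M) * real (card (bd N S))"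
    by (simp add: abs_le_iff)
  have 2: "energy f S v \<le> 1/2 * (\<Sum>i\<in>S. square_energy f v i) + 18 * M * real (card (bd 1 S))"
    using energy_square_energy[where u=v, OF S v] by (simp add: abs_le_iff)
  have "E \<le> 1/2 * q + 18 * M * (x + y)"
    if "s \<le> q + 2 * (18 * M) * y" "E \<le> 1/2 * s + 18 * M * x" for E s q x y :: real
    using that by (simp add: distrib_left)
  from this[OF 1 2] show ?thesis .
qed

lemma (in spin) abs_mean_square_energy_le:
  assumes "\<And>i. v i \<in> S2" "0 < N" shows "\<bar>mean N (square_energy f v)\<bar> \<le> 18 * M"
  using norm_mean_le[OF assms(2), of "square_energy f v" "18 * M"] abs_square_energy_le[OF assms(1)] by simp

context domain_spin
begin

text \<open>One configuration must serve all values of \<open>Q\<close> on a piece. Around each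
  \<open>P\<close> in \<open>K\<close> lower semicontinuity gives a ball on which the envelope is at
  least its value at \<open>P\<close> minus \<eta>, so a configuration nearly optimal at the centre
  is nearly optimal for every value in the ball. The ball and the configuration contribute one
  \<eta> each.\<close>

lemma periodic_pieces:
  assumes Q: "Q \<in> Linf \<Omega>" and K: "AE x in \<mu>. Q x \<in> K" and \<eta>: "0 < \<eta>"
  shows "\<exists>(m::nat) C N v. (\<forall>n<m. compact (C n) \<and> C n \<subseteq> \<Omega>) \<and> (\<forall>k<m. \<forall>l<m. k \<noteq> l \<longrightarrow> C k \<inter> C l = {}) \<and>
     measure \<mu> \<Omega> - \<eta> < (\<Sum>n<m. measure \<mu> (C n)) \<and> (\<forall>n. 0 < N n \<and> periodic (N n) (v n) \<and> (\<forall>i. v n i \<in> S2)) \<and>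
     (\<forall>n<m. \<forall>x\<in>C n. Q x \<in> K \<and> norm (mean (N n) (\<lambda>i. tensor (v n i)) - Q x) \<le> 2 * \<eta> \<and>
        mean (N n) (square_energy f (v n)) \<le> 3 * (real_envelope (Q x) + 2 * \<eta>))"
proof -
  have "\<exists>e>0. \<forall>Y\<in>Msym. dist Y P < e \<longrightarrow> ereal (real_envelope P - \<eta>) < envelope f Y" if P: "P \<in> K" for P
  proof (rule lsc_onD[OF lsc_envelope])
    show "P \<in> Msym" using P K_subset_Msym by blast
    show "ereal (real_envelope P - \<eta>) < envelope f P" using \<eta> by (subst (2) envelope_real[OF P]) simp
  qed
  then have "\<forall>P\<in>K. \<exists>e. e > 0 \<and> (\<forall>Y\<in>Msym. dist Y P < e \<longrightarrow> ereal (real_envelope P - \<eta>) < envelope f Y)" by blast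
  from bchoice[OF this] obtain r where
    r: "\<And>P. P \<in> K \<Longrightarrow> 0 < r P" "\<And>P Y. P \<in> K \<Longrightarrow> Y \<in> Msym \<Longrightarrow> dist Y P < r P \<Longrightarrow> ereal (real_envelope P - \<eta>) < envelope f Y"
    by (auto simp only: Ball_def)
  \<comment> \<open>\<open>r P\<close> controls the envelope, while the bound \<eta> on the radius
    keeps the mean tensor close to the values of \<open>Q\<close>.\<close>
  define U where "U P = ball P (min (r P) \<eta>)" for P
  obtain e :: "nat \<Rightarrow> _" where e: "range e \<subseteq> K" "(\<Union>n. U (e n)) = (\<Union>P\<in>K. U P)"
    using Lindelof_enum[of K U] K_nonempty by (auto simp: U_def)
  have eK: "e n \<in> K" for n using e(1) by blast
  have "\<forall>n. \<exists>Nv. 0 < fst Nv \<and> (\<forall>i. snd Nv i \<in> S2) \<and> periodic (fst Nv) (snd Nv) \<and>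
     norm (mean (fst Nv) (\<lambda>i. tensor (snd Nv i)) - e n) \<le> \<eta> \<and>
     mean (fst Nv) (square_energy f (snd Nv)) \<le> 3 * (real_envelope (e n) + \<eta>)"
    using envelope_periodic[OF eK \<eta>] by auto
  from choice[OF this] obtain Nv where Nv: "\<forall>n. 0 < fst (Nv n) \<and> (\<forall>i. snd (Nv n) i \<in> S2) \<and> periodic (fst (Nv n)) (snd (Nv n)) \<and>
     norm (mean (fst (Nv n)) (\<lambda>i. tensor (snd (Nv n) i)) - e n) \<le> \<eta> \<and>
     mean (fst (Nv n)) (square_energy f (snd (Nv n))) \<le> 3 * (real_envelope (e n) + \<eta>)"
    by (rule exE)
  define N where "N n = fst (Nv n)" for n
  define v where "v n = snd (Nv n)" for n
  have Nv': "0 < N n" "\<forall>i. v n i \<in> S2" "periodic (N n) (v n)" "norm (mean (N n) (\<lambda>i. tensor (v n i)) - e n) \<le> \<eta>"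
     "mean (N n) (square_energy f (v n)) \<le> 3 * (real_envelope (e n) + \<eta>)" for n
    using Nv by (simp_all add: N_def v_def)
  have Qm: "Q \<in> borel_measurable \<mu>" by (rule LinfD(1)[OF Q])
  define E where "E n = {x \<in> space \<mu>. Q x \<in> K \<inter> U (e n)}" for n
  have E: "E n \<in> sets \<mu>" for n
  proof -
    have "K \<inter> U (e n) \<in> sets borel" using closed_K by (auto simp: U_def)
    then have "Q -` (K \<inter> U (e n)) \<inter> space \<mu> \<in> sets \<mu>" by (rule measurable_sets[OF Qm])
    moreover have "E n = Q -` (K \<inter> U (e n)) \<inter> space \<mu>" by (auto simp: E_def)
    ultimately show ?thesis by simp
  qed
  have cover: "AE x in \<mu>. \<exists>n. x \<in> E n"
    using K AE_space
  proof eventually_elim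
    case (elim x)
    have "Q x \<in> U (Q x)" using r(1)[OF elim(1)] \<eta> by (simp add: U_def)
    then have "Q x \<in> (\<Union>n. U (e n))" unfolding e(2) using elim(1) by blast
    then show ?case using elim by (auto simp: E_def)
  qed
  obtain m C where C: "\<forall>n<m. compact (C n) \<and> C n \<subseteq> E n" "\<forall>k<m. \<forall>l<m. k \<noteq> l \<longrightarrow> C k \<inter> C l = {}"
     and mC: "measure \<mu> \<Omega> - \<eta> < (\<Sum>n<m. measure \<mu> (C n))"
    using compact_pieces[OF E cover \<eta>] by metis
  have "Q x \<in> K \<and> norm (mean (N n) (\<lambda>i. tensor (v n i)) - Q x) \<le> 2 * \<eta> \<and>
        mean (N n) (square_energy f (v n)) \<le> 3 * (real_envelope (Q x) + 2 * \<eta>)" if n: "n < m" and x: "x \<in> C n" for n x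
  proof -
    have xE: "Q x \<in> K" "Q x \<in> U (e n)" using C(1) n x by (auto simp: E_def)
    then have d: "dist (Q x) (e n) < r (e n)" "dist (Q x) (e n) < \<eta>" by (auto simp: U_def dist_commute)
    have "norm (mean (N n) (\<lambda>i. tensor (v n i)) - Q x) \<le> \<eta> + \<eta>"
      using norm_diff_triangle_le[OF Nv'(4)[of n], of "Q x" \<eta>] d(2) by (simp add: dist_norm norm_minus_commute)
    moreover have "ereal (real_envelope (e n) - \<eta>) < envelope f (Q x)"
      using r(2)[OF eK _ d(1)] xE(1) K_subset_Msym by blast
    then have "real_envelope (e n) - \<eta> < real_envelope (Q x)" by (subst (asm) envelope_real[OF xE(1)]) simp
    ultimately show ?thesis using xE(1) Nv'(5)[of n] by simp
  qed
  moreover have "\<forall>n<m. compact (C n) \<and> C n \<subseteq> \<Omega>" using C(1) by (auto simp: E_def)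
  ultimately show ?thesis
    using C(2) mC Nv' by (intro exI[of _ m] exI[of _ C] exI[of _ N] exI[of _ v]) blast
qed

text \<open>Once the pieces are separated, the mixture is on each of them the configuration of that
  piece, which pays its mean cost per site; every remaining site costs at most
  \<open>18 * M\<close>.\<close>

lemma mixture_energy:
  assumes I: "finite I" and C: "\<And>k. k \<in> I \<Longrightarrow> compact (C k)" "\<And>k. k \<in> I \<Longrightarrow> C k \<subseteq> \<Omega>"
    and dis: "\<And>k l. k \<in> I \<Longrightarrow> l \<in> I \<Longrightarrow> k \<noteq> l \<Longrightarrow> C k \<inter> C l = {}"
    and v: "\<And>k i. v k i \<in> S2" and N: "\<And>k. 0 < N k" and p: "\<And>k. periodic (N k) (v k)" and \<delta>: "0 < \<delta>"
  shows "eventually (\<lambda>\<epsilon>. \<epsilon>^3 * energy f (sites \<epsilon> \<Omega>) (mixture I C v \<epsilon>) \<le>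
     (\<Sum>k\<in>I. 1/2 * (measure \<mu> (C k) * mean (N k) (square_energy f (v k))))
     + 18 * M * (measure \<mu> \<Omega> - (\<Sum>k\<in>I. measure \<mu> (C k))) + \<delta>) (at_right 0)"
proof -
  \<comment> \<open>Per piece, \<open>9 * M\<close> comes from replacing the count by the measure
    and \<open>36 * M\<close> from the two collars; the leading \<open>18 * M\<close> from the count
    of the sites outside the pieces.\<close>
  define B where "B = 18 * M + real (card I) * (45 * M)"
  have B0: "0 \<le> B" using M_nonneg by (simp add: B_def)
  define e where "e = \<delta> / (B + 1)"
  have e: "0 < e" "B * e \<le> \<delta>" using \<delta> B0 by (auto simp: e_def divide_simps mult_left_mono)
  let ?S = "\<lambda>\<epsilon> k. near \<epsilon> 2 (C k)" and ?u = "mixture I C v" and ?q = "\<lambda>k. mean (N k) (square_energy f (v k))"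
  have ev1: "eventually (\<lambda>\<epsilon>. \<forall>k\<in>I. \<forall>l\<in>I. k \<noteq> l \<longrightarrow> nb 1 (?S \<epsilon> k) \<inter> ?S \<epsilon> l = {}) (at_right 0)"
    by (rule eventually_pieces_separated[OF I C(1) dis])
  have ev2: "eventually (\<lambda>\<epsilon>. \<forall>k\<in>I. ?S \<epsilon> k \<subseteq> sites \<epsilon> \<Omega>) (at_right 0)"
    using I C open_domain by (intro eventually_ball_finite ballI near_subset_sites) auto
  have ev3: "eventually (\<lambda>\<epsilon>. \<forall>k\<in>I. \<epsilon>^3 * real (card (bd 1 (?S \<epsilon> k))) \<le> e) (at_right 0)"
    using I C e by (intro eventually_ball_finite ballI card_bd_near) auto
  have ev4: "eventually (\<lambda>\<epsilon>. \<forall>k\<in>I. \<epsilon>^3 * real (card (bd (N k) (?S \<epsilon> k))) \<le> e) (at_right 0)"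
    using I C e N by (intro eventually_ball_finite ballI card_bd_near) (auto intro: less_imp_le)
  have ev5: "eventually (\<lambda>\<epsilon>. \<forall>k\<in>I. \<epsilon>^3 * real (card (?S \<epsilon> k)) \<le> measure lebesgue (C k) + e) (at_right 0)"
    using I C e by (intro eventually_ball_finite ballI card_near_le) auto
  have ev6: "eventually (\<lambda>\<epsilon>. \<bar>\<epsilon>^3 * real (card (sites \<epsilon> \<Omega>)) - measure lebesgue \<Omega>\<bar> \<le> e) (at_right 0)"
    using e by (intro card_sites bounded_domain negligible_frontier lmeasurable_domain)
  show ?thesis
    using ev1 ev2 ev3 ev4 ev5 ev6 eventually_pos_at_right_0
  proof eventually_elim
    case (elim \<epsilon>)
    have pos: "0 \<le> \<epsilon>^3" using elim by simp
    have fin: "finite (sites \<epsilon> \<Omega>)" using elim bounded_domain by (intro finite_sites) auto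
    have finS: "finite (?S \<epsilon> k)" if "k \<in> I" for k using elim(2) that fin finite_subset by blast
    have u: "?u \<epsilon> i \<in> S2" for i using v by (simp add: mixture_def S2_def)
    have mC: "measure \<mu> (C k) = measure lebesgue (C k)" if "k \<in> I" for k using C(2)[OF that] by (rule measure_mu)
    have piece: "\<epsilon>^3 * energy f (?S \<epsilon> k) (?u \<epsilon>) \<le> 1/2 * (measure \<mu> (C k) * ?q k) + 45 * M * e" if k: "k \<in> I" for k
    proof -
      have "?u \<epsilon> i = v k i" if i: "i \<in> ?S \<epsilon> k" for i
      proof -
        have uniq: "l = k" if l: "l \<in> I \<and> i \<in> ?S \<epsilon> l" for l
        proof (rule ccontr)
          assume "l \<noteq> k"
          then have "nb 1 (?S \<epsilon> k) \<inter> ?S \<epsilon> l = {}" using elim(1) k l by metis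
          then show False using subset_nb[of 1 "?S \<epsilon> k"] i l by auto
        qed
        have "(SOME l. l \<in> I \<and> i \<in> ?S \<epsilon> l) = k"
          by (rule some_equality, rule conjI[OF k i], rule uniq)
        then show ?thesis using i k unfolding mixture_def by (subst if_P) auto
      qed
      then have "energy f (?S \<epsilon> k) (?u \<epsilon>) = energy f (?S \<epsilon> k) (v k)" by (intro energy_cong) auto
      also have "\<dots> \<le> 1/2 * (real (card (?S \<epsilon> k)) * ?q k) + 18 * M * (real (card (bd 1 (?S \<epsilon> k))) + real (card (bd (N k) (?S \<epsilon> k))))"
        by (intro energy_periodic_le finS k v N p)
      finally have "\<epsilon>^3 * energy f (?S \<epsilon> k) (?u \<epsilon>) \<le> \<epsilon>^3 * (1/2 * (real (card (?S \<epsilon> k)) * ?q k)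
          + 18 * M * (real (card (bd 1 (?S \<epsilon> k))) + real (card (bd (N k) (?S \<epsilon> k)))))"
        using pos by (rule mult_left_mono)
      also have "\<dots> = 1/2 * ((\<epsilon>^3 * real (card (?S \<epsilon> k))) * ?q k)
          + 18 * M * (\<epsilon>^3 * real (card (bd 1 (?S \<epsilon> k))) + \<epsilon>^3 * real (card (bd (N k) (?S \<epsilon> k))))"
        by (simp add: algebra_simps)
      also have "\<dots> \<le> 1/2 * (measure \<mu> (C k) * ?q k + 18 * M * e) + 18 * M * (e + e)"
      proof (intro add_mono mult_left_mono)
        have "\<bar>(\<epsilon>^3 * real (card (?S \<epsilon> k)) - measure \<mu> (C k)) * ?q k\<bar> \<le> e * (18 * M)"
          unfolding abs_mult
          using card_near_ge[OF C(1)[OF k] elim(7)] elim(5) k abs_mean_square_energy_le[of "v k" "N k", OF v N] mC[OF k] e(1)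
          by (intro mult_mono) auto
        then show "(\<epsilon>^3 * real (card (?S \<epsilon> k))) * ?q k \<le> measure \<mu> (C k) * ?q k + 18 * M * e"
          by (simp add: abs_le_iff algebra_simps)
      qed (use elim(3,4) k M_nonneg in auto)
      finally show ?thesis by (simp add: algebra_simps)
    qed
    let ?n = "\<epsilon>^3 * real (card (sites \<epsilon> \<Omega>)) - (\<Sum>k\<in>I. \<epsilon>^3 * real (card (?S \<epsilon> k)))"
    have "\<bar>energy f (sites \<epsilon> \<Omega>) (?u \<epsilon>) - (\<Sum>k\<in>I. energy f (?S \<epsilon> k) (?u \<epsilon>))\<bar>
        \<le> 18 * M * (real (card (sites \<epsilon> \<Omega>)) - (\<Sum>k\<in>I. real (card (?S \<epsilon> k))))"
      using elim(1,2) by (intro energy_separated_ge fin I u) auto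
    then have "energy f (sites \<epsilon> \<Omega>) (?u \<epsilon>) \<le> (\<Sum>k\<in>I. energy f (?S \<epsilon> k) (?u \<epsilon>))
        + 18 * M * (real (card (sites \<epsilon> \<Omega>)) - (\<Sum>k\<in>I. real (card (?S \<epsilon> k))))" by linarith
    from mult_left_mono[OF this pos]
    have 1: "\<epsilon>^3 * energy f (sites \<epsilon> \<Omega>) (?u \<epsilon>) \<le> (\<Sum>k\<in>I. \<epsilon>^3 * energy f (?S \<epsilon> k) (?u \<epsilon>)) + 18 * M * ?n"
      by (simp add: sum_distrib_left distrib_left right_diff_distrib mult.assoc mult.left_commute)
    have "?n \<le> measure \<mu> \<Omega> - (\<Sum>k\<in>I. measure \<mu> (C k)) + e"
    proof -
      have "(\<Sum>k\<in>I. measure \<mu> (C k)) \<le> (\<Sum>k\<in>I. \<epsilon>^3 * real (card (?S \<epsilon> k)))"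
        using card_near_ge[OF C(1) elim(7)] mC by (intro sum_mono) simp
      then show ?thesis using elim(6) measure_mu[of \<Omega>] by (simp add: abs_le_iff)
    qed
    then have 2: "18 * M * ?n \<le> 18 * M * (measure \<mu> \<Omega> - (\<Sum>k\<in>I. measure \<mu> (C k)) + e)"
      using M_nonneg by (intro mult_left_mono) auto
    have 3: "(\<Sum>k\<in>I. \<epsilon>^3 * energy f (?S \<epsilon> k) (?u \<epsilon>)) \<le> (\<Sum>k\<in>I. 1/2 * (measure \<mu> (C k) * ?q k) + 45 * M * e)"
      by (intro sum_mono piece)
    have 4: "(\<Sum>k\<in>I. 1/2 * (measure \<mu> (C k) * ?q k) + 45 * M * e) = (\<Sum>k\<in>I. 1/2 * (measure \<mu> (C k) * ?q k)) + real (card I) * (45 * M) * e"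
      by (simp add: sum.distrib)
    have 5: "B * e = 18 * M * e + real (card I) * (45 * M) * e" by (simp add: B_def distrib_right)
    show ?case
      using 1 2 3 e(2) unfolding 4 5 distrib_left[of "18 * M" _ e] by linarith
  qed
qed

text \<open>\<open>R j\<close> has the mean tensors of periodic configurations as its values on the
  pieces and \<open>tensor e1\<close> elsewhere. The index \<open>j\<close> is fixed so that
  \<open>R j\<close> lies in \<open>U\<close> and its cost is below \<open>s\<close>; only then is
  \<epsilon> sent to 0.\<close>

lemma limsup_bound:
  assumes Q: "Q \<in> Linf \<Omega>" and K: "AE x in \<mu>. Q x \<in> K" and s: "3/2 * (LINT x|\<mu>. real_envelope (Q x)) < s"
    and U: "openin (weak_star \<Omega>) U" "Q \<in> U"
  shows "eventually (\<lambda>\<epsilon>. \<exists>P\<in>U. F_eps f \<Omega> \<epsilon> P \<le> ereal s) (at_right 0)"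
proof -
  interpret finite_measure \<mu> by (rule finite_measure_mu)
  define L where "L = measure \<mu> \<Omega>"
  have L0: "0 \<le> L" by (simp add: L_def)
  define \<eta> where "\<eta> j = inverse (real (Suc j))" for j
  have \<eta>: "0 < \<eta> j" for j by (simp add: \<eta>_def)
  have \<eta>0: "\<eta> \<longlonglongrightarrow> 0" unfolding \<eta>_def[abs_def] by (rule LIMSEQ_inverse_real_of_nat)
  have Qm: "Q \<in> borel_measurable \<mu>" by (rule LinfD(1)[OF Q])
  have gm: "(\<lambda>x. real_envelope (Q x)) \<in> borel_measurable \<mu>" by (rule g_measurable[OF Qm])
  define e1 :: "real^3" where "e1 = axis 1 1"
  have e1: "e1 \<in> S2" by (simp add: S2_def e1_def)
  \<comment> \<open>All data for one \<open>j\<close> form a single tuple, so that one application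
    of choice provides them for all \<open>j\<close>.\<close>
  define good where "good j = (\<lambda>(m::nat, C, N, v). (\<forall>n<m. compact (C n) \<and> C n \<subseteq> \<Omega>) \<and> (\<forall>k<m. \<forall>l<m. k \<noteq> l \<longrightarrow> C k \<inter> C l = {}) \<and>
     L - \<eta> j < (\<Sum>n<m. measure \<mu> (C n)) \<and> (\<forall>n. 0 < N n \<and> periodic (N n) (v n) \<and> (\<forall>i. v n i \<in> S2)) \<and>
     (\<forall>n<m. \<forall>x\<in>C n. Q x \<in> K \<and> norm (mean (N n) (\<lambda>i. tensor (v n i)) - Q x) \<le> 2 * \<eta> j \<and>
        mean (N n) (square_energy f (v n)) \<le> 3 * (real_envelope (Q x) + 2 * \<eta> j)))" for j
  have "\<forall>j. \<exists>z. good j z"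
  proof
    fix j
    from periodic_pieces[OF Q K \<eta>[of j]] show "\<exists>z. good j z"
      unfolding L_def good_def split_paired_Ex case_prod_conv .
  qed
  from choice[OF this] obtain z where z: "\<forall>j. good j (z j)" by (rule exE)
  define m where "m j = fst (z j)" for j
  define C where "C j = fst (snd (z j))" for j
  define N where "N j = fst (snd (snd (z j)))" for j
  define v where "v j = snd (snd (snd (z j)))" for j
  have zj: "good j (m j, C j, N j, v j)" for j using z by (simp add: m_def C_def N_def v_def)
  have C: "\<And>j n. n < m j \<Longrightarrow> compact (C j n)" "\<And>j n. n < m j \<Longrightarrow> C j n \<subseteq> \<Omega>"
     "\<And>j k l. k < m j \<Longrightarrow> l < m j \<Longrightarrow> k \<noteq> l \<Longrightarrow> C j k \<inter> C j l = {}"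
     "\<And>j. L - \<eta> j < (\<Sum>n<m j. measure \<mu> (C j n))"
     "\<And>j n. 0 < N j n" "\<And>j n. periodic (N j n) (v j n)" "\<And>j n i. v j n i \<in> S2"
     using zj unfolding good_def case_prod_conv by blast+
  have CQ: "\<And>j n x. n < m j \<Longrightarrow> x \<in> C j n \<Longrightarrow> Q x \<in> K"
     "\<And>j n x. n < m j \<Longrightarrow> x \<in> C j n \<Longrightarrow> norm (mean (N j n) (\<lambda>i. tensor (v j n i)) - Q x) \<le> 2 * \<eta> j"
     "\<And>j n x. n < m j \<Longrightarrow> x \<in> C j n \<Longrightarrow> mean (N j n) (square_energy f (v j n)) \<le> 3 * (real_envelope (Q x) + 2 * \<eta> j)"
     using zj unfolding good_def case_prod_conv by blast+
  have Cs: "C j n \<in> sets \<mu>" if "n < m j" for j n using C(1,2)[OF that] by (rule compact_sets_mu)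
  define P where "P j n = mean (N j n) (\<lambda>i. tensor (v j n i))" for j n
  define R where "R j x = tensor e1 + (\<Sum>n<m j. indicator (C j n) x *\<^sub>R (P j n - tensor e1))" for j x
  have RC: "R j x = P j n" if n: "n < m j" "x \<in> C j n" for j n x
  proof -
    have "(\<Sum>k<m j. indicator (C j k) x *\<^sub>R (P j k - tensor e1)) = (\<Sum>k<m j. if k = n then P j n - tensor e1 else 0)"
      using C(3)[OF _ n(1)] n(2) by (intro sum.cong refl) (auto simp: indicator_def)
    then show ?thesis using n(1) by (simp add: R_def)
  qed
  have R0: "R j x = tensor e1" if "\<And>n. n < m j \<Longrightarrow> x \<notin> C j n" for j x
    using that by (simp add: R_def indicator_def)
  have Rm: "R j \<in> borel_measurable \<mu>" for j
    unfolding R_def[abs_def] using Cs by (intro borel_measurable_add borel_measurable_const borel_measurable_sum borel_measurable_scaleR borel_measurable_indicator) auto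
  have nP: "norm (P j n) \<le> 1" for j n
    using norm_mean_le[OF C(5)[of j n], of "\<lambda>i. tensor (v j n i)" 1] norm_tensor[OF C(7)] by (simp add: P_def)
  have Rb: "norm (R j x) \<le> 1" for j x
    using RC[of _ j x] R0[of j x] nP norm_tensor[OF e1] by (cases "\<exists>n<m j. x \<in> C j n") force+
  have PM: "P j n \<in> Msym" for j n
  proof -
    have tr: "transpose (tensor w) = tensor w" for w by (simp add: transpose_def tensor_def mult.commute)
    have "transpose (P j n) = (1 / real_of_int ((N j n)^3)) *\<^sub>R (\<Sum>i\<in>cell0 (N j n). transpose (tensor (v j n i)))"
      by (simp add: P_def mean_def transpose_def vec_eq_iff sum_component)
    then have "transpose (P j n) = P j n" unfolding tr by (simp add: P_def mean_def)
    then show ?thesis by (simp add: Msym_def)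
  qed
  have RM: "R j x \<in> Msym" for j x
  proof (cases "\<exists>n<m j. x \<in> C j n")
    case True
    then obtain n where "R j x = P j n" using RC by blast
    then show ?thesis using PM by simp
  next
    case False
    then have "R j x = tensor e1" using R0 by blast
    then show ?thesis using tensor_in_K[OF e1] K_subset_Msym by auto
  qed
  have RL: "R j \<in> Linf \<Omega>" for j
    unfolding Linf_def using Rm RM Rb by (intro CollectI conjI AE_I2 exI[of _ 1]) auto
  have Qb: "AE x in \<mu>. norm (Q x) \<le> 1" using K by eventually_elim (rule norm_K_le)
  \<comment> \<open>The difference is at most \<open>2 * \<eta> j\<close> on the pieces, whose total
    measure is at most \<open>L\<close>, and at most 2 on the rest, whose measure is below
    \<open>\<eta> j\<close>.\<close>
  have close: "norm ((LINT x:E|\<mu>. R j x) - (LINT x:E|\<mu>. Q x)) \<le> (2 * L + 2) * \<eta> j" if E: "E \<in> sets \<mu>" for E j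
  proof -
    let ?d = "\<lambda>x. norm (R j x - Q x)"
    have dm: "(\<lambda>x. R j x - Q x) \<in> borel_measurable \<mu>" "?d \<in> borel_measurable \<mu>" using Rm[of j] Qm by auto
    have db: "AE x in \<mu>. \<bar>?d x\<bar> \<le> 2"
      using Qb
    proof eventually_elim
      case (elim x)
      then show ?case using norm_triangle_ineq4[of "R j x" "Q x"] Rb[of j x] by simp
    qed
    have di: "integrable \<mu> ?d" by (rule integrable_bounded[OF dm(2)]) (use db in simp)
    have "(LINT x:E|\<mu>. R j x) - (LINT x:E|\<mu>. Q x) = (LINT x:E|\<mu>. R j x - Q x)"
      by (intro set_integral_diff(2)[symmetric] set_integrable_bounded[OF Rm AE_I2[OF Rb] E] set_integrable_bounded[OF Qm Qb E])
    also have "norm \<dots> \<le> (LINT x|\<mu>. norm (indicator E x *\<^sub>R (R j x - Q x)))"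
      unfolding set_lebesgue_integral_def by (rule integral_norm_bound)
    also have "\<dots> \<le> (LINT x|\<mu>. ?d x)"
    proof (rule integral_mono[OF _ di])
      show "integrable \<mu> (\<lambda>x. norm (indicator E x *\<^sub>R (R j x - Q x)))"
        by (intro integrable_norm integrable_mult_indicator E integrable_bounded[OF dm(1)]) (use db in simp)
    qed (auto simp: indicator_def)
    also have "\<dots> \<le> (\<Sum>n<m j. LINT x:C j n|\<mu>. ?d x) + 2 * (L - (\<Sum>n<m j. measure \<mu> (C j n)))"
      using integral_split_pieces[of "{..<m j}" "C j" ?d 2] Cs C(3) dm db by (simp add: L_def abs_le_iff)
    also have "(\<Sum>n<m j. LINT x:C j n|\<mu>. ?d x) \<le> (\<Sum>n<m j. 2 * \<eta> j * measure \<mu> (C j n))"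
    proof (rule sum_mono)
      fix n assume "n \<in> {..<m j}"
      then have n: "n < m j" by simp
      have "(LINT x|\<mu>. indicator (C j n) x *\<^sub>R ?d x) \<le> (LINT x|\<mu>. 2 * \<eta> j * indicator (C j n) x)"
      proof (rule integral_mono)
        show "integrable \<mu> (\<lambda>x. indicator (C j n) x *\<^sub>R ?d x)"
          by (intro integrable_mult_indicator Cs n di)
        show "integrable \<mu> (\<lambda>x. 2 * \<eta> j * indicator (C j n) x)"
          using integrable_indicator_mu[OF Cs[OF n]] by simp
        show "indicator (C j n) x *\<^sub>R ?d x \<le> 2 * \<eta> j * indicator (C j n) x" for x
          using CQ(2)[OF n] RC[OF n] by (auto simp: indicator_def P_def)
      qed
      also have "\<dots> = 2 * \<eta> j * measure \<mu> (C j n)" using C(2)[OF n] by (simp add: Int_absorb2)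
      finally show "(LINT x:C j n|\<mu>. ?d x) \<le> 2 * \<eta> j * measure \<mu> (C j n)" by (simp add: set_lebesgue_integral_def)
    qed
    also have "\<dots> \<le> 2 * \<eta> j * L"
    proof -
      have "(\<Sum>n<m j. measure \<mu> (C j n)) = measure \<mu> (\<Union>n<m j. C j n)"
        using Cs C(3) by (intro finite_measure_finite_Union[symmetric]) (auto simp: disjoint_family_on_def)
      also have "\<dots> \<le> L" unfolding L_def using bounded_measure[of "\<Union>n<m j. C j n"] by simp
      finally show ?thesis using \<eta>[of j] by (simp add: mult_left_mono flip: sum_distrib_left)
    qed
    finally show ?thesis using C(4)[of j] by (simp add: algebra_simps)
  qed
  have lim: "(\<lambda>j. LINT x|\<mu>. R j x \<bullet> \<Phi> x) \<longlonglongrightarrow> (LINT x|\<mu>. Q x \<bullet> \<Phi> x)" if "\<Phi> \<in> L1 \<Omega>" for \<Phi>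
  proof (rule tendsto_integral_inner[OF Rm AE_I2[OF Rb] Qm Qb])
    fix E assume E: "E \<in> sets \<mu>"
    have "(\<lambda>j. (2 * L + 2) * \<eta> j) \<longlonglongrightarrow> (2 * L + 2) * 0" by (intro tendsto_intros \<eta>0)
    then have "(\<lambda>j. (2 * L + 2) * \<eta> j) \<longlonglongrightarrow> 0" by simp
    with always_eventually[OF allI[OF close[OF E]]]
    have "(\<lambda>j. (LINT x:E|\<mu>. R j x) - (LINT x:E|\<mu>. Q x)) \<longlonglongrightarrow> 0"
      by (rule Lim_null_comparison)
    then show "(\<lambda>j. LINT x:E|\<mu>. R j x) \<longlonglongrightarrow> (LINT x:E|\<mu>. Q x)" by (simp add: LIM_zero_iff)
  qed (use that in \<open>auto simp: L1_def\<close>)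
  have ev1: "eventually (\<lambda>j. R j \<in> U) sequentially"
    by (rule eventually_in_weak_star_open[OF U(1) RL U(2) lim])
  \<comment> \<open>\<open>27 * M\<close> is \<open>9 * M\<close> for the envelope outside the
    pieces plus \<open>18 * M\<close> for the sites there; \<open>3 * L\<close> is half of the
    excess \<open>6 * \<eta> j\<close> over the pieces, and 1 is the discretization error.\<close>
  have "(\<lambda>j. 3/2 * (LINT x|\<mu>. real_envelope (Q x)) + (27 * M + 3 * L + 1) * \<eta> j) \<longlonglongrightarrow> 3/2 * (LINT x|\<mu>. real_envelope (Q x)) + (27 * M + 3 * L + 1) * 0"
    by (intro tendsto_intros \<eta>0)
  then have ev2: "eventually (\<lambda>j. 3/2 * (LINT x|\<mu>. real_envelope (Q x)) + (27 * M + 3 * L + 1) * \<eta> j < s) sequentially"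
    using s by (intro order_tendstoD(2)) auto
  obtain j where j: "R j \<in> U" "3/2 * (LINT x|\<mu>. real_envelope (Q x)) + (27 * M + 3 * L + 1) * \<eta> j < s"
    using eventually_conj[OF ev1 ev2] by (auto simp: eventually_sequentially)
  let ?I = "{..<m j}" and ?u = "mixture {..<m j} (C j) (v j)"
  have u: "?u \<epsilon> i \<in> S2" for \<epsilon> i using C(7) by (simp add: mixture_def S2_def)
  have "((\<lambda>\<epsilon>. LINT x|\<mu>. step_field \<epsilon> (?u \<epsilon>) x \<bullet> \<Phi> x) \<longlongrightarrow> (LINT x|\<mu>. R j x \<bullet> \<Phi> x)) (at_right 0)"
    if "\<Phi> \<in> L1 \<Omega>" for \<Phi>
  proof (rule recovery[where N="N j"])
    show "integrable \<mu> \<Phi>" using that by (simp add: L1_def)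
    show "R j x = mean (N j k) (\<lambda>i. tensor (v j k i))" if "k \<in> ?I" "x \<in> C j k" for k x
      using RC[of k j x] that by (simp add: P_def)
    show "R j x = tensor (axis 1 1)" if "\<And>k. k \<in> ?I \<Longrightarrow> x \<notin> C j k" for x
      using R0[of j x] that by (simp add: e1_def)
  qed (use C Rm in auto)
  then have ev3: "eventually (\<lambda>\<epsilon>. step_field \<epsilon> (?u \<epsilon>) \<in> U) (at_right 0)"
    by (rule eventually_in_weak_star_open[OF U(1) step_field_Linf[OF u] j(1)])
  have bound: "(\<Sum>k\<in>?I. 1/2 * (measure \<mu> (C j k) * mean (N j k) (square_energy f (v j k))))
     + 18 * M * (L - (\<Sum>k\<in>?I. measure \<mu> (C j k))) + \<eta> j \<le> s"
  proof -
    have piece: "1/2 * (measure \<mu> (C j k) * mean (N j k) (square_energy f (v j k))) \<le> 3/2 * (LINT x:C j k|\<mu>. real_envelope (Q x)) + 3 * \<eta> j * measure \<mu> (C j k)"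
      if "k \<in> ?I" for k
    proof -
      have k: "k < m j" using that by simp
      let ?q = "mean (N j k) (square_energy f (v j k))"
      have gi: "integrable \<mu> (\<lambda>x. indicator (C j k) x *\<^sub>R real_envelope (Q x))"
        using Cs[OF k] by (intro integrable_mult_indicator integrable_g Q K)
      have ii: "integrable \<mu> (indicat_real (C j k))" using Cs[OF k] by (rule integrable_indicator_mu)
      have mi: "(LINT x|\<mu>. indicator (C j k) x) = measure \<mu> (C j k)" using C(2)[OF k] by (simp add: Int_absorb2)
      have "(LINT x|\<mu>. ?q * indicator (C j k) x) \<le> (LINT x|\<mu>. 3 * (indicator (C j k) x *\<^sub>R real_envelope (Q x)) + 6 * \<eta> j * indicator (C j k) x)"
      proof (rule integral_mono)
        show "integrable \<mu> (\<lambda>x. ?q * indicator (C j k) x)" using ii by simp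
        show "integrable \<mu> (\<lambda>x. 3 * (indicator (C j k) x *\<^sub>R real_envelope (Q x)) + 6 * \<eta> j * indicator (C j k) x)"
          by (intro Bochner_Integration.integrable_add integrable_mult_right gi ii)
        show "?q * indicator (C j k) x \<le> 3 * (indicator (C j k) x *\<^sub>R real_envelope (Q x)) + 6 * \<eta> j * indicator (C j k) x" for x
          using CQ(3)[OF k, of x] by (auto simp: indicator_def)
      qed
      moreover have "(LINT x|\<mu>. ?q * indicator (C j k) x) = ?q * measure \<mu> (C j k)"
        by (simp only: integral_mult_right_zero mi)
      moreover have "(LINT x|\<mu>. 3 * (indicator (C j k) x *\<^sub>R real_envelope (Q x)) + 6 * \<eta> j * indicator (C j k) x)
         = 3 * (LINT x:C j k|\<mu>. real_envelope (Q x)) + 6 * \<eta> j * measure \<mu> (C j k)"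
        unfolding set_lebesgue_integral_def
        by (subst Bochner_Integration.integral_add[OF integrable_mult_right[OF gi] integrable_mult_right[OF ii]])
           (simp only: integral_mult_right_zero mi)
      ultimately have "?q * measure \<mu> (C j k) \<le> 3 * (LINT x:C j k|\<mu>. real_envelope (Q x)) + 6 * \<eta> j * measure \<mu> (C j k)"
        by (simp only:)
      then show ?thesis by (simp add: mult.commute)
    qed
    have 1: "(\<Sum>k\<in>?I. 1/2 * (measure \<mu> (C j k) * mean (N j k) (square_energy f (v j k))))
        \<le> 3/2 * (\<Sum>k\<in>?I. LINT x:C j k|\<mu>. real_envelope (Q x)) + 3 * \<eta> j * (\<Sum>k\<in>?I. measure \<mu> (C j k))"
      unfolding sum_distrib_left sum.distrib[symmetric] by (intro sum_mono piece)
    have "\<bar>(LINT x|\<mu>. real_envelope (Q x)) - (\<Sum>k\<in>?I. LINT x:C j k|\<mu>. real_envelope (Q x))\<bar> \<le> 6 * M * (L - (\<Sum>k\<in>?I. measure \<mu> (C j k)))"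
      unfolding L_def using Cs C(3) M_nonneg by (intro integral_split_pieces gm integrable_g(2)[OF Q K]) auto
    moreover have "6 * M * (L - (\<Sum>k\<in>?I. measure \<mu> (C j k))) \<le> 6 * M * \<eta> j"
      using C(4)[of j] M_nonneg by (intro mult_left_mono) auto
    ultimately have 2: "(\<Sum>k\<in>?I. LINT x:C j k|\<mu>. real_envelope (Q x)) \<le> (LINT x|\<mu>. real_envelope (Q x)) + 6 * M * \<eta> j" by linarith
    have 3: "18 * M * (L - (\<Sum>k\<in>?I. measure \<mu> (C j k))) \<le> 18 * M * \<eta> j"
      using C(4)[of j] M_nonneg by (intro mult_left_mono) auto
    have "(\<Sum>k\<in>?I. measure \<mu> (C j k)) = measure \<mu> (\<Union>k\<in>?I. C j k)"
      using Cs C(3) by (intro finite_measure_finite_Union[symmetric]) (auto simp: disjoint_family_on_def)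
    also have "\<dots> \<le> L" unfolding L_def using bounded_measure[of "\<Union>k\<in>?I. C j k"] by simp
    finally have 4: "3 * \<eta> j * (\<Sum>k\<in>?I. measure \<mu> (C j k)) \<le> 3 * \<eta> j * L" using \<eta>[of j] by (intro mult_left_mono) auto
    have 5: "(27 * M + 3 * L + 1) * \<eta> j = 9 * M * \<eta> j + 18 * M * \<eta> j + 3 * \<eta> j * L + \<eta> j" by (simp add: algebra_simps)
    have "A + t + \<eta> j \<le> s"
      if "A \<le> 3/2 * G + w" "G \<le> G0 + 6 * M * \<eta> j" "t \<le> 18 * M * \<eta> j" "w \<le> 3 * \<eta> j * L"
        "3/2 * G0 + (9 * M * \<eta> j + 18 * M * \<eta> j + 3 * \<eta> j * L + \<eta> j) < s" for A t G w G0
      using that by argo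
    from this[OF 1 2 3 4 j(2)[unfolded 5]] show ?thesis .
  qed
  have "eventually (\<lambda>\<epsilon>. \<epsilon>^3 * energy f (sites \<epsilon> \<Omega>) (?u \<epsilon>) \<le>
     (\<Sum>k\<in>?I. 1/2 * (measure \<mu> (C j k) * mean (N j k) (square_energy f (v j k))))
     + 18 * M * (measure \<mu> \<Omega> - (\<Sum>k\<in>?I. measure \<mu> (C j k))) + \<eta> j) (at_right 0)"
    using C \<eta>[of j] by (intro mixture_energy) auto
  then show ?thesis
    using ev3 eventually_pos_at_right_0
  proof eventually_elim
    case (elim \<epsilon>)
    have "F_eps f \<Omega> \<epsilon> (step_field \<epsilon> (?u \<epsilon>)) \<le> ereal (\<epsilon>^3 * energy f (sites \<epsilon> \<Omega>) (?u \<epsilon>))"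
      by (rule F_eps_step_field[OF elim(3) u])
    also have "\<dots> \<le> ereal s" using elim(1) bound by (simp add: L_def)
    finally show ?case using elim(2) by blast
  qed
qed

lemma Gamma_limsup_F_eps:
  assumes Q: "Q \<in> Linf \<Omega>"
  shows "Gamma_limsup (weak_star \<Omega>) (at_right 0) (F_eps f \<Omega>) Q \<le> F_lim f \<Omega> Q"
proof (rule Gamma_limsup_le)
  fix U s assume U: "openin (weak_star \<Omega>) U" "Q \<in> U" "F_lim f \<Omega> Q < ereal s"
  then have "AE x in \<mu>. Q x \<in> K" "3/2 * (LINT x|\<mu>. real_envelope (Q x)) < s"
    using Q by (auto simp: F_lim_def split: if_splits)
  then show "eventually (\<lambda>\<epsilon>. \<exists>y\<in>U. F_eps f \<Omega> \<epsilon> y \<le> ereal s) (at_right 0)"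
    using limsup_bound[OF Q] U by blast
qed

lemma Gamma_converges_F_eps: "Gamma_converges (weak_star \<Omega>) (at_right 0) (F_eps f \<Omega>) (F_lim f \<Omega>)"
  unfolding Gamma_converges_def topspace_weak_star
proof
  fix Q assume Q: "Q \<in> Linf \<Omega>"
  have "Gamma_liminf (weak_star \<Omega>) (at_right 0) (F_eps f \<Omega>) Q \<le> Gamma_limsup (weak_star \<Omega>) (at_right 0) (F_eps f \<Omega>) Q"
    by (rule Gamma_liminf_le_limsup) simp
  then show "Gamma_liminf (weak_star \<Omega>) (at_right 0) (F_eps f \<Omega>) Q = F_lim f \<Omega> Q \<and>
      Gamma_limsup (weak_star \<Omega>) (at_right 0) (F_eps f \<Omega>) Q = F_lim f \<Omega> Q"
    using Gamma_liminf_F_eps[OF Q] Gamma_limsup_F_eps[OF Q] by (meson order_antisym order_trans)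
qed

end

section \<open>The homogenized energy density\<close>

lemma W3_eq_cells: "W3 = cells 1 {(0,0,0)}"
proof -
  have "emb (0,0,0) = 0" by (simp add: vec_eq_iff forall_3 emb_nth)
  then show ?thesis by (auto simp: cells_def nearest_eq_iff_W3)
qed

lemma W3_measure: "W3 \<in> lmeasurable" "measure lebesgue W3 = 1"
  unfolding W3_eq_cells using measure_cell[of 1 "(0,0,0)"] by simp_all

lemma bounded_W3: "bounded W3"
proof -
  have "norm x \<le> 2" if "x \<in> W3" for x
  proof -
    have "emb (0,0,0) = 0" by (simp add: vec_eq_iff forall_3 emb_nth)
    then show ?thesis using norm_nearest[of x] that nearest_eq_iff_W3[of x "(0,0,0)"] by simp
  qed
  then show ?thesis unfolding bounded_iff by blast
qed

lemma negligible_frontier_W3: "negligible (frontier W3)"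
proof (rule negligible_convex_frontier)
  have eq: "W3 = (\<Inter>k. {x. x $ k \<ge> - 1/2} \<inter> {x. x $ k < 1/2})" by (auto simp: W3_def)
  have "convex {x :: real^3. x $ k \<ge> - 1/2}" "convex {x :: real^3. x $ k < 1/2}" for k
    using convex_halfspace_ge[of "- 1/2" "axis k (1::real)"] convex_halfspace_lt[of "axis k (1::real)" "1/2"]
    by (simp_all add: inner_axis' )
  then show "convex W3" unfolding eq by (intro convex_INT convex_Int)
qed

lemma scaled_W3: "0 < h \<Longrightarrow> x \<in> (\<lambda>w. h *\<^sub>R w) ` W3 \<longleftrightarrow> inverse h *\<^sub>R x \<in> W3"
  by (auto simp: image_iff intro!: bexI[of _ "inverse h *\<^sub>R x"])

text \<open>The integer points of a cube of side \<open>h\<close> are the lattice of step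
  \<open>1 / h\<close> in the unit cube, so the counting results for domains apply.\<close>

lemma cube_sites_eq: "0 < h \<Longrightarrow> cube_sites h = emb ` sites (inverse h) W3"
  unfolding cube_sites_def range_emb[symmetric] by (auto simp: scaled_W3 sites_def)

text \<open>The weight vanishes for differences outside \<open>site_box 1\<close>; the remaining
  pairs are grouped by their difference.\<close>

lemma cube_energy_eq:
  assumes h: "0 < h"
  shows "cube_energy f h u = energy f (sites (inverse h) W3) (\<lambda>i. u (emb i))"
proof -
  let ?S = "sites (inverse h) W3"
  have fin: "finite ?S" using h by (intro finite_sites bounded_W3) simp
  let ?Y = "{(\<xi>,i). i \<in> ?S \<and> i + \<xi> \<in> ?S}"
  define H where "H = (\<lambda>(\<xi>,i). (emb \<xi>, emb i))"
  have set_eq: "{(\<xi>,\<beta>). \<xi> \<in> Z3 \<and> \<beta> \<in> cube_sites h \<and> \<beta> + \<xi> \<in> (\<lambda>w. h *\<^sub>R w) ` W3} = H ` ?Y"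
  proof (intro equalityI subsetI)
    fix p assume "p \<in> {(\<xi>,\<beta>). \<xi> \<in> Z3 \<and> \<beta> \<in> cube_sites h \<and> \<beta> + \<xi> \<in> (\<lambda>w. h *\<^sub>R w) ` W3}"
    then obtain x y where p: "p = (x, y)" "x \<in> range emb" "y \<in> emb ` ?S" "y + x \<in> (\<lambda>w. h *\<^sub>R w) ` W3"
      unfolding cube_sites_eq[OF h] range_emb[symmetric] by (cases p) simp
    obtain \<xi> i where xi: "x = emb \<xi>" "y = emb i" "i \<in> ?S" using p(2,3) by blast
    have "emb (i + \<xi>) \<in> (\<lambda>w. h *\<^sub>R w) ` W3" using p(4) by (simp add: xi emb_add)
    then have "i + \<xi> \<in> ?S" unfolding scaled_W3[OF h] by (simp add: sites_def)
    then show "p \<in> H ` ?Y"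
      using xi p(1) by (intro image_eqI[of _ _ "(\<xi>, i)"]) (simp_all add: H_def)
  next
    fix p assume "p \<in> H ` ?Y"
    then show "p \<in> {(\<xi>,\<beta>). \<xi> \<in> Z3 \<and> \<beta> \<in> cube_sites h \<and> \<beta> + \<xi> \<in> (\<lambda>w. h *\<^sub>R w) ` W3}"
      unfolding cube_sites_eq[OF h] range_emb[symmetric] using scaled_W3[OF h]
      by (auto simp: H_def sites_def emb_add simp del: add_Pair)
  qed
  have inj: "inj_on H ?Y"
  proof (rule inj_onI)
    fix p q assume "H p = H q"
    then have "emb (fst p) = emb (fst q)" "emb (snd p) = emb (snd q)"
      by (simp_all add: H_def case_prod_beta)
    then show "p = q" by (intro prod_eqI injD[OF inj_emb])
  qed
  have "cube_energy f h u = (\<Sum>(\<xi>,i)\<in>?Y. wt \<xi> * f (u (emb i)) (u (emb (i + \<xi>))))"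
    unfolding cube_energy_def set_eq
    by (subst sum.reindex[OF inj]) (simp add: H_def case_prod_beta c_weight_emb emb_add comp_def)
  also have "\<dots> = (\<Sum>(\<xi>,i)\<in>(SIGMA \<xi>:site_box 1. {i\<in>?S. i + \<xi> \<in> ?S}). wt \<xi> * f (u (emb i)) (u (emb (i + \<xi>))))"
  proof (rule sum.mono_neutral_right)
    have "?Y \<subseteq> (\<lambda>(i,j). (j - i, i)) ` (?S \<times> ?S)"
    proof
      fix p assume "p \<in> ?Y"
      then obtain \<xi> i where "p = (\<xi>, i)" "i \<in> ?S" "i + \<xi> \<in> ?S" by blast
      then show "p \<in> (\<lambda>(i,j). (j - i, i)) ` (?S \<times> ?S)"
        by (intro image_eqI[of _ _ "(i, i + \<xi>)"]) auto
    qed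
    then show "finite ?Y" by (rule finite_subset) (intro finite_imageI finite_cartesian_product fin)
    show "\<forall>p\<in>?Y - (SIGMA \<xi>:site_box 1. {i\<in>?S. i + \<xi> \<in> ?S}). (case p of (\<xi>, i) \<Rightarrow> wt \<xi> * f (u (emb i)) (u (emb (i + \<xi>)))) = 0"
    proof
      fix p assume p: "p \<in> ?Y - (SIGMA \<xi>:site_box 1. {i\<in>?S. i + \<xi> \<in> ?S})"
      obtain \<xi> i where "p = (\<xi>, i)" by (cases p)
      with p have "\<xi> \<notin> site_box 1" "p = (\<xi>, i)" by auto
      then show "(case p of (\<xi>, i) \<Rightarrow> wt \<xi> * f (u (emb i)) (u (emb (i + \<xi>)))) = 0"
        by (simp add: wt_outside)
    qed
  qed auto
  also have "\<dots> = (\<Sum>\<xi>\<in>site_box 1. \<Sum>i\<in>{i\<in>?S. i + \<xi> \<in> ?S}. wt \<xi> * f (u (emb i)) (u (emb (i + \<xi>))))"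
    using fin by (intro sum.Sigma[symmetric]) auto
  also have "\<dots> = energy f ?S (\<lambda>i. u (emb i))"
    by (simp add: energy_def pairs_sum_def sum_distrib_left)
  finally show ?thesis .
qed

lemma eventually_inverse_at_top: "eventually P (at_right 0) \<Longrightarrow> eventually (\<lambda>h::real. P (inverse h)) at_top"
  using filterlim_inverse_at_right_top filterlim_iff by blast

section \<open>Limits on growing cubes\<close>

context spin
begin

abbreviation cube_average where
  "cube_average S u \<equiv> (1 / real (card S)) *\<^sub>R (\<Sum>i\<in>S. tensor (u i))"

lemma sum_tensor_average: "finite S \<Longrightarrow> S \<noteq> {} \<Longrightarrow> (\<Sum>i\<in>S. tensor (u i)) = real (card S) *\<^sub>R cube_average S u"
  by simp

lemma average_in_K:
  assumes "finite S" "S \<noteq> {}" "\<And>i. i \<in> S \<Longrightarrow> u i \<in> S2"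
  shows "cube_average S u \<in> K"
proof -
  have "(\<Sum>i\<in>S. (1 / real (card S)) *\<^sub>R tensor (u i)) \<in> K"
    using assms by (intro convex_sum convex_K tensor_in_K) auto
  then show ?thesis by (simp add: scaleR_sum_right)
qed

text \<open>Relaxing the constraint on the average to a ball replaces the envelope by its infimum
  there; 3/2 of this value is the inner limit in the density at fixed \<rho>.\<close>

definition ball_min :: "real^3^3 \<Rightarrow> real \<Rightarrow> real" where
  "ball_min Q \<rho> = (INF Y\<in>K \<inter> cball Q \<rho>. real_of_ereal (envelope f Y))"

lemma bdd_below_envelope: "bdd_below ((\<lambda>Y. real_of_ereal (envelope f Y)) ` (K \<inter> A))"
proof (rule bdd_belowI)
  fix x assume "x \<in> (\<lambda>Y. real_of_ereal (envelope f Y)) ` (K \<inter> A)"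
  then obtain Y where "Y \<in> K" "x = real_of_ereal (envelope f Y)" by blast
  then show "- (6 * M) \<le> x" using abs_le_D2[OF abs_envelope_le[of Y]] by linarith
qed

lemma cube_asymptotics:
  assumes e: "0 < e" and N: "0 \<le> N"
  shows "eventually (\<lambda>h. 1 \<le> h \<and> finite (sites (inverse h) W3) \<and> sites (inverse h) W3 \<noteq> {} \<and>
     \<bar>real (card (sites (inverse h) W3)) - h^3\<bar> \<le> e * h^3 \<and>
     real (card (bd 1 (sites (inverse h) W3))) \<le> e * h^3 \<and> real (card (bd N (sites (inverse h) W3))) \<le> e * h^3) at_top"
proof -
  have 1: "eventually (\<lambda>\<epsilon>. \<bar>\<epsilon>^3 * real (card (sites \<epsilon> W3)) - 1\<bar> \<le> e) (at_right 0)"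
    using card_sites[OF bounded_W3 negligible_frontier_W3 W3_measure(1) e] by (simp add: W3_measure)
  have 2: "eventually (\<lambda>\<epsilon>. \<epsilon>^3 * real (card (bd 1 (sites \<epsilon> W3))) \<le> e) (at_right 0)"
    "eventually (\<lambda>\<epsilon>. \<epsilon>^3 * real (card (bd N (sites \<epsilon> W3))) \<le> e) (at_right 0)"
    by (intro card_bd_sites bounded_W3 negligible_frontier_W3 e)+
  show ?thesis
    using eventually_inverse_at_top[OF 1] eventually_inverse_at_top[OF 2(1)] eventually_inverse_at_top[OF 2(2)]
      eventually_ge_at_top[of 1]
  proof eventually_elim
    case (elim h)
    have h: "0 < h" "0 < h^3" using elim(4) by auto
    have resc: "x \<le> e * h^3" if "inverse h ^ 3 * x \<le> e" for x
      using that h by (simp add: field_simps power_inverse)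
    have "\<bar>x - h^3\<bar> \<le> e * h^3" if "\<bar>inverse h ^ 3 * x - 1\<bar> \<le> e" for x
    proof -
      have "inverse h ^ 3 * x - 1 = (x - h^3) / h^3" using h by (simp add: field_simps power_inverse)
      then show ?thesis using that h by (simp add: field_simps)
    qed
    moreover have "(0,0,0) \<in> sites (inverse h) W3"
    proof -
      have "emb (0,0,0) = 0" by (simp add: vec_eq_iff forall_3 emb_nth)
      then show ?thesis by (simp add: sites_def W3_def)
    qed
    then have "sites (inverse h) W3 \<noteq> {}" by blast
    moreover have "finite (sites (inverse h) W3)" using h by (intro finite_sites bounded_W3) simp
    ultimately show ?case using elim resc by simp
  qed
qed

text \<open>Spins on the cube are extended by \<open>axis 1 1\<close> to all integer sites, because
  the energy estimates require unit values everywhere.\<close>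

lemma cube_min_eq:
  assumes "0 < h"
  shows "cube_min f Q \<rho> h = (INF u\<in>{u. (\<forall>i. u i \<in> S2) \<and> cube_average (sites (inverse h) W3) u \<in> cball Q \<rho>}.
     ereal (energy f (sites (inverse h) W3) u))"
proof (rule antisym)
  let ?S = "sites (inverse h) W3"
  have card: "card (cube_sites h) = card ?S"
    unfolding cube_sites_eq[OF assms] by (intro card_image) (meson inj_emb inj_on_subset subset_UNIV)
  have sum: "(\<Sum>\<beta>\<in>cube_sites h. tensor (u \<beta>)) = (\<Sum>i\<in>?S. tensor (u (emb i)))" for u
    unfolding cube_sites_eq[OF assms] using inj_emb by (subst sum.reindex) (auto intro: inj_on_subset)
  show "cube_min f Q \<rho> h \<le> (INF u\<in>{u. (\<forall>i. u i \<in> S2) \<and> cube_average ?S u \<in> cball Q \<rho>}. ereal (energy f ?S u))"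
  proof (rule INF_greatest)
    fix u assume u: "u \<in> {u. (\<forall>i. u i \<in> S2) \<and> cube_average ?S u \<in> cball Q \<rho>}"
    define w where "w = (\<lambda>z. u (inv emb z))"
    have w: "w (emb i) = u i" for i by (simp add: w_def inv_f_f[OF inj_emb])
    have "w \<in> {u. (\<forall>\<beta>\<in>cube_sites h. u \<beta> \<in> S2) \<and> (1 / real (card (cube_sites h))) *\<^sub>R (\<Sum>\<beta>\<in>cube_sites h. tensor (u \<beta>)) \<in> cball Q \<rho>}"
      using u unfolding card sum by (simp add: cube_sites_eq[OF assms] w del: split_paired_All)
    then have "cube_min f Q \<rho> h \<le> ereal (cube_energy f h w)"
      unfolding cube_min_def by (rule INF_lower)
    then show "cube_min f Q \<rho> h \<le> ereal (energy f ?S u)"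
      by (simp add: cube_energy_eq[OF assms] w)
  qed
  show "(INF u\<in>{u. (\<forall>i. u i \<in> S2) \<and> cube_average ?S u \<in> cball Q \<rho>}. ereal (energy f ?S u)) \<le> cube_min f Q \<rho> h"
    unfolding cube_min_def
  proof (rule INF_greatest)
    fix w assume w: "w \<in> {u. (\<forall>\<beta>\<in>cube_sites h. u \<beta> \<in> S2) \<and> (1 / real (card (cube_sites h))) *\<^sub>R (\<Sum>\<beta>\<in>cube_sites h. tensor (u \<beta>)) \<in> cball Q \<rho>}"
    define u where "u i = (if i \<in> ?S then w (emb i) else axis 1 1)" for i
    have S: "w (emb i) \<in> S2" if "i \<in> ?S" for i using w that by (simp add: cube_sites_eq[OF assms])
    then have "u i \<in> S2" for i by (simp add: u_def S2_def)
    moreover have "(\<Sum>i\<in>?S. tensor (u i)) = (\<Sum>i\<in>?S. tensor (w (emb i)))" by (simp add: u_def)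
    ultimately have "u \<in> {u. (\<forall>i. u i \<in> S2) \<and> cube_average ?S u \<in> cball Q \<rho>}"
      using w unfolding card sum by simp
    then have "(INF u\<in>{u. (\<forall>i. u i \<in> S2) \<and> cube_average ?S u \<in> cball Q \<rho>}. ereal (energy f ?S u)) \<le> ereal (energy f ?S u)"
      by (rule INF_lower)
    also have "energy f ?S u = cube_energy f h w"
      unfolding cube_energy_eq[OF assms] by (rule energy_cong) (simp add: u_def)
    finally show "(INF u\<in>{u. (\<forall>i. u i \<in> S2) \<and> cube_average ?S u \<in> cball Q \<rho>}. ereal (energy f ?S u)) \<le> ereal (cube_energy f h w)" .
  qed
qed

text \<open>The average of an admissible configuration is an unknown point of the compact set
  \<open>K \<inter> cball Q \<rho>\<close>. Finitely many minorants suffice on all of it, so the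
  constant of the boundary error does not depend on the configuration.\<close>

lemma cube_lower:
  assumes Q: "Q \<in> K" and \<delta>: "0 < \<delta>" and \<rho>: "0 < \<rho>"
  shows "eventually (\<lambda>h. ereal ((3/2 * ball_min Q \<rho> - \<delta>) * h^3) \<le> cube_min f Q \<rho> h) at_top"
proof -
  let ?G = "ball_min Q \<rho>"
  obtain A :: "nat \<Rightarrow> real^3^3" and b where Ab: "\<And>n. aff_minorant f (A n) (b n)"
     "\<And>Y s. Y \<in> K \<Longrightarrow> s < real_of_ereal (envelope f Y) \<Longrightarrow> \<exists>n. s < A n \<bullet> Y + b n"
    using countable_minorants by blast
  \<comment> \<open>After the factor 3/2 the loss \<open>\<delta>/3\<close> becomes
    \<open>\<delta>/2\<close>; the other half of \<delta> pays for collar and count.\<close>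
  define W where "W n = {Z. ?G - \<delta>/3 < A n \<bullet> Z + b n}" for n
  have cK: "compact (K \<inter> cball Q \<rho>)" by (intro compact_Int compact_K compact_cball)
  have oW: "open (W n)" for n unfolding W_def by (intro open_Collect_less continuous_intros)
  have cov: "K \<inter> cball Q \<rho> \<subseteq> (\<Union>n. W n)"
  proof
    fix Y assume Y: "Y \<in> K \<inter> cball Q \<rho>"
    have "?G \<le> real_of_ereal (envelope f Y)"
      unfolding ball_min_def by (intro cINF_lower bdd_below_envelope Y)
    then have "?G - \<delta>/3 < real_of_ereal (envelope f Y)" using \<delta> by linarith
    from Ab(2)[OF _ this] Y show "Y \<in> (\<Union>n. W n)" by (auto simp: W_def)
  qed
  obtain F where F: "finite F" "K \<inter> cball Q \<rho> \<subseteq> (\<Union>n\<in>F. W n)"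
    using compactE_image[OF cK oW cov] by metis
  define B where "B = (\<Sum>n\<in>F. 18 * M + 9/4 * norm (A n)) + 3/2 * \<bar>?G - \<delta>/3\<bar>"
  have B0: "0 \<le> B" using M_nonneg by (auto simp: B_def intro!: add_nonneg_nonneg sum_nonneg)
  define e where "e = (\<delta>/2) / (B + 1)"
  have e: "0 < e" "B * e \<le> \<delta>/2" using \<delta> B0 by (auto simp: e_def divide_simps mult_left_mono)
  show ?thesis
    using cube_asymptotics[OF e(1), of 0, simplified]
  proof eventually_elim
    case (elim h)
    then have h: "0 < h" "0 \<le> h^3" by auto
    let ?S = "sites (inverse h) W3"
    show "ereal ((3/2 * ?G - \<delta>) * h^3) \<le> cube_min f Q \<rho> h"
      unfolding cube_min_eq[OF h(1)]
    proof (rule INF_greatest)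
      fix u assume u: "u \<in> {u. (\<forall>i. u i \<in> S2) \<and> cube_average ?S u \<in> cball Q \<rho>}"
      define Y where "Y = cube_average ?S u"
      have "Y \<in> K" unfolding Y_def by (rule average_in_K) (use u elim in blast)+
      then have "Y \<in> K \<inter> cball Q \<rho>" using u by (simp add: Y_def del: split_paired_All)
      then obtain n where n: "n \<in> F" "?G - \<delta>/3 < A n \<bullet> Y + b n" using F(2) by (auto simp: W_def)
      have "(\<Sum>i\<in>?S. A n \<bullet> tensor (u i) + b n) = A n \<bullet> (\<Sum>i\<in>?S. tensor (u i)) + b n * real (card ?S)"
        by (simp add: sum.distrib inner_sum_right)
      also have "\<dots> = real (card ?S) * (A n \<bullet> Y + b n)"
        unfolding Y_def using elim by (subst sum_tensor_average) (auto simp: algebra_simps)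
      finally have s: "(\<Sum>i\<in>?S. A n \<bullet> tensor (u i) + b n) = real (card ?S) * (A n \<bullet> Y + b n)" .
      have "3/2 * (\<Sum>i\<in>?S. A n \<bullet> tensor (u i) + b n) - (18 * M + 9/4 * norm (A n)) * real (card (bd 1 ?S)) \<le> energy f ?S u"
        using u elim by (intro energy_ge_affine Ab) auto
      then have 1: "3/2 * (real (card ?S) * (A n \<bullet> Y + b n)) - (18 * M + 9/4 * norm (A n)) * real (card (bd 1 ?S)) \<le> energy f ?S u"
        unfolding s .
      have 2: "real (card ?S) * (?G - \<delta>/3) \<le> real (card ?S) * (A n \<bullet> Y + b n)"
        using n(2) by (intro mult_left_mono) auto
      have "\<bar>(real (card ?S) - h^3) * (?G - \<delta>/3)\<bar> \<le> (e * h^3) * \<bar>?G - \<delta>/3\<bar>"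
        unfolding abs_mult using elim by (intro mult_right_mono) auto
      then have 3: "h^3 * (?G - \<delta>/3) - e * h^3 * \<bar>?G - \<delta>/3\<bar> \<le> real (card ?S) * (?G - \<delta>/3)"
        by (simp add: abs_le_iff algebra_simps)
      have "(18 * M + 9/4 * norm (A n)) * real (card (bd 1 ?S)) \<le> (\<Sum>n\<in>F. 18 * M + 9/4 * norm (A n)) * (e * h^3)"
        using elim M_nonneg n(1) F(1) e(1) h
        by (intro mult_mono member_le_sum) (auto intro!: sum_nonneg)
      then have 4: "(18 * M + 9/4 * norm (A n)) * real (card (bd 1 ?S)) \<le> (B - 3/2 * \<bar>?G - \<delta>/3\<bar>) * (e * h^3)"
        by (simp add: B_def)
      have 5: "B * e * h^3 \<le> \<delta>/2 * h^3" using e(2) h(2) by (rule mult_right_mono)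
      have "(3/2 * ?G - \<delta>) * h^3 \<le> energy f ?S u"
      proof -
        have "E \<ge> (3/2 * G - \<delta>) * t"
          if "3/2 * c - x \<le> E" "c' \<le> c" "t * (G - \<delta>/3) - e * t * p \<le> c'" "x \<le> (B - 3/2 * p) * (e * t)" "B * e * t \<le> \<delta>/2 * t"
          for E G t c c' x p :: real
          using that by (simp add: algebra_simps)
        from this[OF 1 2 3 4 5] show ?thesis .
      qed
      then show "ereal ((3/2 * ?G - \<delta>) * h^3) \<le> ereal (energy f ?S u)" by simp
    qed
  qed
qed

text \<open>A near-minimizer \<open>Y\<close> may lie on the sphere of radius \<rho>, whereas
  configurations reach a prescribed mean only approximately. Moving it slightly towards
  \<open>Q\<close> makes room inside the ball, and convexity bounds the increase of the
  envelope.\<close>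

lemma cube_upper:
  assumes Q: "Q \<in> K" and \<delta>: "0 < \<delta>" and \<rho>: "0 < \<rho>"
  shows "eventually (\<lambda>h. cube_min f Q \<rho> h \<le> ereal ((3/2 * ball_min Q \<rho> + \<delta>) * h^3)) at_top"
proof -
  let ?G = "ball_min Q \<rho>"
  let ?g = "\<lambda>Y. real_of_ereal (envelope f Y)"
  \<comment> \<open>The mean cost uses \<open>3/2 * (3 * d)\<close> and the counting one more
    \<open>d\<close>, which stays below \<open>9 * d\<close>.\<close>
  define d where "d = \<delta>/9"
  have d: "0 < d" using \<delta> by (simp add: d_def)
  have "Q \<in> K \<inter> cball Q \<rho>" using Q \<rho> by simp
  then obtain Y where Y: "Y \<in> K" "dist Q Y \<le> \<rho>" "?g Y < ?G + d"
    using cInf_lessD[of "?g ` (K \<inter> cball Q \<rho>)" "?G + d"] d unfolding ball_min_def by fastforce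
  \<comment> \<open>The envelope varies by at most \<open>12 * M\<close> on \<open>K\<close>, so the
    move costs at most \<open>d\<close>; the 1 in the denominator covers
    \<open>M = 0\<close>.\<close>
  define t where "t = min 1 (d / (12 * M + 1))"
  have t: "0 < t" "t \<le> 1" "t * (12 * M) \<le> d"
  proof -
    show "0 < t" "t \<le> 1" using d M_nonneg by (auto simp: t_def)
    have "t * (12 * M) \<le> d / (12 * M + 1) * (12 * M + 1)"
      using d M_nonneg by (intro mult_mono) (auto simp: t_def)
    then show "t * (12 * M) \<le> d" using M_nonneg by simp
  qed
  define Z where "Z = t *\<^sub>R Q + (1 - t) *\<^sub>R Y"
  have ZK: "Z \<in> K" unfolding Z_def using Q Y t by (intro convexD[OF convex_K]) auto
  have "envelope f Z \<le> ereal (t * ?g Q + (1 - t) * ?g Y)"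
    unfolding Z_def using Q Y(1) K_subset_Msym t envelope_real by (intro convex_envelope) auto
  then have "?g Z \<le> t * ?g Q + (1 - t) * ?g Y" by (subst (asm) envelope_real[OF ZK]) simp
  also have "\<dots> = ?g Y + t * (?g Q - ?g Y)" by (simp add: algebra_simps)
  also have "\<dots> \<le> ?g Y + t * (12 * M)"
    using abs_le_D1[OF abs_envelope_le[OF Q]] abs_le_D2[OF abs_envelope_le[OF Y(1)]] t
    by (intro add_left_mono mult_left_mono) linarith+
  finally have gZ: "?g Z \<le> ?G + 2 * d" using Y(3) t(3) by linarith
  have "Z - Q = (1 - t) *\<^sub>R (Y - Q)" by (simp add: Z_def algebra_simps)
  then have "norm (Z - Q) = (1 - t) * dist Q Y" using t by (simp add: dist_norm norm_minus_commute)
  also have "\<dots> \<le> (1 - t) * \<rho>" using Y(2) t by (intro mult_left_mono) auto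
  finally have ZQ: "norm (Z - Q) \<le> (1 - t) * \<rho>" .
  \<comment> \<open>The move frees a margin \<open>t * \<rho>\<close>: half of it is for the error
    of the periodic mean, the other half for the incomplete period cells of the cube.\<close>
  define r where "r = min (t * \<rho> / 2) d"
  have r: "0 < r" "r \<le> t * \<rho> / 2" "r \<le> d" using t \<rho> d by (auto simp: r_def)
  obtain N v where v: "0 < N" "\<And>i. v i \<in> S2" "periodic N v" "norm (mean N (\<lambda>i. tensor (v i)) - Z) \<le> r"
     "mean N (square_energy f v) \<le> 3 * (?g Z + r)"
    using envelope_periodic[OF ZK r(1)] by blast
  \<comment> \<open>The bound 1/2 ensures at least \<open>h^3 / 2\<close> sites, and with
    \<open>t * \<rho> / 8\<close> the collar error \<open>2 * e * h^3\<close> is at most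
    \<open>t * \<rho> / 2\<close> per site. The \<open>45 * M\<close> is \<open>9 * M\<close> for
    the count plus \<open>36 * M\<close> for the two collars.\<close>
  define e where "e = min (1/2) (min (t * \<rho> / 8) (d / (45 * M + 1)))"
  have e: "0 < e" "e \<le> 1/2" "e \<le> t * \<rho> / 8" "45 * M * e \<le> d"
  proof -
    show "0 < e" using t \<rho> d M_nonneg by (auto simp: e_def)
    show "e \<le> 1/2" "e \<le> t * \<rho> / 8" unfolding e_def by linarith+
    have "(45 * M) * e \<le> (45 * M + 1) * (d / (45 * M + 1))"
      using d M_nonneg \<open>0 < e\<close> by (intro mult_mono) (auto simp: e_def)
    then show "45 * M * e \<le> d" using M_nonneg by simp
  qed
  have "0 \<le> N" using v(1) by simp
  show ?thesis
    using cube_asymptotics[OF e(1) \<open>0 \<le> N\<close>]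
  proof eventually_elim
    case (elim h)
    then have h: "0 < h" "0 < h^3" by auto
    let ?S = "sites (inverse h) W3"
    let ?c = "real (card ?S)"
    have fin: "finite ?S" "?S \<noteq> {}" using elim by auto
    have "\<bar>?c - h^3\<bar> \<le> e * h^3" using elim by blast
    moreover have "e * h^3 \<le> 1/2 * h^3" using e(2) h(2) by (intro mult_right_mono) auto
    ultimately have c: "1/2 * h^3 \<le> ?c" "\<bar>?c - h^3\<bar> \<le> e * h^3" by (auto simp: abs_le_iff)
    then have c0: "0 < ?c" using h by linarith
    have "norm ((\<Sum>i\<in>?S. tensor (v i)) - ?c *\<^sub>R mean N (\<lambda>i. tensor (v i))) \<le> 2 * 1 * real (card (bd N ?S))"
      using norm_tensor[OF v(2)] by (intro sum_periodic v(1) periodic_comp[OF v(3)] fin(1)) auto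
    also have "\<dots> \<le> 2 * (e * h^3)" using elim by simp
    also have "\<dots> \<le> 2 * (t * \<rho> / 8 * h^3)" using e(3) h by (intro mult_left_mono mult_right_mono) auto
    also have "\<dots> = t * \<rho> / 2 * (1/2 * h^3)" by simp
    also have "\<dots> \<le> t * \<rho> / 2 * ?c" using c t \<rho> by (intro mult_left_mono) auto
    finally have "norm (?c *\<^sub>R (cube_average ?S v - mean N (\<lambda>i. tensor (v i)))) \<le> t * \<rho> / 2 * ?c"
      using fin by (simp add: scaleR_right_diff_distrib)
    then have av: "norm (cube_average ?S v - mean N (\<lambda>i. tensor (v i))) \<le> t * \<rho> / 2"
      using c0 by (simp add: mult.commute)
    have "norm (cube_average ?S v - Q) \<le> t * \<rho> / 2 + t * \<rho> / 2 + (1 - t) * \<rho>"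
      by (rule norm_diff_triangle_le[OF norm_diff_triangle_le[OF av order_trans[OF v(4) r(2)]] ZQ])
    also have "\<dots> = \<rho>" by (simp add: algebra_simps)
    finally have "cube_average ?S v \<in> cball Q \<rho>" by (simp add: dist_norm norm_minus_commute)
    then have "cube_min f Q \<rho> h \<le> ereal (energy f ?S v)"
      unfolding cube_min_eq[OF h(1)] using v(2) by (intro INF_lower) auto
    moreover have "energy f ?S v \<le> (3/2 * ?G + \<delta>) * h^3"
    proof -
      let ?q = "mean N (square_energy f v)"
      have 1: "energy f ?S v \<le> 1/2 * (?c * ?q) + 18 * M * (real (card (bd 1 ?S)) + real (card (bd N ?S)))"
        by (rule energy_periodic_le[OF fin(1) v(2,1,3)])
      have 2: "18 * M * (real (card (bd 1 ?S)) + real (card (bd N ?S))) \<le> 18 * M * (e * h^3 + e * h^3)"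
        using elim M_nonneg by (intro mult_left_mono add_mono) auto
      have "\<bar>(?c - h^3) * ?q\<bar> \<le> (e * h^3) * (18 * M)"
        unfolding abs_mult using c abs_mean_square_energy_le[OF v(2,1)] e(1) h by (intro mult_mono) auto
      then have 3: "?c * ?q \<le> h^3 * ?q + 18 * M * (e * h^3)" by (simp add: abs_le_iff algebra_simps)
      have "?q \<le> 3 * (?G + 3 * d)" using v(5) gZ r(3) by argo
      then have 4: "h^3 * ?q \<le> h^3 * (3 * (?G + 3 * d))" using h by (intro mult_left_mono) auto
      have 5: "45 * M * e * h^3 \<le> d * h^3" using e(4) h by (intro mult_right_mono) auto
      have 6: "0 \<le> d * h^3" using d h by simp
      have "E \<le> (3/2 * G + 9 * d) * T"
        if "E \<le> 1/2 * x + y" "y \<le> 18 * M * (e * T + e * T)" "x \<le> z + 18 * M * (e * T)" "z \<le> T * (3 * (G + 3 * d))"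
           "45 * M * e * T \<le> d * T" "0 \<le> d * T" for E G T x y z :: real
        using that by (simp add: algebra_simps)
      from this[OF 1 2 3 4 5 6] show ?thesis by (simp add: d_def)
    qed
    ultimately show ?case by (metis ereal_less_eq(3) order_trans)
  qed
qed

text \<open>The centre \<open>Q\<close> gives the upper bound, lower semicontinuity at
  \<open>Q\<close> the lower one.\<close>

lemma ball_min_tendsto:
  assumes Q: "Q \<in> K"
  shows "((\<lambda>\<rho>. ball_min Q \<rho>) \<longlongrightarrow> real_of_ereal (envelope f Q)) (at_right 0)"
proof (rule tendstoI)
  let ?g = "\<lambda>Y. real_of_ereal (envelope f Y)"
  fix e :: real assume e: "0 < e"
  have "\<exists>r>0. \<forall>Y\<in>Msym. dist Y Q < r \<longrightarrow> ereal (?g Q - e/2) < envelope f Y"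
  proof (rule lsc_onD[OF lsc_envelope])
    show "Q \<in> Msym" using Q K_subset_Msym by blast
    show "ereal (?g Q - e/2) < envelope f Q" using e by (subst (2) envelope_real[OF Q]) simp
  qed
  then obtain r where r: "r > 0" "\<And>Y. Y \<in> Msym \<Longrightarrow> dist Y Q < r \<Longrightarrow> ereal (?g Q - e/2) < envelope f Y" by blast
  show "eventually (\<lambda>\<rho>. dist (ball_min Q \<rho>) (?g Q) < e) (at_right 0)"
  proof (rule eventually_at_right_0I[OF r(1)])
    fix \<rho> :: real assume \<rho>: "0 < \<rho>" "\<rho> < r"
    have QK: "Q \<in> K \<inter> cball Q \<rho>" using Q \<rho> by simp
    have "ball_min Q \<rho> \<le> ?g Q" unfolding ball_min_def by (intro cINF_lower bdd_below_envelope QK)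
    moreover have "?g Q - e/2 \<le> ball_min Q \<rho>"
      unfolding ball_min_def
    proof (rule cINF_greatest)
      show "K \<inter> cball Q \<rho> \<noteq> {}" using QK by blast
      fix Y assume Y: "Y \<in> K \<inter> cball Q \<rho>"
      then have YK: "Y \<in> K" "Y \<in> Msym" "dist Y Q < r" using K_subset_Msym \<rho> by (auto simp: dist_commute)
      from r(2)[OF YK(2,3)] show "?g Q - e/2 \<le> ?g Y" by (subst (asm) envelope_real[OF YK(1)]) simp
    qed
    ultimately show "dist (ball_min Q \<rho>) (?g Q) < e" using e by (simp add: dist_real_def)
  qed
qed

text \<open>For large \<open>h\<close> the two bounds make \<open>cube_min\<close> finite, so the
  division by \<open>h^3\<close> takes place in the reals; the limit in \<rho> is then that of
  \<open>ball_min\<close>.\<close>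

lemma has_f_hom_envelope:
  assumes Q: "Q \<in> K"
  shows "has_f_hom f Q (ereal (3/2) * envelope f Q)"
  unfolding has_f_hom_def
proof (intro exI[of _ "\<lambda>\<rho>. ereal (3/2 * ball_min Q \<rho>)"] conjI allI impI)
  fix \<rho> :: real assume \<rho>: "0 < \<rho>"
  let ?L = "3/2 * ball_min Q \<rho>"
  have near: "eventually (\<lambda>h. ereal (?L - \<delta>) \<le> cube_min f Q \<rho> h / ereal (h^3) \<and>
      cube_min f Q \<rho> h / ereal (h^3) \<le> ereal (?L + \<delta>)) at_top" if "0 < \<delta>" for \<delta>
    using cube_lower[OF Q that \<rho>] cube_upper[OF Q that \<rho>] eventually_gt_at_top[of 0]
  proof eventually_elim
    case (elim h)
    then have h: "0 < h^3" by simp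
    obtain x where x: "cube_min f Q \<rho> h = ereal x"
      using elim(1,2) by (cases "cube_min f Q \<rho> h") auto
    show ?case using elim(1,2) h by (simp add: x field_simps)
  qed
  show "((\<lambda>h. cube_min f Q \<rho> h / ereal (h^3)) \<longlongrightarrow> ereal ?L) at_top"
  proof (rule order_tendstoI)
    fix a assume "a < ereal ?L"
    from ereal_dense2[OF this] obtain s where s: "a < ereal s" "s < ?L" by auto
    show "eventually (\<lambda>h. a < cube_min f Q \<rho> h / ereal (h^3)) at_top"
      using near[of "?L - s"] s by (auto elim!: eventually_mono intro: less_le_trans)
  next
    fix a assume "ereal ?L < a"
    from ereal_dense2[OF this] obtain s where s: "ereal s < a" "?L < s" by auto
    show "eventually (\<lambda>h. cube_min f Q \<rho> h / ereal (h^3) < a) at_top"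
      using near[of "s - ?L"] s by (auto elim!: eventually_mono intro: le_less_trans)
  qed
next
  have "((\<lambda>\<rho>. ereal (3/2 * ball_min Q \<rho>)) \<longlongrightarrow> ereal (3/2 * real_of_ereal (envelope f Q))) (at_right 0)"
    by (intro tendsto_intros ball_min_tendsto Q)
  moreover have "ereal (3/2) * envelope f Q = ereal (3/2 * real_of_ereal (envelope f Q))"
    by (subst envelope_real[OF Q]) simp
  ultimately show "((\<lambda>\<rho>. ereal (3/2 * ball_min Q \<rho>)) \<longlongrightarrow> ereal (3/2) * envelope f Q) (at_right 0)"
    by simp
qed

end

theorem theorem3p19:
  fixes \<Omega> :: "(real^3) set" and f :: "real^3 \<Rightarrow> real^3 \<Rightarrow> real"
  assumes "open \<Omega>" and "bounded \<Omega>" and "lipschitz_boundary \<Omega>"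
    and "\<exists>M. \<forall>u\<in>S2. \<forall>v\<in>S2. \<bar>f u v\<bar> \<le> M"
    and "\<And>u v. u \<in> S2 \<Longrightarrow> v \<in> S2 \<Longrightarrow> f u v = f v u"
    and "\<And>u v. u \<in> S2 \<Longrightarrow> v \<in> S2 \<Longrightarrow> f u v = f u (- v) \<and> f u v = f (- u) v"
  shows "Gamma_converges (weak_star \<Omega>) (at_right 0) (F_eps f \<Omega>) (F_lim f \<Omega>) \<and>
         (\<forall>Q\<in>K. has_f_hom f Q (ereal (3/2) * lsc_convex_envelope Msym (fhat f) Q))"
proof -
  obtain M where M: "\<forall>u\<in>S2. \<forall>v\<in>S2. \<bar>f u v\<bar> \<le> M"
    using assms(4) by blast
  interpret domain_spin \<Omega> f M
    using assms(1,2,5) M negligible_frontier_if_lipschitz[OF assms(3)] by unfold_locales auto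
  show ?thesis
    using Gamma_converges_F_eps has_f_hom_envelope by blast
qed

end
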